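(* Let $N\ge1$, $\mu,\kappa>0$, and let $t\mapsto(\rho(t),u(t),T(t))$ be a $C^\infty$ solution on $\mathbb T^N$ of $$\partial_t\rho+\nabla\cdot(\rho u)=0,\quad \partial_t(\rho u)+\nabla\cdot(\rho u\otimes u)+\nabla(\rho T)=2\mu\nabla\cdot\{\nabla u\},$$ $$\partial_t\Big(\rho\frac{|u|^2}2+\frac N2\rho T\Big)+\nabla\cdot\Big(\rho\frac{|u|^2}2u+\frac{N+2}2\rho uT\Big)=2\mu\nabla\cdot(u\{\nabla u\})+\frac N2\kappa\Delta T,$$ normalized by $\int\rho=1$, $\int\rho u=0$, $\int\rho|u|^2/2+\frac N2\int\rho T=\frac N2$, and satisfying $\sup_{t\ge0}(\|\rho(t)\|_{C^k}+\|u(t)\|_{C^k}+\|T(t)\|_{C^k})<\infty$ for every $k\in\mathbb N$ and $\rho(t)\ge\rho_m>0$, $T(t)\ge T_m>0$ for all $t\ge0$. Then for every $k$, $\|(\rho(t),u(t),T(t))-(1,0,1)\|_{C^k}=O(t^{-\infty})$ as $t\to\infty$.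
   Context: $\{\nabla u\}$ is the traceless symmetric strain: $\{\nabla u\}_{ij}=\frac12(\partial_ju_i+\partial_iu_j)-\frac{\nabla\cdot u}N\delta_{ij}$. $C^k$ is the space of functions with bounded derivatives up to order $k$ on $\mathbb T^N$. $O(t^{-\infty})$ means $O(t^{-\beta})$ for every $\beta>0$. *)

theory Defs
  imports "HOL-Analysis.Analysis"
begin

text \<open>Space-time points are pairs (t, x) with t :: real and x :: real^'n.
  The torus T^N = R^N / Z^N is modelled by functions that are 1-periodic in each
  spatial coordinate; N = CARD('n).
  Coordinate directions: None = time, Some i = spatial direction i.\<close>

definition coord_dir :: "'n::finite option \<Rightarrow> real \<times> (real^'n)" where
  "coord_dir c = (case c of None \<Rightarrow> (1, 0) | Some i \<Rightarrow> (0, axis i 1))"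

definition partial_c :: "'n::finite option \<Rightarrow> (real \<times> (real^'n) \<Rightarrow> real) \<Rightarrow> real \<times> (real^'n) \<Rightarrow> real" where
  "partial_c c g p = deriv (\<lambda>h. g (p + h *\<^sub>R coord_dir c)) 0"

abbreviation dt :: "(real \<times> (real^'n::finite) \<Rightarrow> real) \<Rightarrow> real \<times> (real^'n) \<Rightarrow> real" where
  "dt g \<equiv> partial_c None g"

abbreviation dx :: "'n::finite \<Rightarrow> (real \<times> (real^'n) \<Rightarrow> real) \<Rightarrow> real \<times> (real^'n) \<Rightarrow> real" where
  "dx i g \<equiv> partial_c (Some i) g"

fun iter_partial :: "'n::finite option list \<Rightarrow> (real \<times> (real^'n) \<Rightarrow> real) \<Rightarrow> real \<times> (real^'n) \<Rightarrow> real" where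
  "iter_partial [] g = g"
| "iter_partial (c # cs) g = partial_c c (iter_partial cs g)"

definition smooth_pos :: "(real \<times> (real^'n::finite) \<Rightarrow> real) \<Rightarrow> bool" where
  "smooth_pos g \<longleftrightarrow> (\<forall>cs. continuous_on {p. fst p > 0} (iter_partial cs g) \<and>
      (\<forall>c p. fst p > 0 \<longrightarrow> (\<lambda>h. iter_partial cs g (p + h *\<^sub>R coord_dir c)) differentiable (at 0)))"

definition periodic_x :: "(real \<times> (real^'n::finite) \<Rightarrow> real) \<Rightarrow> bool" where
  "periodic_x g \<longleftrightarrow> (\<forall>t x i. g (t, x + axis i 1) = g (t, x))"

definition Ck_bound :: "nat \<Rightarrow> (real \<times> (real^'n::finite) \<Rightarrow> real) \<Rightarrow> real \<Rightarrow> real \<Rightarrow> bool" where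
  "Ck_bound k g t B \<longleftrightarrow> (\<forall>cs x. length cs \<le> k \<longrightarrow> \<bar>iter_partial (map Some cs) g (t, x)\<bar> \<le> B)"

definition torus_int :: "(real^'n::finite \<Rightarrow> real) \<Rightarrow> real" where
  "torus_int f = integral (cbox 0 One) f"

definition strain :: "(real \<times> (real^'n::finite) \<Rightarrow> real^'n) \<Rightarrow> 'n \<Rightarrow> 'n \<Rightarrow> real \<times> (real^'n) \<Rightarrow> real" where
  "strain u i j p = (dx j (\<lambda>q. u q $ i) p + dx i (\<lambda>q. u q $ j) p) / 2
      - (\<Sum>k\<in>UNIV. dx k (\<lambda>q. u q $ k) p) / real CARD('n) * (if i = j then 1 else 0)"

end

theory Submission
  imports Defs
begin

text \<open>
  The entropy H, the integral of \<rho> (ln \<rho> - N/2 ln T), decreases, and its dissipation D controls the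
  traceless strain and the gradient of T. By the conservation laws H is non-negative and bounded by the
  squared distance to equilibrium. Put \<epsilon> = H(t) - H(t+1), the dissipation over a unit time window.
  Since all space-time derivatives are bounded (time derivatives are bounded through the equations),
  interpolation shows that any quantity of size \<epsilon> to some power has all its derivatives of the same size,
  up to an arbitrarily small loss in the exponent. Hence D is pointwise of size \<epsilon> (up to such a loss), so
  strain and grad T are of size sqrt \<epsilon>. This smallness then propagates: the temperature equation makes
  the gradient of div u small, hence all pure second derivatives of u and, by Rolle on periodic lines,
  grad u; the momentum equation makes the second derivatives of ln \<rho> small, hence grad \<rho>. The
  normalizations turn this into smallness of (\<rho> - 1, u, T - 1), so H(t) is bounded by a power of \<epsilon> close
  to 1, and this difference inequality forces superpolynomial decay. For N = 1 the
  traceless strain vanishes identically; the route through the temperature equation covers this case too.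
\<close>

section \<open>Smooth functions on positive times\<close>

text \<open>The dissipation sees neither div u nor grad \<rho>, and the equations give these only up
  to the time derivatives of ln T and of u, which are not known to be small. One more space
  derivative removes the obstacle: it commutes with the time derivative, so that what appears is the
  time derivative of grad ln T or grad u, small by interpolation. Hence the detour through grad div
  u and second derivatives of ln \<rho>, after which periodicity lowers the order again. Hence also
  the need to bound time derivatives and to measure smallness on windows rather than at single
  times. Every differentiation costs a little of the exponent, so the working class
  \<open>half_order\<close> asks for all exponents below 1/2; it is stable under derivatives and
  under bounded smooth factors. A product of two such fields has every order below 1, which matches
  the quadratic bound on H. The size \<eta> of a window is a free upper bound for the entropy drop:
  when it is chosen too small for H(t) \<le> C \<eta>^\<alpha> to hold, the drop must exceed
  it.\<close>

type_synonym 'n field = "real \<times> (real^'n) \<Rightarrow> real"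

abbreviation pos_time :: "(real \<times> (real^'n::finite)) set" where
  "pos_time \<equiv> {p. fst p > 0}"

definition partially_differentiable :: "'n::finite option \<Rightarrow> 'n field \<Rightarrow> bool" where
  "partially_differentiable c g \<longleftrightarrow>
     (\<forall>p. fst p > 0 \<longrightarrow> (\<lambda>h. g (p + h *\<^sub>R coord_dir c)) differentiable (at 0))"

definition bounded_pos :: "'n::finite field \<Rightarrow> bool" where
  "bounded_pos g \<longleftrightarrow> (\<exists>B. \<forall>p. fst p > 0 \<longrightarrow> \<bar>g p\<bar> \<le> B)"

text \<open>For m = 0 no bound is imposed; for m > 0 the partial derivatives of order at most n with
  fewer than m time derivatives are bounded.\<close>

fun regular :: "nat \<Rightarrow> nat \<Rightarrow> 'n::finite field \<Rightarrow> bool" where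
  "regular 0 m g \<longleftrightarrow> continuous_on pos_time g \<and> (m > 0 \<longrightarrow> bounded_pos g)"
| "regular (Suc n) m g \<longleftrightarrow> continuous_on pos_time g \<and> (m > 0 \<longrightarrow> bounded_pos g) \<and>
     (\<forall>c. partially_differentiable c g \<and> regular n (if c = None then m - 1 else m) (partial_c c g))"

declare split_paired_All [simp del] split_paired_Ex [simp del]

lemma coord_dir_simps [simp]: "coord_dir None = (1, 0)" "coord_dir (Some i) = (0, axis i 1)"
  by (auto simp: coord_dir_def)

lemma eventually_pos_time:
  assumes "fst p > 0"
  shows "\<forall>\<^sub>F h in nhds 0. fst (p + h *\<^sub>R coord_dir (c :: 'n::finite option)) > 0"
proof -
  have "((\<lambda>h. fst (p + h *\<^sub>R coord_dir c)) \<longlongrightarrow> fst (p + 0 *\<^sub>R coord_dir c)) (nhds 0)"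
    by (intro tendsto_intros filterlim_ident)
  then show ?thesis
    using order_tendstoD(1)[of _ _ "nhds 0" 0] assms by auto
qed

lemma eventually_eq_along:
  assumes "\<And>p. fst p > 0 \<Longrightarrow> g p = h p" "fst p > 0"
  shows "\<forall>\<^sub>F k in nhds 0. g (p + k *\<^sub>R coord_dir c) = h (p + k *\<^sub>R coord_dir (c :: 'n::finite option))"
  using eventually_pos_time[OF assms(2), of c] by eventually_elim (use assms in auto)

lemma partial_c_cong:
  assumes "\<And>p. fst p > 0 \<Longrightarrow> g p = h p" "fst p > 0"
  shows "partial_c c g p = partial_c c h p"
  unfolding partial_c_def by (rule deriv_cong_ev[OF eventually_eq_along[OF assms]]) auto

lemma has_partial:
  assumes "partially_differentiable c g" "fst p > 0"
  shows "((\<lambda>h. g (p + h *\<^sub>R coord_dir c)) has_real_derivative partial_c c g p) (at 0)"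
  using assms unfolding partially_differentiable_def partial_c_def
  by (simp only: DERIV_deriv_iff_real_differentiable)

lemma partially_differentiableI:
  assumes "\<And>p. fst p > 0 \<Longrightarrow> ((\<lambda>h. g (p + h *\<^sub>R coord_dir c)) has_real_derivative D p) (at 0)"
  shows "partially_differentiable c g"
  using assms unfolding partially_differentiable_def real_differentiable_def by blast

lemma partial_c_eqI:
  "((\<lambda>h. g (p + h *\<^sub>R coord_dir c)) has_real_derivative D) (at 0) \<Longrightarrow> partial_c c g p = D"
  unfolding partial_c_def by (rule DERIV_imp_deriv)

lemma partially_differentiable_cong:
  assumes "partially_differentiable c g" "\<And>p. fst p > 0 \<Longrightarrow> g p = h p"
  shows "partially_differentiable c h"
proof (rule partially_differentiableI)
  fix p :: "real \<times> (real^'a)" assume p: "fst p > 0"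
  show "((\<lambda>k. h (p + k *\<^sub>R coord_dir c)) has_real_derivative partial_c c g p) (at 0)"
    using has_partial[OF assms(1) p] DERIV_cong_ev[OF refl eventually_eq_along[of g h, OF assms(2) p] refl]
    by blast
qed

text \<open>The calculus rules hold only at positive times, and elsewhere \<open>deriv\<close> may
  return anything, so formulas for derivatives are substituted through this lemma. It works because
  the set of positive times is open: for small h a difference quotient there uses positive times
  only.\<close>

lemma regular_cong:
  assumes "\<And>p. fst p > 0 \<Longrightarrow> g p = h p" "regular n m g"
  shows "regular n m h"
  using assms
proof (induction n arbitrary: m g h)
  case 0
  then show ?case
    using continuous_on_cong[of pos_time pos_time g h] by (auto simp: bounded_pos_def)
next
  case (Suc n)
  have "regular n (if c = None then m - 1 else m) (partial_c c h)" for c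
    using Suc.IH[of "partial_c c g" "partial_c c h"] Suc.prems partial_c_cong[of g h] by auto
  moreover have "continuous_on pos_time h"
    using Suc.prems continuous_on_cong[of pos_time pos_time g h] by auto
  moreover have "m > 0 \<longrightarrow> bounded_pos h"
    using Suc.prems by (auto simp: bounded_pos_def)
  ultimately show ?case
    using Suc.prems partially_differentiable_cong[of _ g h] by auto
qed

lemma regular_SucD: "regular (Suc n) m g \<Longrightarrow> regular n m g"
proof (induction n arbitrary: m g)
  case (Suc n)
  from Suc.prems have "regular (Suc n) (if c = None then m - 1 else m) (partial_c c g)" for c
    by (subst (asm) regular.simps(2)) blast
  then have "regular n (if c = None then m - 1 else m) (partial_c c g)" for c
    using Suc.IH by blast
  moreover have "continuous_on pos_time g \<and> (m > 0 \<longrightarrow> bounded_pos g) \<and> (\<forall>c. partially_differentiable c g)"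
    using Suc.prems by (subst (asm) regular.simps(2)) blast
  ultimately show ?case by (subst regular.simps(2)) blast
qed auto

lemma regular_mono: "regular n m g \<Longrightarrow> m' \<le> m \<Longrightarrow> regular n m' g"
proof (induction n arbitrary: m m' g)
  case 0
  then show ?case by auto
next
  case (Suc n)
  have "regular n (if c = None then m' - 1 else m') (partial_c c g)" for c
    using Suc.prems Suc.IH[of "if c = None then m - 1 else m" "partial_c c g"]
    by (auto simp: diff_le_mono)
  then show ?case using Suc.prems by auto
qed

lemma regular_partial:
  assumes "regular (Suc n) m g"
  shows "partially_differentiable c g" "regular n (if c = None then m - 1 else m) (partial_c c g)"
    "regular n (if c = None then m - 1 else m) g"
    "continuous_on pos_time g" "m > 0 \<Longrightarrow> bounded_pos g"
  using assms regular_mono[OF regular_SucD[OF assms]] by auto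

lemma bounded_pos_add: "bounded_pos g \<Longrightarrow> bounded_pos h \<Longrightarrow> bounded_pos (\<lambda>p. g p + h p)"
  unfolding bounded_pos_def
  by (meson abs_triangle_ineq add_mono order_trans)

lemma bounded_pos_mult:
  assumes "bounded_pos g" "bounded_pos h" shows "bounded_pos (\<lambda>p. g p * h p)"
proof -
  obtain A B where "\<And>p. fst p > 0 \<Longrightarrow> \<bar>g p\<bar> \<le> A" "\<And>p. fst p > 0 \<Longrightarrow> \<bar>h p\<bar> \<le> B"
    using assms unfolding bounded_pos_def by blast
  then have "\<bar>g p * h p\<bar> \<le> A * B" if "fst p > 0" for p
    using that unfolding abs_mult by (meson abs_ge_zero mult_mono order_trans)
  then show ?thesis unfolding bounded_pos_def by blast
qed

lemma partial_c_const [simp]: "partial_c c (\<lambda>p. a) = (\<lambda>p. 0)"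
  by (auto simp: fun_eq_iff intro!: partial_c_eqI derivative_eq_intros)

lemma regular_const [simp]: "regular n m (\<lambda>p. a)"
proof (induction n arbitrary: m a)
  case (Suc n)
  then show ?case
    by (auto simp: bounded_pos_def intro!: continuous_intros partially_differentiableI[of _ _ "\<lambda>_. 0"]
        derivative_eq_intros)
qed (auto simp: bounded_pos_def)

lemma
  assumes "partially_differentiable c g" "partially_differentiable c h"
  shows partially_differentiable_add: "partially_differentiable c (\<lambda>p. g p + h p)"
    and partial_c_add: "fst p > 0 \<Longrightarrow> partial_c c (\<lambda>p. g p + h p) p = partial_c c g p + partial_c c h p"
    and partially_differentiable_mult: "partially_differentiable c (\<lambda>p. g p * h p)"
    and partial_c_mult: "fst p > 0 \<Longrightarrow>
      partial_c c (\<lambda>p. g p * h p) p = partial_c c g p * h p + g p * partial_c c h p"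
proof -
  have 1: "((\<lambda>k. g (p + k *\<^sub>R coord_dir c) + h (p + k *\<^sub>R coord_dir c))
     has_real_derivative (partial_c c g p + partial_c c h p)) (at 0)" if "fst p > 0" for p
    by (intro derivative_intros has_partial assms that)
  have 2: "((\<lambda>k. g (p + k *\<^sub>R coord_dir c) * h (p + k *\<^sub>R coord_dir c))
     has_real_derivative (partial_c c g p * h p + g p * partial_c c h p)) (at 0)" if "fst p > 0" for p
    using DERIV_mult[OF has_partial[OF assms(1) that] has_partial[OF assms(2) that]]
    by (simp add: algebra_simps)
  show "partially_differentiable c (\<lambda>p. g p + h p)" "partially_differentiable c (\<lambda>p. g p * h p)"
    by (rule partially_differentiableI, erule 1, rule partially_differentiableI, erule 2)
  show "partial_c c (\<lambda>p. g p + h p) p = partial_c c g p + partial_c c h p"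
    "partial_c c (\<lambda>p. g p * h p) p = partial_c c g p * h p + g p * partial_c c h p" if "fst p > 0"
    using 1[OF that] 2[OF that] by (auto intro: partial_c_eqI)
qed

lemma
  assumes "partially_differentiable c g" "\<And>p. fst p > 0 \<Longrightarrow> g p > 0"
  shows partially_differentiable_inverse: "partially_differentiable c (\<lambda>p. inverse (g p))"
    and partial_c_inverse: "fst p > 0 \<Longrightarrow>
      partial_c c (\<lambda>p. inverse (g p)) p = - partial_c c g p * (inverse (g p) * inverse (g p))"
    and partially_differentiable_ln: "partially_differentiable c (\<lambda>p. ln (g p))"
    and partial_c_ln: "fst p > 0 \<Longrightarrow> partial_c c (\<lambda>p. ln (g p)) p = partial_c c g p * inverse (g p)"
proof -
  have 1: "((\<lambda>k. inverse (g (p + k *\<^sub>R coord_dir c)))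
     has_real_derivative (- partial_c c g p * (inverse (g p) * inverse (g p)))) (at 0)" if "fst p > 0" for p
    by (rule derivative_eq_intros has_partial assms that refl)+ (use assms(2)[of p] that in auto)
  have 2: "((\<lambda>k. ln (g (p + k *\<^sub>R coord_dir c)))
     has_real_derivative (partial_c c g p * inverse (g p))) (at 0)" if "fst p > 0" for p
    using DERIV_chain2[OF DERIV_ln has_partial[OF assms(1) that]] assms(2)[OF that]
    by (auto simp: mult.commute)
  show "partially_differentiable c (\<lambda>p. inverse (g p))" "partially_differentiable c (\<lambda>p. ln (g p))"
    by (rule partially_differentiableI, erule 1, rule partially_differentiableI, erule 2)
  show "partial_c c (\<lambda>p. inverse (g p)) p = - partial_c c g p * (inverse (g p) * inverse (g p))"
    "partial_c c (\<lambda>p. ln (g p)) p = partial_c c g p * inverse (g p)" if "fst p > 0"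
    using 1[OF that] 2[OF that] by (auto intro: partial_c_eqI)
qed

lemma regular_add: "regular n m g \<Longrightarrow> regular n m h \<Longrightarrow> regular n m (\<lambda>p. g p + h p)"
proof (induction n arbitrary: m g h)
  case 0
  then show ?case by (auto intro!: continuous_intros bounded_pos_add)
next
  case (Suc n)
  have "regular n (if c = None then m - 1 else m) (partial_c c (\<lambda>p. g p + h p))" for c
    by (rule regular_cong[where g = "\<lambda>p. partial_c c g p + partial_c c h p"])
      (use regular_partial[OF Suc.prems(1)] regular_partial[OF Suc.prems(2)] Suc.IH in
        \<open>simp_all add: partial_c_add\<close>)
  then show ?case
    using Suc.prems by (auto intro!: continuous_intros bounded_pos_add partially_differentiable_add)
qed

lemma regular_mult: "regular n m g \<Longrightarrow> regular n m h \<Longrightarrow> regular n m (\<lambda>p. g p * h p)"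
proof (induction n arbitrary: m g h)
  case 0
  then show ?case by (auto intro!: continuous_intros bounded_pos_mult)
next
  case (Suc n)
  have "regular n (if c = None then m - 1 else m) (partial_c c (\<lambda>p. g p * h p))" for c
    by (rule regular_cong[where g = "\<lambda>p. partial_c c g p * h p + g p * partial_c c h p"])
      (use regular_partial[OF Suc.prems(1)] regular_partial[OF Suc.prems(2)] Suc.IH in
        \<open>simp_all add: partial_c_mult regular_add\<close>)
  then show ?case
    using Suc.prems by (auto intro!: continuous_intros bounded_pos_mult partially_differentiable_mult)
qed

lemma regular_uminus: "regular n m g \<Longrightarrow> regular n m (\<lambda>p. - g p)"
  using regular_mult[of n m "\<lambda>_. -1" g] by simp

lemma bounded_pos_inverse:
  assumes "a > 0" "\<And>p. fst p > 0 \<Longrightarrow> g p \<ge> a"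
  shows "bounded_pos (\<lambda>p. inverse (g p))"
proof -
  have "\<bar>inverse (g p)\<bar> \<le> inverse a" if "fst p > 0" for p
    using assms(1) assms(2)[OF that] by (simp add: le_imp_inverse_le)
  then show ?thesis unfolding bounded_pos_def by blast
qed

text \<open>The derivative -g' / g^2 contains only g' and the inverse itself at one order less, so
  the induction on n closes. The uniform lower bound a keeps 1/g bounded.\<close>

lemma regular_inverse:
  assumes "a > 0" "\<And>p. fst p > 0 \<Longrightarrow> g p \<ge> a" "regular n m g"
  shows "regular n m (\<lambda>p. inverse (g p))"
  using assms(3)
proof (induction n arbitrary: m)
  case 0
  have "\<forall>p\<in>pos_time. g p \<noteq> 0" using assms(1,2) by fastforce
  then show ?case
    using 0 bounded_pos_inverse[of a g, OF assms(1,2)] by (auto intro!: continuous_intros)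
next
  case (Suc n)
  have pos: "g p > 0" if "fst p > 0" for p using assms(1,2) that by (meson less_le_trans)
  have "regular n (if c = None then m - 1 else m) (partial_c c (\<lambda>p. inverse (g p)))" for c
    by (rule regular_cong[where g = "\<lambda>p. - partial_c c g p * (inverse (g p) * inverse (g p))"])
      (use regular_partial[OF Suc.prems] Suc.IH pos in
        \<open>simp_all add: partial_c_inverse regular_mult regular_uminus del: mult_minus_left\<close>)
  moreover have "\<forall>p\<in>pos_time. g p \<noteq> 0" using pos by fastforce
  ultimately show ?case
    using Suc.prems bounded_pos_inverse[of a g, OF assms(1,2)] pos
    by (auto intro!: continuous_intros partially_differentiable_inverse)
qed

lemma bounded_pos_ln:
  assumes "a > 0" "\<And>p. fst p > 0 \<Longrightarrow> g p \<ge> a" "bounded_pos g"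
  shows "bounded_pos (\<lambda>p. ln (g p))"
proof -
  obtain B where B: "\<And>p. fst p > 0 \<Longrightarrow> \<bar>g p\<bar> \<le> B"
    using assms unfolding bounded_pos_def by blast
  have "\<bar>ln (g p)\<bar> \<le> \<bar>ln a\<bar> + \<bar>ln B\<bar>" if "fst p > 0" for p
  proof -
    have "ln a \<le> ln (g p)" "ln (g p) \<le> ln B"
      using assms(1) assms(2)[OF that] B[OF that] by (auto intro!: ln_mono)
    then show ?thesis by linarith
  qed
  then show ?thesis unfolding bounded_pos_def by blast
qed

lemma regular_ln:
  assumes "a > 0" "\<And>p. fst p > 0 \<Longrightarrow> g p \<ge> a" "regular n m g"
  shows "regular n m (\<lambda>p. ln (g p))"
proof -
  have pos: "g p > 0" if "fst p > 0" for p using assms(1,2) that by (meson less_le_trans)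
  then have nz: "\<forall>p\<in>pos_time. g p \<noteq> 0" by fastforce
  show ?thesis
  proof (cases n)
    case 0
    then show ?thesis
      using assms(3) bounded_pos_ln[of a g, OF assms(1,2)] nz by (auto intro!: continuous_intros)
  next
    case (Suc k)
    have "regular k (if c = None then m - 1 else m) (partial_c c (\<lambda>p. ln (g p)))" for c
      by (rule regular_cong[where g = "\<lambda>p. partial_c c g p * inverse (g p)"])
        (use regular_partial[OF assms(3)[unfolded Suc]] regular_inverse[of a g, OF assms(1,2)] pos in
          \<open>simp_all add: partial_c_ln regular_mult\<close>)
    then show ?thesis
      using assms(3) bounded_pos_ln[of a g, OF assms(1,2)] nz pos Suc
      by (auto intro!: continuous_intros partially_differentiable_ln)
  qed
qed

text \<open>\<open>iter_partial\<close> unfolds from the outermost derivative, whereas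
  \<open>regular\<close> recurses on the innermost one; extending the list at its end passes between
  the two.\<close>

lemma iter_partial_snoc: "iter_partial (cs @ [c]) g = iter_partial cs (partial_c c g)"
  by (induction cs) auto

lemma smooth_pos_regular:
  assumes "smooth_pos g" shows "regular n 0 g"
  using assms
proof (induction n arbitrary: g)
  case 0
  then have "continuous_on pos_time (iter_partial [] g)" unfolding smooth_pos_def by blast
  then show ?case by simp
next
  case (Suc n)
  have "smooth_pos (partial_c c g)" for c
    unfolding smooth_pos_def
  proof
    fix cs
    show "continuous_on pos_time (iter_partial cs (partial_c c g)) \<and>
      (\<forall>d p. fst p > 0 \<longrightarrow> (\<lambda>h. iter_partial cs (partial_c c g) (p + h *\<^sub>R coord_dir d)) differentiable (at 0))"
      using Suc.prems[unfolded smooth_pos_def, rule_format, of "cs @ [c]"] by (simp add: iter_partial_snoc)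
  qed
  moreover have "continuous_on pos_time g" "\<And>c. partially_differentiable c g"
    using Suc.prems[unfolded smooth_pos_def, rule_format, of "[]"]
    by (auto simp: partially_differentiable_def)
  ultimately show ?case using Suc.IH by auto
qed

text \<open>Entry point for the assumed C^k bounds. With m = 1 a time derivative lowers the second
  index to 0, where no bound is asked, so bounds on purely spatial derivatives suffice.\<close>

lemma regular_1I:
  assumes "\<And>n. regular n 0 g" "\<And>cs. bounded_pos (iter_partial (map Some cs) g)"
  shows "regular n 1 g"
  using assms
proof (induction n arbitrary: g)
  case 0
  from 0(1)[of 0] 0(2)[of "[]"] show ?case by simp
next
  case (Suc n)
  have 1: "regular k 0 (partial_c c g)" for c k
    using Suc.prems(1)[of "Suc k"] by (cases c) (auto dest: spec[of _ c])
  have "regular n 1 (dx i g)" for i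
  proof (rule Suc.IH[OF 1])
    show "bounded_pos (iter_partial (map Some cs) (dx i g))" for cs
      using Suc.prems(2)[of "cs @ [i]"] by (simp add: iter_partial_snoc)
  qed
  then have "regular n (if c = None then 1 - 1 else 1) (partial_c c g)" for c
    using 1 by (cases c) auto
  moreover have "bounded_pos g" using Suc.prems(2)[of "[]"] by simp
  ultimately show ?case
    using regular_partial(1,4)[OF Suc.prems(1)[of "Suc n"]] by (subst regular.simps(2)) blast
qed

text \<open>Only the index m survives, because a space derivative keeps it and a time derivative
  lowers it by one. \<open>tame 0\<close> is enough for identities; a positive m supplies
  bounds.\<close>

definition tame :: "nat \<Rightarrow> 'n::finite field \<Rightarrow> bool" where
  "tame m g \<longleftrightarrow> (\<forall>n. regular n m g)"

named_theorems tame_intros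

lemma tame_const [tame_intros, simp]: "tame m (\<lambda>p. a)"
  by (simp add: tame_def)

lemma tame_add [tame_intros]: "tame m g \<Longrightarrow> tame m h \<Longrightarrow> tame m (\<lambda>p. g p + h p)"
  by (simp add: tame_def regular_add)

lemma tame_mult [tame_intros]: "tame m g \<Longrightarrow> tame m h \<Longrightarrow> tame m (\<lambda>p. g p * h p)"
  by (simp add: tame_def regular_mult)

lemma tame_uminus [tame_intros]: "tame m g \<Longrightarrow> tame m (\<lambda>p. - g p)"
  by (simp add: tame_def regular_uminus)

lemma tame_diff [tame_intros]: "tame m g \<Longrightarrow> tame m h \<Longrightarrow> tame m (\<lambda>p. g p - h p)"
  using tame_add[of m g "\<lambda>p. - h p"] tame_uminus[of m h] by simp

lemma tame_power [tame_intros]: "tame m g \<Longrightarrow> tame m (\<lambda>p. g p ^ k)"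
  by (induction k) (auto intro: tame_mult)

lemma tame_sum [tame_intros]:
  "(\<And>i. i \<in> I \<Longrightarrow> tame m (g i)) \<Longrightarrow> tame m (\<lambda>p. \<Sum>i\<in>I. g i p)"
  by (induction I rule: infinite_finite_induct) (auto intro: tame_add)

lemma tame_inverse:
  "a > 0 \<Longrightarrow> (\<And>p. fst p > 0 \<Longrightarrow> g p \<ge> a) \<Longrightarrow> tame m g \<Longrightarrow> tame m (\<lambda>p. inverse (g p))"
  unfolding tame_def using regular_inverse by blast

lemma tame_ln:
  "a > 0 \<Longrightarrow> (\<And>p. fst p > 0 \<Longrightarrow> g p \<ge> a) \<Longrightarrow> tame m g \<Longrightarrow> tame m (\<lambda>p. ln (g p))"
  unfolding tame_def using regular_ln by blast

lemma tame_divide_const [tame_intros]: "tame m g \<Longrightarrow> tame m (\<lambda>p. g p / a)"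
  using tame_mult[of m g "\<lambda>_. inverse a"] by (simp add: divide_inverse)

lemma tame_mono: "tame m g \<Longrightarrow> m' \<le> m \<Longrightarrow> tame m' g"
  unfolding tame_def using regular_mono by blast

lemma tame_cong: "(\<And>p. fst p > 0 \<Longrightarrow> g p = h p) \<Longrightarrow> tame m g \<Longrightarrow> tame m h"
  unfolding tame_def using regular_cong by blast

lemma tame_partial: "tame m g \<Longrightarrow> tame (if c = None then m - 1 else m) (partial_c c g)"
  unfolding tame_def using regular_partial(2) by blast

lemma tame_dx [tame_intros]: "tame m g \<Longrightarrow> tame m (dx i g)"
  using tame_partial[of m g "Some i"] by simp

lemma tame_0_partial [tame_intros]: "tame 0 g \<Longrightarrow> tame 0 (partial_c c g)"
  using tame_partial[of 0 g c] by (simp split: if_splits)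

lemma tame_partially_differentiable: "tame m g \<Longrightarrow> partially_differentiable c g"
  unfolding tame_def using regular_partial(1) by blast

lemma tame_continuous: "tame m g \<Longrightarrow> continuous_on pos_time g"
  unfolding tame_def using regular_partial(4) by blast

lemma tame_bounded: "tame m g \<Longrightarrow> m > 0 \<Longrightarrow> bounded_pos g"
  unfolding tame_def using regular_partial(5) by blast

section \<open>Mean value theorem and symmetry of mixed derivatives\<close>

lemma tame_has_partial:
  assumes "tame m g" "fst (p + h *\<^sub>R coord_dir c) > 0"
  shows "((\<lambda>h. g (p + h *\<^sub>R coord_dir c)) has_real_derivative
    partial_c c g (p + h *\<^sub>R coord_dir c)) (at h)"
proof -
  have "((\<lambda>k. g (p + h *\<^sub>R coord_dir c + k *\<^sub>R coord_dir c)) has_real_derivative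
    partial_c c g (p + h *\<^sub>R coord_dir c)) (at 0)"
    by (rule has_partial[OF tame_partially_differentiable[OF assms(1)] assms(2)])
  then show ?thesis
    using DERIV_shift[of "\<lambda>h. g (p + h *\<^sub>R coord_dir c)" "partial_c c g (p + h *\<^sub>R coord_dir c)" 0 h]
    by (simp add: add.assoc scaleR_add_left[symmetric] add.commute[of h])
qed

text \<open>The factor \<open>\<sigma>\<close> is a direction, 1 or -1 in the uses: near the right
  end of a time window the line has to be followed backwards.\<close>

lemma partial_mvt:
  assumes "tame m g" "h > 0" "\<And>k. 0 \<le> k \<Longrightarrow> k \<le> h \<Longrightarrow> fst (p + (\<sigma> * k) *\<^sub>R coord_dir c) > 0"
  obtains k where "0 < k" "k < h"
    "g (p + (\<sigma> * h) *\<^sub>R coord_dir c) - g p = h * (\<sigma> * partial_c c g (p + (\<sigma> * k) *\<^sub>R coord_dir c))"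
proof -
  have "((\<lambda>k. g (p + (\<sigma> * k) *\<^sub>R coord_dir c)) has_real_derivative
     \<sigma> * partial_c c g (p + (\<sigma> * k) *\<^sub>R coord_dir c)) (at k)" if "0 \<le> k" "k \<le> h" for k
  proof -
    have "((\<lambda>k. \<sigma> * k) has_real_derivative \<sigma>) (at k)" by (auto intro!: derivative_eq_intros)
    from DERIV_chain2[where f = "\<lambda>h. g (p + h *\<^sub>R coord_dir c)",
        OF tame_has_partial[OF assms(1) assms(3)[OF that]] this]
    show ?thesis by (simp only: mult.commute[of _ \<sigma>])
  qed
  from MVT2[OF assms(2) this] that show thesis by auto
qed

text \<open>The double difference is symmetric in c and d while the derivative on the right is not,
  which is what makes mixed derivatives commute. The mean value theorem is applied in direction c to
  the increment in direction d, then in direction d.\<close>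

lemma double_difference:
  assumes "tame 0 g" "h > 0"
    and "\<And>s t. 0 \<le> s \<Longrightarrow> s \<le> h \<Longrightarrow> 0 \<le> t \<Longrightarrow> t \<le> h \<Longrightarrow>
      fst (p + s *\<^sub>R coord_dir c + t *\<^sub>R coord_dir d) > 0"
  obtains s t where "0 \<le> s" "s \<le> h" "0 \<le> t" "t \<le> h"
    "g (p + h *\<^sub>R coord_dir c + h *\<^sub>R coord_dir d) - g (p + h *\<^sub>R coord_dir c)
       - g (p + h *\<^sub>R coord_dir d) + g p
     = h * h * partial_c d (partial_c c g) (p + s *\<^sub>R coord_dir c + t *\<^sub>R coord_dir d)"
proof -
  define \<phi> where "\<phi> s = g (p + h *\<^sub>R coord_dir d + s *\<^sub>R coord_dir c) - g (p + s *\<^sub>R coord_dir c)" for s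
  have 1: "fst (p + h *\<^sub>R coord_dir d + s *\<^sub>R coord_dir c) > 0" "fst (p + s *\<^sub>R coord_dir c) > 0"
    if "0 \<le> s" "s \<le> h" for s
    using assms(3)[OF that, of h] assms(3)[OF that, of 0] assms(2) by (simp_all add: add_ac)
  have "(\<phi> has_real_derivative (partial_c c g (p + h *\<^sub>R coord_dir d + s *\<^sub>R coord_dir c)
     - partial_c c g (p + s *\<^sub>R coord_dir c))) (at s)" if "0 \<le> s" "s \<le> h" for s
    unfolding \<phi>_def by (intro DERIV_diff tame_has_partial[OF assms(1)] 1 that)
  from MVT2[OF assms(2) this] obtain s where s: "0 < s" "s < h" and
    s': "\<phi> h - \<phi> 0 = (h - 0) * (partial_c c g (p + h *\<^sub>R coord_dir d + s *\<^sub>R coord_dir c)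
     - partial_c c g (p + s *\<^sub>R coord_dir c))" by auto
  have 2: "fst (p + s *\<^sub>R coord_dir c + (1 * t) *\<^sub>R coord_dir d) > 0" if "0 \<le> t" "t \<le> h" for t
    using assms(3)[of s t] s that by simp
  obtain t where t: "0 < t" "t < h"
    "partial_c c g (p + s *\<^sub>R coord_dir c + (1 * h) *\<^sub>R coord_dir d) - partial_c c g (p + s *\<^sub>R coord_dir c)
      = h * (1 * partial_c d (partial_c c g) (p + s *\<^sub>R coord_dir c + (1 * t) *\<^sub>R coord_dir d))"
    by (rule partial_mvt[OF tame_0_partial[OF assms(1)] assms(2) 2])
  have "\<phi> h - \<phi> 0 = h * h * partial_c d (partial_c c g) (p + s *\<^sub>R coord_dir c + t *\<^sub>R coord_dir d)"
    using s' t(3) by (simp add: add_ac)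
  then show thesis
    using that[of s t] s t(1,2) by (simp add: \<phi>_def algebra_simps)
qed

lemma norm_coord_dir [simp]: "norm (coord_dir c :: real \<times> (real^'n::finite)) = 1"
  by (cases c) (auto simp: norm_Pair norm_axis_1)

text \<open>Schwarz's theorem. For small h both mixed derivatives take, at points near p, the same
  value: the double difference divided by h^2. If they differed at p, continuity would keep them
  apart near p.\<close>

theorem partial_commute:
  fixes g :: "'n::finite field"
  assumes "tame 0 g" "fst p > 0"
  shows "partial_c c (partial_c d g) p = partial_c d (partial_c c g) p"
proof (rule ccontr)
  define A B where "A = partial_c d (partial_c c g)" and "B = partial_c c (partial_c d g)"
  assume "partial_c c (partial_c d g) p \<noteq> partial_c d (partial_c c g) p"
  then have e: "\<bar>A p - B p\<bar> / 2 > 0" by (simp add: A_def B_def)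
  have op: "open (pos_time :: (real \<times> (real^'n)) set)"
    by (intro open_Collect_less continuous_intros)
  have cont: "continuous_on pos_time A" "continuous_on pos_time B"
    unfolding A_def B_def by (intro tame_continuous[of 0] tame_0_partial assms)+
  then have "isCont A p" "isCont B p"
    using op assms(2) by (auto simp: continuous_on_eq_continuous_at)
  moreover have "\<forall>\<^sub>F q in nhds p. q \<in> pos_time"
    using op assms(2) eventually_nhds_in_open by blast
  ultimately have "\<forall>\<^sub>F q in nhds p. fst q > 0 \<and> dist (A q) (A p) < \<bar>A p - B p\<bar> / 2 \<and> dist (B q) (B p) < \<bar>A p - B p\<bar> / 2"
    using e unfolding isCont_def tendsto_at_iff_tendsto_nhds
    unfolding tendsto_iff
    by (simp only: eventually_conj_iff mem_Collect_eq)
  then obtain r where r: "r > 0" and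
    rq: "\<And>q. dist q p < r \<Longrightarrow> fst q > 0 \<and> dist (A q) (A p) < \<bar>A p - B p\<bar> / 2 \<and> dist (B q) (B p) < \<bar>A p - B p\<bar> / 2"
    unfolding eventually_nhds_metric by blast
  \<comment> \<open>Two steps of length at most r/3 stay inside the ball of radius r.\<close>
  define h where "h = r / 3"
  have h: "h > 0" using r by (simp add: h_def)
  have near: "dist (p + s *\<^sub>R coord_dir c' + t *\<^sub>R coord_dir d') p < r"
    if "0 \<le> s" "s \<le> h" "0 \<le> t" "t \<le> h" for s t and c' d' :: "'n option"
  proof -
    have "norm (s *\<^sub>R (coord_dir c' :: real \<times> (real^'n)) + t *\<^sub>R coord_dir d') \<le> s + t"
      using that norm_triangle_ineq[of "s *\<^sub>R (coord_dir c' :: real \<times> (real^'n))" "t *\<^sub>R coord_dir d'"] by simp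
    then show ?thesis using that r by (simp add: dist_norm add.assoc h_def)
  qed
  obtain s t where st: "0 \<le> s" "s \<le> h" "0 \<le> t" "t \<le> h"
    "g (p + h *\<^sub>R coord_dir c + h *\<^sub>R coord_dir d) - g (p + h *\<^sub>R coord_dir c)
       - g (p + h *\<^sub>R coord_dir d) + g p = h * h * A (p + s *\<^sub>R coord_dir c + t *\<^sub>R coord_dir d)"
    unfolding A_def by (rule double_difference[OF assms(1) h]) (use rq near in blast)+
  obtain s' t' where st': "0 \<le> s'" "s' \<le> h" "0 \<le> t'" "t' \<le> h"
    "g (p + h *\<^sub>R coord_dir d + h *\<^sub>R coord_dir c) - g (p + h *\<^sub>R coord_dir d)
       - g (p + h *\<^sub>R coord_dir c) + g p = h * h * B (p + s' *\<^sub>R coord_dir d + t' *\<^sub>R coord_dir c)"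
    unfolding B_def by (rule double_difference[OF assms(1) h]) (use rq near in blast)+
  have "h * h * A (p + s *\<^sub>R coord_dir c + t *\<^sub>R coord_dir d) =
      h * h * B (p + s' *\<^sub>R coord_dir d + t' *\<^sub>R coord_dir c)"
    using st(5) st'(5) unfolding add.assoc add.commute[of "h *\<^sub>R coord_dir d"] by linarith
  then have "A (p + s *\<^sub>R coord_dir c + t *\<^sub>R coord_dir d) = B (p + s' *\<^sub>R coord_dir d + t' *\<^sub>R coord_dir c)"
    using h by simp
  moreover have "dist (A (p + s *\<^sub>R coord_dir c + t *\<^sub>R coord_dir d)) (A p) < \<bar>A p - B p\<bar> / 2"
    "dist (B (p + s' *\<^sub>R coord_dir d + t' *\<^sub>R coord_dir c)) (B p) < \<bar>A p - B p\<bar> / 2"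
    using rq near st st' by blast+
  ultimately show False unfolding dist_real_def by (simp add: abs_if split: if_splits)
qed

text \<open>How bounds on one more time derivative are gained. In the induction on n the space
  derivatives of g inherit both hypotheses because \<open>dt\<close> and \<open>dx\<close> commute;
  m > 0 is required since \<open>tame 0\<close> carries no bound.\<close>

lemma tame_SucI:
  assumes "tame m g" "tame m (dt g)" "m > 0"
  shows "tame (Suc m) g"
proof -
  have "regular n (Suc m) g" for n
    using assms(1,2)
  proof (induction n arbitrary: g)
    case 0
    then show ?case using tame_continuous tame_bounded[OF _ assms(3)] by auto
  next
    case (Suc n)
    have "tame m (dt (dx i g))" for i
      by (rule tame_cong[OF _ tame_dx[OF Suc.prems(2), of i]])
        (rule partial_commute[OF tame_mono[OF Suc.prems(1)]], auto)
    then have "regular n (Suc m) (dx i g)" for i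
      using Suc.IH tame_dx[OF Suc.prems(1)] by blast
    moreover have "regular n m (dt g)"
      using Suc.prems(2) by (simp add: tame_def)
    ultimately have "regular n (if c = None then Suc m - 1 else Suc m) (partial_c c g)" for c
      by (cases c) auto
    then show ?case
      using Suc.prems tame_continuous tame_bounded[OF _ assms(3)] tame_partially_differentiable
      by (subst regular.simps(2)) blast
  qed
  then show ?thesis by (simp add: tame_def)
qed

text \<open>A pair (t, \<eta>) stands for the time window from t to t + 1 on which sizes are measured in powers of \<eta>.
  Keeping \<eta> positive avoids the junk value 0 powr 0 = 0.\<close>

definition windows :: "(real \<times> real) set \<Rightarrow> bool" where
  "windows R \<longleftrightarrow> (\<forall>t \<eta>. (t, \<eta>) \<in> R \<longrightarrow> t > 0 \<and> 0 < \<eta> \<and> \<eta> \<le> 1)"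

lemma windowsD: "windows R \<Longrightarrow> (t, \<eta>) \<in> R \<Longrightarrow> t > 0 \<and> 0 < \<eta> \<and> \<eta> \<le> 1"
  by (simp add: windows_def)

section \<open>Interpolation of derivatives on unit time windows\<close>

definition small_on :: "(real \<times> real) set \<Rightarrow> real \<Rightarrow> 'n::finite field \<Rightarrow> bool" where
  "small_on R \<alpha> g \<longleftrightarrow> (\<exists>C. \<forall>t \<eta> s x. (t, \<eta>) \<in> R \<longrightarrow> t \<le> s \<longrightarrow> s \<le> t + 1 \<longrightarrow> \<bar>g (s, x)\<bar> \<le> C * \<eta> powr \<alpha>)"

text \<open>Landau's inequality: somewhere within distance h the derivative equals a difference
  quotient and is at most 2A/h, and over that distance it changes by at most hB.\<close>

lemma partial_interpolation_bound:
  assumes "tame m g" "0 < h" "\<bar>\<sigma>\<bar> = 1"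
    and "\<And>k. 0 \<le> k \<Longrightarrow> k \<le> h \<Longrightarrow> fst (p + (\<sigma> * k) *\<^sub>R coord_dir c) > 0"
    and A: "\<And>k. 0 \<le> k \<Longrightarrow> k \<le> h \<Longrightarrow> \<bar>g (p + (\<sigma> * k) *\<^sub>R coord_dir c)\<bar> \<le> A"
    and B: "\<And>k. 0 \<le> k \<Longrightarrow> k \<le> h \<Longrightarrow> \<bar>partial_c c (partial_c c g) (p + (\<sigma> * k) *\<^sub>R coord_dir c)\<bar> \<le> B"
  shows "\<bar>partial_c c g p\<bar> \<le> 2 * A / h + h * B"
proof -
  have B0: "0 \<le> B" using B[of 0] assms(2) by (auto intro: order_trans[OF abs_ge_zero])
  obtain k where k: "0 < k" "k < h" "g (p + (\<sigma> * h) *\<^sub>R coord_dir c) - g p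
    = h * (\<sigma> * partial_c c g (p + (\<sigma> * k) *\<^sub>R coord_dir c))"
    by (rule partial_mvt[OF assms(1,2), of p \<sigma> c]) (use assms(4) in auto)
  have "tame 0 (partial_c c g)"
    using tame_0_partial tame_mono[OF assms(1)] by blast
  then obtain l where l: "0 < l" "l < k" "partial_c c g (p + (\<sigma> * k) *\<^sub>R coord_dir c) - partial_c c g p
    = k * (\<sigma> * partial_c c (partial_c c g) (p + (\<sigma> * l) *\<^sub>R coord_dir c))"
    by (rule partial_mvt[OF _ k(1), of 0 _ p \<sigma> c]) (use assms(4) k in auto)
  have "h * \<bar>partial_c c g (p + (\<sigma> * k) *\<^sub>R coord_dir c)\<bar> = \<bar>g (p + (\<sigma> * h) *\<^sub>R coord_dir c) - g p\<bar>"
    unfolding k(3) using assms(2,3) by (simp add: abs_mult)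
  also have "\<dots> \<le> 2 * A" using A[of h] A[of 0] assms(2) by auto
  finally have 1: "\<bar>partial_c c g (p + (\<sigma> * k) *\<^sub>R coord_dir c)\<bar> \<le> 2 * A / h"
    using assms(2) by (simp add: field_simps)
  have "\<bar>partial_c c g (p + (\<sigma> * k) *\<^sub>R coord_dir c) - partial_c c g p\<bar> =
      k * \<bar>partial_c c (partial_c c g) (p + (\<sigma> * l) *\<^sub>R coord_dir c)\<bar>"
    unfolding l(3) using k(1) assms(3) by (simp add: abs_mult)
  also have "\<dots> \<le> h * B"
    using B[of l] k l assms(2) B0 by (intro mult_mono) auto
  finally show ?thesis using 1 by linarith
qed

text \<open>At least half of the window lies on one side of p, so interpolation with a step of at
  most 1/2 uses no time outside the window.\<close>

lemma window_segment:
  fixes p :: "real \<times> (real^'n::finite)"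
  assumes "t \<le> fst p" "fst p \<le> t + 1"
  obtains \<sigma> :: real where "\<bar>\<sigma>\<bar> = 1" "\<And>k. 0 \<le> k \<Longrightarrow> k \<le> 1/2 \<Longrightarrow>
    t \<le> fst (p + (\<sigma> * k) *\<^sub>R coord_dir c) \<and> fst (p + (\<sigma> * k) *\<^sub>R coord_dir c) \<le> t + 1"
proof (cases "fst p \<le> t + 1/2")
  case True
  show ?thesis by (rule that[of 1]) (use True assms in \<open>cases c; auto\<close>)+
next
  case False
  show ?thesis by (rule that[of "-1"]) (use False assms in \<open>cases c; auto\<close>)+
qed

lemma small_on_partial_step:
  assumes R: "windows R"
    and "tame m g" "\<beta> \<le> \<alpha>" "small_on R \<alpha> g" "small_on R \<beta> (partial_c c (partial_c c g))"
  shows "small_on R ((\<alpha> + \<beta>) / 2) (partial_c c g)"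
proof -
  obtain A where A: "\<And>t \<eta> s x. (t, \<eta>) \<in> R \<Longrightarrow> t \<le> s \<Longrightarrow> s \<le> t + 1 \<Longrightarrow> \<bar>g (s, x)\<bar> \<le> A * \<eta> powr \<alpha>"
    using assms(4) unfolding small_on_def by blast
  obtain B where B: "\<And>t \<eta> s x. (t, \<eta>) \<in> R \<Longrightarrow> t \<le> s \<Longrightarrow> s \<le> t + 1 \<Longrightarrow>
      \<bar>partial_c c (partial_c c g) (s, x)\<bar> \<le> B * \<eta> powr \<beta>"
    using assms(5) unfolding small_on_def by blast
  have "\<bar>partial_c c g (s, x)\<bar> \<le> (4 * A + B / 2) * \<eta> powr ((\<alpha> + \<beta>) / 2)"
    if R': "(t, \<eta>) \<in> R" "t \<le> s" "s \<le> t + 1" for t \<eta> s x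
  proof -
    \<comment> \<open>This step gives A/h and hB the same power of \<eta>. The factor 1/2 makes it
      fit \<open>window_segment\<close>, since \<beta> \<le> \<alpha> keeps the power itself at most
      1.\<close>
    define h where "h = \<eta> powr ((\<alpha> - \<beta>) / 2) / 2"
    have \<eta>: "0 < \<eta>" "\<eta> \<le> 1" "t > 0" using windowsD[OF R] R' by blast+
    have h: "0 < h" "h \<le> 1/2" using \<eta> assms(3) by (auto simp: h_def powr_le1)
    obtain \<sigma> :: real where \<sigma>: "\<bar>\<sigma>\<bar> = 1" and seg: "\<And>k. 0 \<le> k \<Longrightarrow> k \<le> 1/2 \<Longrightarrow>
      t \<le> fst ((s, x) + (\<sigma> * k) *\<^sub>R coord_dir c) \<and> fst ((s, x) + (\<sigma> * k) *\<^sub>R coord_dir c) \<le> t + 1"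
      by (rule window_segment[of t "(s, x)" c]) (use R' in auto)
    have "\<bar>partial_c c g (s, x)\<bar> \<le> 2 * (A * \<eta> powr \<alpha>) / h + h * (B * \<eta> powr \<beta>)"
    proof (rule partial_interpolation_bound[OF assms(2) h(1) \<sigma>])
      fix k :: real assume k: "0 \<le> k" "k \<le> h"
      let ?q = "(s, x) + (\<sigma> * k) *\<^sub>R coord_dir c"
      have q: "t \<le> fst ?q" "fst ?q \<le> t + 1" using seg[of k] k h by auto
      show "0 < fst ?q" using q \<eta> by linarith
      show "\<bar>g ?q\<bar> \<le> A * \<eta> powr \<alpha>"
        using A[OF R'(1) q, of "snd ?q"] by (simp only: prod.collapse)
      show "\<bar>partial_c c (partial_c c g) ?q\<bar> \<le> B * \<eta> powr \<beta>"
        using B[OF R'(1) q, of "snd ?q"] by (simp only: prod.collapse)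
    qed
    also have "2 * (A * \<eta> powr \<alpha>) / h = 4 * A * \<eta> powr ((\<alpha> + \<beta>) / 2)"
      using \<eta> by (simp add: h_def powr_diff[symmetric] field_simps powr_add[symmetric])
    also have "h * (B * \<eta> powr \<beta>) = B / 2 * \<eta> powr ((\<alpha> + \<beta>) / 2)"
      using \<eta> by (simp add: h_def field_simps powr_add[symmetric])
    finally show ?thesis by (simp add: algebra_simps)
  qed
  then show ?thesis unfolding small_on_def by blast
qed

lemma small_on_mono:
  assumes R: "windows R"
    and "small_on R \<alpha> g" "\<beta> \<le> \<alpha>"
  shows "small_on R \<beta> g"
proof -
  obtain A where A: "\<And>t \<eta> s x. (t, \<eta>) \<in> R \<Longrightarrow> t \<le> s \<Longrightarrow> s \<le> t + 1 \<Longrightarrow> \<bar>g (s, x)\<bar> \<le> A * \<eta> powr \<alpha>"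
    using assms(2) unfolding small_on_def by blast
  have "\<bar>g (s, x)\<bar> \<le> \<bar>A\<bar> * \<eta> powr \<beta>" if "(t, \<eta>) \<in> R" "t \<le> s" "s \<le> t + 1" for t \<eta> s x
  proof -
    have "\<bar>g (s, x)\<bar> \<le> \<bar>A\<bar> * \<eta> powr \<alpha>"
      using A[OF that, of x] by (meson abs_ge_self mult_right_mono order_trans powr_ge_zero)
    also have "\<dots> \<le> \<bar>A\<bar> * \<eta> powr \<beta>"
      using windowsD[OF R that(1)] assms(3) by (intro mult_left_mono powr_mono') auto
    finally show ?thesis .
  qed
  then show ?thesis unfolding small_on_def by blast
qed

lemma small_on_0:
  assumes R: "windows R" and "bounded_pos g"
  shows "small_on R 0 g"
proof -
  obtain B where B: "\<And>p. fst p > 0 \<Longrightarrow> \<bar>g p\<bar> \<le> B"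
    using assms(2) unfolding bounded_pos_def by blast
  have "\<bar>g (s, x)\<bar> \<le> B * \<eta> powr 0" if "(t, \<eta>) \<in> R" "t \<le> s" "s \<le> t + 1" for t \<eta> s x
    using windowsD[OF R that(1)] that B[of "(s, x)"] by simp
  then show ?thesis unfolding small_on_def by blast
qed

abbreviation smooth_bounded :: "'n::finite field \<Rightarrow> bool" where
  "smooth_bounded g \<equiv> (\<forall>m. tame m g)"

lemma smooth_bounded_partial: "smooth_bounded g \<Longrightarrow> smooth_bounded (partial_c c g)"
proof
  fix m assume "smooth_bounded g"
  then have "tame (Suc m) g" by blast
  from tame_partial[OF this, of c] show "tame m (partial_c c g)"
    by (rule tame_mono) simp
qed

text \<open>If g of order \<alpha> implies that every first derivative is of order c * \<alpha>, then second derivatives are of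
  order c^2 * \<alpha>, and interpolating between g and these improves c to (1 + c^2) / 2.\<close>

definition interpolation_gain :: "nat \<Rightarrow> real" where
  "interpolation_gain n = ((\<lambda>c. (1 + c\<^sup>2) / 2) ^^ n) 0"

lemma interpolation_gain_bounds: "0 \<le> interpolation_gain n" "interpolation_gain n \<le> 1"
proof -
  have "0 \<le> interpolation_gain n \<and> interpolation_gain n \<le> 1"
    by (induction n) (auto simp: interpolation_gain_def power_le_one)
  then show "0 \<le> interpolation_gain n" "interpolation_gain n \<le> 1" by auto
qed

text \<open>Since (1 + c^2)/2 - c = (1 - c)^2/2, the iteration increases and its only fixed point is
  1.\<close>

lemma interpolation_gain_tendsto: "interpolation_gain \<longlonglongrightarrow> 1"
proof -
  have Suc: "interpolation_gain (Suc n) = (1 + (interpolation_gain n)\<^sup>2) / 2" for n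
    by (simp add: interpolation_gain_def)
  have "interpolation_gain (Suc n) - interpolation_gain n = (1 - interpolation_gain n)\<^sup>2 / 2" for n
    unfolding Suc by (simp add: power2_eq_square field_simps)
  then have "interpolation_gain n \<le> interpolation_gain (Suc n)" for n
    by (metis diff_ge_0_iff_ge divide_nonneg_nonneg zero_le_numeral zero_le_power2)
  then have "incseq interpolation_gain" by (simp add: incseq_SucI)
  then obtain L where L: "interpolation_gain \<longlonglongrightarrow> L"
    by (rule incseq_convergent[of _ 1]) (use interpolation_gain_bounds in blast)+
  have "(\<lambda>n. (1 + (interpolation_gain n)\<^sup>2) / 2) \<longlonglongrightarrow> (1 + L\<^sup>2) / 2"
    by (intro tendsto_intros L) auto
  moreover have "(\<lambda>n. interpolation_gain (Suc n)) \<longlonglongrightarrow> L"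
    using L by (rule LIMSEQ_Suc)
  ultimately have "(1 + L\<^sup>2) / 2 = L"
    unfolding Suc by (rule LIMSEQ_unique)
  then have "(L - 1)\<^sup>2 = 0" by (simp add: power2_eq_square field_simps)
  then show ?thesis using L by simp
qed

text \<open>The induction hypothesis is used for g and again for its derivative, hence the
  generalization over g and \<alpha>. The initial gain 0 is plain boundedness of the
  derivative.\<close>

lemma small_on_partial_gain:
  assumes R: "windows R"
    and "smooth_bounded g" "0 \<le> \<alpha>" "small_on R \<alpha> g"
  shows "small_on R (interpolation_gain n * \<alpha>) (partial_c c g)"
  using assms(2-)
proof (induction n arbitrary: g \<alpha>)
  case 0
  then have "bounded_pos (partial_c c g)"
    using tame_bounded[of 1] smooth_bounded_partial[of g c] by (meson zero_less_one)
  from small_on_0[OF R this] show ?case by (simp add: interpolation_gain_def)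
next
  case (Suc n)
  let ?c = "interpolation_gain n"
  have c: "0 \<le> ?c" "?c \<le> 1" by (rule interpolation_gain_bounds)+
  have 1: "small_on R (?c * \<alpha>) (partial_c c g)" using Suc by blast
  have "small_on R (?c * (?c * \<alpha>)) (partial_c c (partial_c c g))"
    by (rule Suc.IH[OF smooth_bounded_partial[OF Suc.prems(1)] _ 1]) (use c Suc.prems in auto)
  moreover have "?c * (?c * \<alpha>) \<le> \<alpha>"
    using c Suc.prems by (meson mult_left_le_one_le mult_nonneg_nonneg order_trans)
  ultimately have "small_on R ((\<alpha> + ?c * (?c * \<alpha>)) / 2) (partial_c c g)"
    using small_on_partial_step[OF R] Suc.prems by blast
  moreover have "(\<alpha> + ?c * (?c * \<alpha>)) / 2 = interpolation_gain (Suc n) * \<alpha>"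
    by (simp add: interpolation_gain_def power2_eq_square algebra_simps add_divide_distrib)
  ultimately show ?case by simp
qed

text \<open>The loss \<alpha> - \<beta> can be arbitrarily small because the gains tend to
  1.\<close>

theorem small_on_partial:
  assumes R: "windows R"
    and "smooth_bounded g" "0 < \<alpha>" "small_on R \<alpha> g" "\<beta> < \<alpha>"
  shows "small_on R \<beta> (partial_c c g)"
proof -
  have "(\<lambda>n. interpolation_gain n * \<alpha>) \<longlonglongrightarrow> 1 * \<alpha>"
    by (intro tendsto_intros interpolation_gain_tendsto)
  then have "\<forall>\<^sub>F n in sequentially. \<beta> < interpolation_gain n * \<alpha>"
    using assms(5) by (auto dest: order_tendstoD(1))
  then obtain n where n: "\<beta> < interpolation_gain n * \<alpha>"
    using eventually_happens'[OF sequentially_bot] by blast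
  have "small_on R (interpolation_gain n * \<alpha>) (partial_c c g)"
    using small_on_partial_gain[OF R assms(2)] assms(3,4) by simp
  from small_on_mono[OF R this] n show ?thesis by simp
qed

section \<open>Periodicity and integrals over the torus\<close>

lemma periodic_x_partial: "periodic_x g \<Longrightarrow> periodic_x (partial_c c g)"
proof -
  assume per: "periodic_x g"
  have sh: "g (t, y) = g (t, x)" if "y = x + axis i 1" for t x y i
    using per that by (simp add: periodic_x_def)
  have "g ((t, x + axis i 1) + h *\<^sub>R coord_dir c) = g ((t, x) + h *\<^sub>R coord_dir c)" for t x i h
  proof (cases c)
    case (Some j)
    then show ?thesis using sh[of "x + axis i 1 + h *\<^sub>R axis j 1" "x + h *\<^sub>R axis j 1" i t]
      by (simp add: add_ac)
  qed (use per in \<open>simp add: periodic_x_def\<close>)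
  then show ?thesis by (simp add: periodic_x_def partial_c_def)
qed

lemma periodic_x_int_shift:
  assumes "periodic_x g"
  shows "g (t, x + of_int k *\<^sub>R axis i 1) = g (t, x)"
proof (induction k rule: int_induct[where k = 0])
  case (step1 k)
  have "g (t, x + of_int (k + 1) *\<^sub>R axis i 1) = g (t, (x + of_int k *\<^sub>R axis i 1) + axis i 1)"
    by (simp add: scaleR_add_left add.assoc)
  then show ?case using assms step1 by (simp add: periodic_x_def)
next
  case (step2 k)
  have "g (t, x + of_int k *\<^sub>R axis i 1) = g (t, (x + of_int (k - 1) *\<^sub>R axis i 1) + axis i 1)"
    by (simp add: scaleR_diff_left)
  then show ?case using assms step2 by (simp add: periodic_x_def)
qed simp

text \<open>Take fractional parts, one coordinate at a time; each change is a shift by an integer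
  multiple of a period.\<close>

lemma periodic_x_unit_cube:
  fixes x :: "real^'n::finite"
  obtains y where "\<And>i. 0 \<le> y $ i \<and> y $ i \<le> 1" "\<And>g t. periodic_x g \<Longrightarrow> g (t, y) = g (t, x)"
proof -
  define y where "y S = (\<chi> i. if i \<in> S then frac (x $ i) else x $ i)" for S
  have "g (t, y S) = g (t, x)" if "finite S" "periodic_x g" for g t S
    using that(1)
  proof (induction S)
    case empty
    have "y {} = x" by (simp add: y_def vec_eq_iff)
    then show ?case by simp
  next
    case (insert j S)
    have "y S = y (insert j S) + of_int \<lfloor>x $ j\<rfloor> *\<^sub>R axis j 1"
      using insert(2) by (auto simp: y_def vec_eq_iff axis_def frac_def)
    then show ?case
      using insert(3) periodic_x_int_shift[OF that(2), of t "y (insert j S)" "\<lfloor>x $ j\<rfloor>" j] by simp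
  qed
  from this[OF finite] show thesis
  proof (rule that[of "y UNIV", rotated])
    show "0 \<le> y UNIV $ i \<and> y UNIV $ i \<le> 1" for i
      by (simp add: y_def frac_ge_0 less_imp_le[OF frac_lt_1])
  qed
qed

text \<open>By Rolle's theorem the derivative vanishes somewhere on every closed coordinate line.\<close>

lemma periodic_dx_bound:
  assumes "tame m g" "periodic_x g" "s > 0" "\<And>x. \<bar>dx i (dx i g) (s, x)\<bar> \<le> a"
  shows "\<bar>dx i g (s, x)\<bar> \<le> a"
proof -
  let ?e = "\<lambda>k. (s, x) + (1 * k) *\<^sub>R coord_dir (Some i)"
  obtain k where k: "0 < k" "k < 1" "g (?e 1) - g (s, x) = 1 * (1 * dx i g (?e k))"
    by (rule partial_mvt[OF assms(1), of 1 "(s, x)" 1 "Some i"]) (use assms(3) in auto)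
  have "g (?e 1) = g (s, x)" using assms(2) by (simp add: periodic_x_def)
  then have 0: "dx i g (?e k) = 0" using k(3) by simp
  \<comment> \<open>The zero found above lies at distance k < 1, within one period, so the bound a
    is recovered without a constant.\<close>
  obtain l where l: "0 < l" "l < k" "dx i g (?e k) - dx i g (s, x) = k * (1 * dx i (dx i g) (?e l))"
    by (rule partial_mvt[OF tame_dx[OF assms(1)] k(1), of "(s, x)" 1 "Some i"]) (use assms(3) in auto)
  have "\<bar>dx i g (s, x)\<bar> = k * \<bar>dx i (dx i g) (?e l)\<bar>"
    using arg_cong[OF l(3), of abs] k(1) unfolding 0 by (simp add: abs_mult)
  also have "\<dots> \<le> \<bar>dx i (dx i g) (?e l)\<bar>" using k by (simp add: mult_left_le_one_le)
  also have "\<dots> \<le> a" using assms(4)[of "x + l *\<^sub>R axis i 1"] by simp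
  finally show ?thesis .
qed

lemma small_on_periodic_dx:
  assumes R: "windows R"
    and "tame m g" "periodic_x g" "small_on R \<alpha> (dx i (dx i g))"
  shows "small_on R \<alpha> (dx i g)"
proof -
  obtain A where A: "\<And>t \<eta> s x. (t, \<eta>) \<in> R \<Longrightarrow> t \<le> s \<Longrightarrow> s \<le> t + 1 \<Longrightarrow> \<bar>dx i (dx i g) (s, x)\<bar> \<le> A * \<eta> powr \<alpha>"
    using assms(4) unfolding small_on_def by blast
  have "\<bar>dx i g (s, x)\<bar> \<le> A * \<eta> powr \<alpha>" if "(t, \<eta>) \<in> R" "t \<le> s" "s \<le> t + 1" for t \<eta> s x
    by (rule periodic_dx_bound[OF assms(2,3) _ A[OF that]]) (use windowsD[OF R that(1)] that in auto)
  then show ?thesis unfolding small_on_def by blast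
qed

text \<open>The conditions on k describe the segment from 0 to h for either sign of h, so only that
  segment has to stay at positive times.\<close>

lemma partial_lipschitz:
  assumes "tame m g" "\<And>k. \<bar>k\<bar> \<le> \<bar>h\<bar> \<Longrightarrow> h * k \<ge> 0 \<Longrightarrow> fst (p + k *\<^sub>R coord_dir c) > 0"
    "\<And>k. \<bar>k\<bar> \<le> \<bar>h\<bar> \<Longrightarrow> h * k \<ge> 0 \<Longrightarrow> \<bar>partial_c c g (p + k *\<^sub>R coord_dir c)\<bar> \<le> L"
  shows "\<bar>g (p + h *\<^sub>R coord_dir c) - g p\<bar> \<le> L * \<bar>h\<bar>"
proof (cases "h = 0")
  case False
  have *: "\<bar>sgn h * k\<bar> \<le> \<bar>h\<bar>" "h * (sgn h * k) \<ge> 0" if "0 \<le> k" "k \<le> \<bar>h\<bar>" for k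
    using that False by (auto simp: abs_mult sgn_if mult_nonpos_nonneg)
  obtain k where k: "0 < k" "k < \<bar>h\<bar>"
    "g (p + (sgn h * \<bar>h\<bar>) *\<^sub>R coord_dir c) - g p = \<bar>h\<bar> * (sgn h * partial_c c g (p + (sgn h * k) *\<^sub>R coord_dir c))"
    by (rule partial_mvt[OF assms(1), of "\<bar>h\<bar>" p "sgn h" c]) (use False * assms(2) in auto)
  have "\<bar>g (p + h *\<^sub>R coord_dir c) - g p\<bar> = \<bar>h\<bar> * \<bar>partial_c c g (p + (sgn h * k) *\<^sub>R coord_dir c)\<bar>"
    using k(3) False by (simp add: abs_mult sgn_mult_abs)
  also have "\<dots> \<le> \<bar>h\<bar> * L"
    using k * by (intro mult_left_mono assms(3)) auto
  finally show ?thesis by (simp add: mult.commute)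
qed simp

text \<open>The coordinates of x are replaced by those of y one at a time; S holds the coordinates
  in which the two points may still differ.\<close>

lemma space_lipschitz:
  fixes g :: "'n::finite field"
  assumes "tame m g" "s > 0" "\<And>x i. \<bar>dx i g (s, x)\<bar> \<le> L"
  shows "\<bar>g (s, x) - g (s, y)\<bar> \<le> L * (\<Sum>i\<in>UNIV. \<bar>x $ i - y $ i\<bar>)"
proof -
  have "\<bar>g (s, x) - g (s, y)\<bar> \<le> L * (\<Sum>i\<in>S. \<bar>x $ i - y $ i\<bar>)"
    if "finite S" "\<And>i. i \<notin> S \<Longrightarrow> x $ i = y $ i" for S x y
    using that
  proof (induction S arbitrary: x)
    case empty
    then have "x = y" by (simp add: vec_eq_iff)
    then show ?case by simp
  next
    case (insert j S)
    define z where "z = x + (y $ j - x $ j) *\<^sub>R axis j 1"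
    have z: "z $ i = (if i = j then y $ j else x $ i)" for i
      by (auto simp: z_def axis_def)
    have "\<bar>g ((s, x) + (y $ j - x $ j) *\<^sub>R coord_dir (Some j)) - g (s, x)\<bar> \<le> L * \<bar>y $ j - x $ j\<bar>"
      by (rule partial_lipschitz[OF assms(1)]) (use assms(2,3) in auto)
    then have "\<bar>g (s, z) - g (s, x)\<bar> \<le> L * \<bar>x $ j - y $ j\<bar>"
      by (simp add: z_def abs_minus_commute)
    moreover have "\<bar>g (s, z) - g (s, y)\<bar> \<le> L * (\<Sum>i\<in>S. \<bar>z $ i - y $ i\<bar>)"
      by (rule insert.IH) (use insert.prems z in auto)
    moreover have "(\<Sum>i\<in>S. \<bar>z $ i - y $ i\<bar>) = (\<Sum>i\<in>S. \<bar>x $ i - y $ i\<bar>)"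
      by (rule sum.cong) (use insert.hyps z in auto)
    ultimately show ?case
      using insert.hyps by (simp add: algebra_simps)
  qed
  from this[of UNIV x y] show ?thesis by simp
qed

text \<open>Once both points are moved into the unit cube, each of the N coordinates differs by at
  most 1.\<close>

lemma periodic_oscillation:
  fixes g :: "'n::finite field"
  assumes "tame m g" "periodic_x g" "s > 0" "\<And>x i. \<bar>dx i g (s, x)\<bar> \<le> L"
  shows "\<bar>g (s, x) - g (s, y)\<bar> \<le> L * real CARD('n)"
proof -
  obtain x' where x': "\<And>i. 0 \<le> x' $ i \<and> x' $ i \<le> 1" "g (s, x') = g (s, x)"
    using periodic_x_unit_cube[of x] assms(2) by metis
  obtain y' where y': "\<And>i. 0 \<le> y' $ i \<and> y' $ i \<le> 1" "g (s, y') = g (s, y)"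
    using periodic_x_unit_cube[of y] assms(2) by metis
  have "L \<ge> 0" using assms(4)[of undefined x] by linarith
  have "\<bar>g (s, x') - g (s, y')\<bar> \<le> L * (\<Sum>i\<in>UNIV. \<bar>x' $ i - y' $ i\<bar>)"
    by (rule space_lipschitz[OF assms(1,3,4)])
  also have "\<dots> \<le> L * (\<Sum>i\<in>(UNIV :: 'n set). 1)"
  proof (intro mult_left_mono sum_mono \<open>L \<ge> 0\<close>)
    show "\<bar>x' $ i - y' $ i\<bar> \<le> 1" for i using x'(1)[of i] y'(1)[of i] by linarith
  qed
  finally show ?thesis using x'(2) y'(2) by simp
qed

section \<open>Integrals over the unit cube\<close>

lemma tame_slice_continuous:
  assumes "tame m g" "t > 0" shows "continuous_on S (\<lambda>x. g (t, x))"
  by (rule continuous_on_compose2[OF tame_continuous[OF assms(1)]])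
    (use assms(2) in \<open>auto intro!: continuous_intros\<close>)

lemma tame_slice_integrable:
  assumes "tame m g" "t > 0" shows "(\<lambda>x. g (t, x)) integrable_on cbox a b"
  by (intro integrable_continuous tame_slice_continuous[OF assms])

lemma torus_int_dt:
  assumes "tame m g" "t > 0"
  shows "((\<lambda>t. torus_int (\<lambda>x. g (t, x))) has_real_derivative torus_int (\<lambda>x. dt g (t, x))) (at t)"
proof -
  have "((\<lambda>t. integral (cbox 0 One) (\<lambda>x. g (t, x))) has_real_derivative
     integral (cbox 0 One) (\<lambda>x. dt g (t, x))) (at t within {0<..})"
  proof (rule leibniz_rule_field_derivative)
    fix r :: real and x :: "real^'a" assume r: "r \<in> {0<..}"
    have "((\<lambda>h. g ((0, x) + h *\<^sub>R coord_dir None)) has_real_derivative dt g ((0, x) + r *\<^sub>R coord_dir None)) (at r)"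
      by (rule tame_has_partial[OF assms(1)]) (use r in simp)
    then show "((\<lambda>r. g (r, x)) has_real_derivative dt g (r, x)) (at r within {0<..})"
      by (simp add: has_field_derivative_at_within)
  next
    show "(\<lambda>x. g (r, x)) integrable_on cbox 0 One" if "r \<in> {0<..}" for r
      using tame_slice_integrable[OF assms(1)] that by simp
  next
    have "continuous_on pos_time (dt g)"
      using tame_continuous[OF tame_0_partial[OF tame_mono[OF assms(1)]]] by simp
    then show "continuous_on ({0<..} \<times> cbox 0 One) (\<lambda>(r, x). dt g (r, x))"
      by (rule continuous_on_cong[THEN iffD1, rotated 2, OF continuous_on_subset]) auto
  qed (use assms(2) in auto)
  then show ?thesis
    using assms(2) by (simp add: torus_int_def at_within_open[of t "{0<..}"])
qed

lemma unit_cube_cart: "cbox 0 (One :: real^'n::finite) = {x. \<forall>i. 0 \<le> x $ i \<and> x $ i \<le> 1}"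
proof -
  have "(One :: real^'n) $ i = 1" for i
    by (simp add: cart_eq_inner_axis axis_in_Basis_iff)
  then show ?thesis by (auto simp: mem_box_cart)
qed

lemma cube_integral_split:
  fixes a b :: "real^'n::finite" and f :: "real^'n \<Rightarrow> real"
  assumes "f integrable_on cbox a b" "a $ i \<le> c" "c \<le> b $ i"
  shows "integral (cbox a b) f =
    integral (cbox a (b + (c - b $ i) *\<^sub>R axis i 1)) f + integral (cbox (a + (c - a $ i) *\<^sub>R axis i 1) b) f"
proof -
  have comp: "(b + (c - b $ i) *\<^sub>R axis i 1) $ j = (if j = i then c else b $ j)"
    "(a + (c - a $ i) *\<^sub>R axis i 1) $ j = (if j = i then c else a $ j)" for j
    by (simp_all add: axis_def)
  have 1: "cbox a b \<inter> {x. x \<bullet> axis i 1 \<le> c} = cbox a (b + (c - b $ i) *\<^sub>R axis i 1)"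
  proof -
    have "(x $ j) \<le> b $ j" if "\<forall>j. a $ j \<le> x $ j \<and> x $ j \<le> (if j = i then c else b $ j)" for x :: "real^'n" and j
      using that[rule_format, of j] assms(3) by (cases "j = i") auto
    then show ?thesis
      unfolding set_eq_iff Int_iff mem_Collect_eq mem_box_cart inner_axis comp by (auto split: if_splits)
  qed
  have 2: "cbox a b \<inter> {x. x \<bullet> axis i 1 \<ge> c} = cbox (a + (c - a $ i) *\<^sub>R axis i 1) b"
  proof -
    have "a $ j \<le> x $ j" if "\<forall>j. (if j = i then c else a $ j) \<le> x $ j \<and> x $ j \<le> b $ j" for x :: "real^'n" and j
      using that[rule_format, of j] assms(2) by (cases "j = i") auto
    then show ?thesis
      unfolding set_eq_iff Int_iff mem_Collect_eq mem_box_cart inner_axis comp by (auto split: if_splits)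
  qed
  have k: "axis i (1::real) \<in> Basis" by (simp add: axis_in_Basis_iff)
  show ?thesis
  proof (rule integral_unique[OF has_integral_split[OF _ _ k, where c = c]])
    show "(f has_integral integral (cbox a (b + (c - b $ i) *\<^sub>R axis i 1)) f) (cbox a b \<inter> {x. x \<bullet> axis i 1 \<le> c})"
      unfolding 1 by (rule integrable_integral, rule integrable_on_subcbox[OF assms(1)]) (use 1 in blast)
    show "(f has_integral integral (cbox (a + (c - a $ i) *\<^sub>R axis i 1) b) f) (cbox a b \<inter> {x. x \<bullet> axis i 1 \<ge> c})"
      unfolding 2 by (rule integrable_integral, rule integrable_on_subcbox[OF assms(1)]) (use 2 in blast)
  qed
qed

text \<open>Lengthen the cube by h in direction i and cut it once at height h and once at height 1:
  the slabs of thickness h at the two ends are translates of each other by one period.\<close>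

lemma periodic_cube_integral_shift:
  fixes f :: "real^'n::finite \<Rightarrow> real"
  assumes "continuous_on UNIV f" "\<And>x. f (x + axis i 1) = f x" "0 \<le> h" "h \<le> 1"
  shows "integral (cbox 0 One) (\<lambda>x. f (x + h *\<^sub>R axis i 1)) = integral (cbox 0 One) f"
proof -
  have int: "f integrable_on cbox a b" for a b
    using assms(1) by (auto intro!: integrable_continuous intro: continuous_on_subset)
  have One: "(One :: real^'n) $ i = 1"
    by (simp add: cart_eq_inner_axis axis_in_Basis_iff)
  let ?e = "axis i 1 :: real^'n"
  let ?b = "One + h *\<^sub>R ?e"
  have "integral (cbox 0 ?b) f = integral (cbox 0 (One + (h - 1) *\<^sub>R ?e)) f + integral (cbox (h *\<^sub>R ?e) ?b) f"
    using cube_integral_split[OF int, of 0 i h ?b] assms(3,4) One by (simp add: scaleR_diff_left add_diff_eq)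
  moreover have "integral (cbox 0 ?b) f = integral (cbox 0 One) f + integral (cbox ?e ?b) f"
    using cube_integral_split[OF int, of 0 i 1 ?b] assms(3,4) One by (simp add: scaleR_diff_left scaleR_add_left)
  moreover have "integral (cbox ?e ?b) f = integral (cbox 0 (One + (h - 1) *\<^sub>R ?e)) f"
    using integral_shift_cbox[of ?e ?e ?b f] assms(2) by (simp add: algebra_simps)
  moreover have "integral (cbox (h *\<^sub>R ?e) ?b) f = integral (cbox 0 One) (\<lambda>x. f (x + h *\<^sub>R ?e))"
    using integral_shift_cbox[of "h *\<^sub>R ?e" "h *\<^sub>R ?e" ?b f] by simp
  ultimately show ?thesis by simp
qed

text \<open>The integral of g shifted by h in direction i does not depend on h, and its derivative
  at h = 0 is the integral in question. Shifts are available for h in [0, 1], hence the one-sided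
  derivative.\<close>

lemma torus_int_dx:
  assumes "tame m g" "periodic_x g" "t > 0"
  shows "torus_int (\<lambda>x. dx i g (t, x)) = 0"
proof -
  let ?I = "\<lambda>h. integral (cbox 0 One) (\<lambda>x. g (t, x + h *\<^sub>R axis i 1))"
  have "(?I has_real_derivative integral (cbox 0 One) (\<lambda>x. dx i g (t, x + 0 *\<^sub>R axis i 1))) (at 0 within {0..1})"
  proof (rule leibniz_rule_field_derivative)
    fix r :: real and x :: "real^'a"
    have "((\<lambda>h. g ((t, x) + h *\<^sub>R coord_dir (Some i))) has_real_derivative dx i g ((t, x) + r *\<^sub>R coord_dir (Some i))) (at r)"
      by (rule tame_has_partial[OF assms(1)]) (use assms(3) in simp)
    then show "((\<lambda>r. g (t, x + r *\<^sub>R axis i 1)) has_real_derivative dx i g (t, x + r *\<^sub>R axis i 1)) (at r within {0..1})"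
      by (simp add: has_field_derivative_at_within)
  next
    show "(\<lambda>x. g (t, x + r *\<^sub>R axis i 1)) integrable_on cbox 0 One" for r
      by (intro integrable_continuous continuous_on_compose2[OF tame_continuous[OF assms(1)]])
        (use assms(3) in \<open>auto intro!: continuous_intros\<close>)
  next
    have "continuous_on pos_time (dx i g)"
      by (rule tame_continuous[OF tame_dx[OF assms(1)]])
    then show "continuous_on ({0..1} \<times> cbox 0 One) (\<lambda>(r, x). dx i g (t, x + r *\<^sub>R axis i 1))"
      unfolding case_prod_beta
      by (rule continuous_on_compose2) (use assms(3) in \<open>auto intro!: continuous_intros\<close>)
  qed auto
  moreover have "?I h = ?I 0" if "h \<in> {0..1}" for h
    using periodic_cube_integral_shift[of "\<lambda>x. g (t, x)" i h] assms(2) that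
      tame_slice_continuous[OF assms(1,3)] by (simp add: periodic_x_def)
  then have "(?I has_real_derivative 0) (at 0 within {0..1})"
    by (intro has_field_derivative_transform_within[OF DERIV_const, of 1]) auto
  moreover have "at (0::real) within {0..1} \<noteq> bot"
    by (simp add: at_within_Icc_at_right)
  ultimately show ?thesis
    using vector_derivative_unique_within
    by (simp add: torus_int_def has_real_derivative_iff_has_vector_derivative) blast
qed

lemma torus_int_ge_box:
  fixes g :: "'n::finite field"
  assumes "tame m g" "s > 0" "\<And>x. g (s, x) \<ge> 0" "cbox a b \<subseteq> cbox 0 One"
    "\<And>x. x \<in> cbox a b \<Longrightarrow> g (s, x) \<ge> M"
  shows "M * measure lborel (cbox a b) \<le> torus_int (\<lambda>x. g (s, x))"
proof -
  have "M * measure lborel (cbox a b) = integral (cbox a b) (\<lambda>x. M)" by simp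
  also have "\<dots> \<le> integral (cbox a b) (\<lambda>x. g (s, x))"
    by (intro integral_le tame_slice_integrable[OF assms(1,2)] assms(5)) auto
  also have "\<dots> \<le> integral (cbox 0 One) (\<lambda>x. g (s, x))"
    by (intro integral_subset_le tame_slice_integrable[OF assms(1,2)] assms(4) ballI assms(3))
  finally show ?thesis by (simp add: torus_int_def)
qed

text \<open>Momentum and energy are normalized with the weight \<open>\<rho>\<close>, so the mean is
  taken with a weight. The difference is the average of f(x) - f(y) over y against w.\<close>

lemma torus_weighted_mean:
  fixes w f :: "'n::finite field"
  assumes "tame m w" "tame m f" "s > 0" "\<And>x. w (s, x) \<ge> 0" "torus_int (\<lambda>x. w (s, x)) = 1"
    "\<And>x y. \<bar>f (s, x) - f (s, y)\<bar> \<le> a"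
  shows "\<bar>f (s, x) - torus_int (\<lambda>y. w (s, y) * f (s, y))\<bar> \<le> a"
proof -
  have w: "(\<lambda>y. w (s, y)) integrable_on cbox 0 One" by (rule tame_slice_integrable[OF assms(1,3)])
  have wf: "(\<lambda>y. w (s, y) * f (s, y)) integrable_on cbox 0 One"
    by (rule tame_slice_integrable[OF tame_mult[OF assms(1,2)] assms(3)])
  have c: "integral (cbox 0 One) (\<lambda>y. w (s, y) * k) = k" "(\<lambda>y. w (s, y) * k) integrable_on cbox 0 One" for k
    using assms(5) w by (auto simp: torus_int_def intro: integrable_on_mult_left)
  have "f (s, x) - torus_int (\<lambda>y. w (s, y) * f (s, y)) =
      integral (cbox 0 One) (\<lambda>y. w (s, y) * f (s, x) - w (s, y) * f (s, y))"
    using c wf by (subst integral_diff) (auto simp: torus_int_def)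
  moreover have "\<bar>integral (cbox 0 One) (\<lambda>y. w (s, y) * f (s, x) - w (s, y) * f (s, y))\<bar>
      \<le> integral (cbox 0 One) (\<lambda>y. w (s, y) * a)"
  proof (rule integral_norm_bound_integral[where 'a = real, unfolded real_norm_def])
    show "(\<lambda>y. w (s, y) * f (s, x) - w (s, y) * f (s, y)) integrable_on cbox 0 One"
      using c wf by (intro integrable_diff)
    show "\<bar>w (s, y) * f (s, x) - w (s, y) * f (s, y)\<bar> \<le> w (s, y) * a" for y
      using assms(4,6) by (simp add: right_diff_distrib[symmetric] abs_mult mult_left_mono)
  qed (rule c)
  ultimately show ?thesis unfolding c(1) by linarith
qed

section \<open>Smallness in terms of the dissipation\<close>

text \<open>The interval of length r extends from s to whichever side has room; it serves for time
  and for each space coordinate.\<close>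

lemma unit_interval_sub:
  fixes s t r :: real
  assumes "t \<le> s" "s \<le> t + 1" "0 < r" "r \<le> 1/2"
  obtains a where "t \<le> a" "a + r \<le> t + 1" "a \<le> s" "s \<le> a + r"
  by (cases "s \<le> t + 1/2") (use assms that[of s] that[of "s - r"] in auto)

lemma finite_uniform_const:
  fixes P :: "'c::finite \<Rightarrow> real \<Rightarrow> bool"
  assumes "\<And>c. \<exists>C. P c C" "\<And>c C C'. P c C \<Longrightarrow> C \<le> C' \<Longrightarrow> P c C'"
  obtains L where "L \<ge> B" "\<And>c. P c L"
proof -
  obtain f where f: "\<And>c. P c (f c)" using assms(1) by metis
  have "f c \<le> (\<Sum>c\<in>UNIV. \<bar>f c\<bar>) + \<bar>B\<bar>" for c
    using member_le_sum[of c UNIV "\<lambda>c. \<bar>f c\<bar>"] by simp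
  moreover have "B \<le> (\<Sum>c\<in>UNIV. \<bar>f c\<bar>) + \<bar>B\<bar>" by (simp add: sum_nonneg add_increasing)
  ultimately show thesis using f assms(2) by (intro that) blast+
qed

text \<open>If the supremum M of g over a window is nearly attained at p, then interpolation bounds the first
  derivatives of g there by M to a power close to 1, so g stays comparable to M on a cube around p
  whose side is a small power of M. Hence the space-time integral controls M almost linearly.\<close>

lemma dissipation_controls_density:
  fixes g :: "'n::finite field" and X :: "real \<Rightarrow> real"
  assumes g: "smooth_bounded g" "periodic_x g" "\<And>p. fst p > 0 \<Longrightarrow> g p \<ge> 0"
    and X: "\<And>t. t > 0 \<Longrightarrow> (X has_real_derivative - torus_int (\<lambda>x. g (t, x))) (at t)"
    and R: "windows R"
    and RX: "\<And>t \<eta>. (t, \<eta>) \<in> R \<Longrightarrow> X t - X (t + 1) \<le> K * \<eta>"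
    and \<alpha>: "0 \<le> \<alpha>" "\<alpha> < 1"
  shows "small_on R \<alpha> g"
proof -
  let ?N = "real CARD('n)"
  \<comment> \<open>The exponent is shared among N + 1 space-time directions: a cube of side about
    m^\<delta> has volume about m^(1 - \<alpha>), and a value of about m on it contributes m^(2 -
    \<alpha>).\<close>
  define \<delta> where "\<delta> = (1 - \<alpha>) / (?N + 1)"
  have \<delta>: "0 < \<delta>" "\<delta> < 1" "\<delta> * (?N + 1) = 1 - \<alpha>"
    using \<alpha> by (auto simp: \<delta>_def field_simps intro: add_nonneg_pos)
  have tame: "tame 1 g" using g(1) by blast
  obtain B0 where B0: "\<And>p. fst p > 0 \<Longrightarrow> \<bar>g p\<bar> \<le> B0"
    using tame_bounded[OF tame] unfolding bounded_pos_def by auto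
  define B where "B = max B0 1"
  have B: "B \<ge> 1" "\<And>p. fst p > 0 \<Longrightarrow> g p \<le> B"
    using B0 by (auto simp: B_def intro: le_max_iff_disj[THEN iffD2] order_trans[OF abs_ge_self])
  \<comment> \<open>Here windows are measured by the size m of g itself. On them g is of order 1 by
    definition, so interpolation gives first derivatives of order 1 - \<delta>. The normalization by
    B keeps m at most 1.\<close>
  define R' where "R' = {(t, m). t > 0 \<and> 0 < m \<and> m \<le> 1 \<and> (\<forall>s x. t \<le> s \<longrightarrow> s \<le> t + 1 \<longrightarrow> g (s, x) \<le> B * m)}"
  have R': "windows R'" by (simp add: windows_def R'_def)
  have small1: "small_on R' 1 g"
    unfolding small_on_def
  proof (intro exI allI impI)
    fix t m s x assume *: "(t, m) \<in> R'" "t \<le> s" "s \<le> t + 1"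
    then have "g (s, x) \<ge> 0" using g(3)[of "(s, x)"] by (simp add: R'_def)
    then show "\<bar>g (s, x)\<bar> \<le> B * m powr 1" using * by (simp add: R'_def)
  qed
  have "\<exists>C. \<forall>t m s x. (t, m) \<in> R' \<longrightarrow> t \<le> s \<longrightarrow> s \<le> t + 1 \<longrightarrow> \<bar>partial_c c g (s, x)\<bar> \<le> C * m powr (1 - \<delta>)" for c
    using small_on_partial[OF R' g(1) _ small1, of "1 - \<delta>" c] \<delta>(1) unfolding small_on_def by simp
  then obtain L where L: "L \<ge> B" and
    "\<And>c. \<forall>t m s x. (t, m) \<in> R' \<longrightarrow> t \<le> s \<longrightarrow> s \<le> t + 1 \<longrightarrow> \<bar>partial_c c g (s, x)\<bar> \<le> L * m powr (1 - \<delta>)"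
    by (rule finite_uniform_const[where B = B and P = "\<lambda>c C. \<forall>t m s x. (t, m) \<in> R' \<longrightarrow> t \<le> s \<longrightarrow> s \<le> t + 1 \<longrightarrow>
      \<bar>partial_c c g (s, x)\<bar> \<le> C * m powr (1 - \<delta>)"]) (meson mult_right_mono order_trans powr_ge_zero, blast)
  then have dL: "\<bar>partial_c c g (s, x)\<bar> \<le> L * m powr (1 - \<delta>)" if "(t, m) \<in> R'" "t \<le> s" "s \<le> t + 1" for c t m s x
    using that by blast
  \<comment> \<open>Chosen so that g changes by at most B m / 4 over a space-time cube of side r = b
    m^\<delta>, half of the value B m / 2 available at the starting point; b \<le> 1/2 lets the cube
    fit into the window.\<close>
  define b where "b = B / (4 * (?N + 1) * L)"
  have N1: "?N \<ge> 1" by (simp add: Suc_leI)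
  have b: "0 < b" "b \<le> 1/2"
  proof -
    have L0: "L > 0" using L B(1) by linarith
    then show "0 < b" unfolding b_def using B(1) N1 by (intro divide_pos_pos mult_pos_pos) linarith+
    have "1 * L \<le> (2 * (?N + 1)) * L" using L0 N1 by (intro mult_right_mono) auto
    then have "B \<le> 1/2 * (4 * (?N + 1) * L)" using L by linarith
    moreover have "4 * (?N + 1) * L > 0" using L0 N1 by (intro mult_pos_pos) linarith+
    ultimately show "b \<le> 1/2" unfolding b_def by (simp only: pos_divide_le_eq)
  qed
  define c0 where "c0 = B / 4 * b ^ (CARD('n) + 1)"
  have c0: "c0 > 0" using b B(1) by (simp add: c0_def)
  have main: "c0 * m powr (2 - \<alpha>) \<le> X t - X (t + 1)"
    if m: "(t, m) \<in> R'" and p0: "t \<le> s0" "s0 \<le> t + 1" "g (s0, x0) \<ge> B * m / 2" for t m s0 x0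
  proof -
    have m0: "t > 0" "0 < m" "m \<le> 1" using windowsD[OF R' m] by auto
    \<comment> \<open>Inside the unit cube there is room for a box of side r containing the point,
      which in each coordinate extends to the side with enough space.\<close>
    obtain x1 where x1: "\<And>i. 0 \<le> x1 $ i \<and> x1 $ i \<le> 1" "g (s0, x1) = g (s0, x0)"
      using periodic_x_unit_cube[of x0] g(2) by metis
    define r where "r = b * m powr \<delta>"
    have "m powr \<delta> \<le> 1" using m0 \<delta> by (simp add: powr_le1)
    then have "b * m powr \<delta> \<le> b * 1" using b by (intro mult_left_mono) auto
    then have r: "0 < r" "r \<le> 1/2"
      using b m0 unfolding r_def by (simp, linarith)
    obtain a0 where a0: "t \<le> a0" "a0 + r \<le> t + 1" "a0 \<le> s0" "s0 \<le> a0 + r"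
      using unit_interval_sub[OF p0(1,2) r] by blast
    have "\<exists>a. 0 \<le> a \<and> a + r \<le> 1 \<and> a \<le> x1 $ i \<and> x1 $ i \<le> a + r" for i
      using unit_interval_sub[of 0 "x1 $ i" r] x1(1)[of i] r by force
    then obtain f where f: "\<And>i. 0 \<le> f i \<and> f i + r \<le> 1 \<and> f i \<le> x1 $ i \<and> x1 $ i \<le> f i + r" by metis
    define a :: "real^'n" where "a = (\<chi> i. f i)"
    define a' :: "real^'n" where "a' = (\<chi> i. f i + r)"
    have sub: "cbox a a' \<subseteq> cbox 0 One"
    proof
      fix x assume x: "x \<in> cbox a a'"
      have "0 \<le> x $ i \<and> x $ i \<le> 1" for i
        using x f[of i] by (auto simp: mem_box_cart a_def a'_def dest!: spec[of _ i])
      then show "x \<in> cbox 0 One" by (simp add: unit_cube_cart)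
    qed
    have vol: "measure lborel (cbox a a') = r ^ CARD('n)"
    proof -
      have "a \<in> cbox a a'" using r by (simp add: mem_box_cart a_def a'_def)
      then have "cbox a a' \<noteq> {}" by blast
      from content_cbox_cart[OF this] show ?thesis by (simp add: a_def a'_def)
    qed
    define l where "l = L * m powr (1 - \<delta>)"
    have lr: "l * ((?N + 1) * r) = B * m / 4"
    proof -
      have "m powr (1 - \<delta>) * m powr \<delta> = m" using m0 by (simp add: powr_add[symmetric])
      moreover have "L' * (n * (B / (4 * n * L'))) = B / 4" if "n > 0" "L' > 0" for n L'
        using that by (simp add: field_simps)
      from this[of "?N + 1" L] have "L * ((?N + 1) * b) = B / 4"
        using L B(1) N1 unfolding b_def by linarith
      ultimately show ?thesis
        unfolding l_def r_def by (metis (no_types, lifting) mult.assoc mult.left_commute times_divide_eq_left)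
    qed
    have l0: "l \<ge> 0" using L B(1) by (simp add: l_def)
    have low: "g (s, x) \<ge> B * m / 4" if s: "a0 \<le> s" "s \<le> a0 + r" and x: "x \<in> cbox a a'" for s x
    proof -
      have s': "t \<le> s" "s \<le> t + 1" "s > 0" using s a0 m0 by auto
      have "\<bar>g (s, x) - g (s, x1)\<bar> \<le> l * (\<Sum>i\<in>UNIV. \<bar>x $ i - x1 $ i\<bar>)"
        unfolding l_def by (rule space_lipschitz[OF tame s'(3)]) (rule dL[OF m s'(1,2)])
      also have "(\<Sum>i\<in>UNIV. \<bar>x $ i - x1 $ i\<bar>) \<le> (\<Sum>i\<in>(UNIV :: 'n set). r)"
      proof (rule sum_mono)
        show "\<bar>x $ i - x1 $ i\<bar> \<le> r" for i
          using x f[of i] by (auto simp: mem_box_cart a_def a'_def abs_le_iff dest!: spec[of _ i])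
      qed
      finally have 1: "\<bar>g (s, x) - g (s, x1)\<bar> \<le> l * (?N * r)"
        using l0 by (simp add: mult_left_mono)
      have "\<bar>g ((s0, x1) + (s - s0) *\<^sub>R coord_dir None) - g (s0, x1)\<bar> \<le> l * \<bar>s - s0\<bar>"
      proof (rule partial_lipschitz[OF tame])
        fix k assume k: "\<bar>k\<bar> \<le> \<bar>s - s0\<bar>" "(s - s0) * k \<ge> 0"
        have "t \<le> s0 + k \<and> s0 + k \<le> t + 1"
          using k s' p0 by (cases "s \<ge> s0") (auto simp: zero_le_mult_iff)
        then show "0 < fst ((s0, x1) + k *\<^sub>R coord_dir None)"
          "\<bar>dt g ((s0, x1) + k *\<^sub>R coord_dir None)\<bar> \<le> l"
          using dL[OF m, of "s0 + k" None x1] m0 by (auto simp: l_def)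
      qed
      also have "\<dots> \<le> l * r" using s a0 l0 by (intro mult_left_mono) auto
      finally have 2: "\<bar>g (s, x1) - g (s0, x1)\<bar> \<le> l * r" by simp
      have "g (s0, x1) - g (s, x) \<le> l * (?N * r) + l * r" using 1 2 by linarith
      also have "\<dots> = B * m / 4" using lr by (simp add: algebra_simps)
      finally show ?thesis using p0(3) x1(2) by simp
    qed
    have dX: "torus_int (\<lambda>x. g (s, x)) \<ge> 0" if "s > 0" for s
      using torus_int_ge_box[OF tame that, of 0 One 0] g(3) that by simp
    have mono: "X z \<le> X y" if "0 < y" "y \<le> z" for y z
    proof (rule DERIV_nonpos_imp_nonincreasing[OF that(2)])
      show "\<exists>d. DERIV X w :> d \<and> d \<le> 0" if "y \<le> w" "w \<le> z" for w
        using X[of w] dX[of w] that \<open>0 < y\<close> by (intro exI[of _ "- torus_int (\<lambda>x. g (w, x))"]) auto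
    qed
    \<comment> \<open>The mean value theorem stands in for the time integral of the dissipation: the
      lower bound on the box holds at every time z of the short interval.\<close>
    have "\<exists>z. a0 < z \<and> z < a0 + r \<and> X (a0 + r) - X a0 = (a0 + r - a0) * (- torus_int (\<lambda>x. g (z, x)))"
      by (rule MVT2) (use r a0 m0 X in auto)
    then obtain z where z: "a0 < z" "z < a0 + r" "X a0 - X (a0 + r) = r * torus_int (\<lambda>x. g (z, x))" by auto
    have "B * m / 4 * measure lborel (cbox a a') \<le> torus_int (\<lambda>x. g (z, x))"
      by (rule torus_int_ge_box[OF tame _ _ sub]) (use z a0 m0 g(3) low in auto)
    then have "r * (B * m / 4 * r ^ CARD('n)) \<le> X a0 - X (a0 + r)"
      unfolding z(3) vol using r by (intro mult_left_mono) auto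
    also have "r * (B * m / 4 * r ^ CARD('n)) = c0 * m powr (2 - \<alpha>)"
    proof -
      have "m powr (2 - \<alpha>) = m * m powr (\<delta> * (?N + 1))"
        using m0 unfolding \<delta>(3) by (metis add_diff_eq one_add_one powr_add powr_one less_imp_le)
      also have "m powr (\<delta> * (?N + 1)) = (m powr \<delta>) ^ (CARD('n) + 1)"
        using m0 powr_realpow[of "m powr \<delta>" "CARD('n) + 1"] by (simp add: powr_powr add.commute)
      finally show ?thesis by (simp add: c0_def r_def power_mult_distrib)
    qed
    finally show ?thesis
      using mono[of t a0] mono[of "a0 + r" "t + 1"] a0 m0 r by auto
  qed
  \<comment> \<open>This solves c0 m^(2 - \<alpha>) \<le> |K| \<eta> for m. The resulting exponent
    1/(2 - \<alpha>) is at least \<alpha> because \<alpha> (2 - \<alpha>) \<le> 1.\<close>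
  define C where "C = B * (\<bar>K\<bar> / c0) powr (1 / (2 - \<alpha>))"
  show ?thesis
    unfolding small_on_def
  proof (intro exI[of _ C] allI impI)
    fix t \<eta> s x assume *: "(t, \<eta>) \<in> R" "t \<le> s" "s \<le> t + 1"
    note \<eta> = windowsD[OF R *(1)]
    define M where "M = (SUP p\<in>{t..t+1}\<times>UNIV. g p)"
    have bdd: "bdd_above (g ` ({t..t+1}\<times>UNIV))"
      using B(2) \<eta> by (intro bdd_aboveI2[of _ _ B]) auto
    have gM: "g (s', x') \<le> M" if "t \<le> s'" "s' \<le> t + 1" for s' x'
      unfolding M_def using bdd that by (intro cSUP_upper) auto
    have MB: "M \<le> B" unfolding M_def using B(2) \<eta> by (intro cSUP_least) auto
    have C0: "C * \<eta> powr \<alpha> \<ge> 0" using B(1) by (simp add: C_def)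
    have "M \<le> C * \<eta> powr \<alpha>"
    proof (cases "M \<le> 0")
      case False
      define m where "m = M / B"
      have m: "0 < m" "m \<le> 1" "B * m = M" using False MB B(1) by (auto simp: m_def)
      have mR: "(t, m) \<in> R'" using m \<eta> gM by (simp add: R'_def)
      \<comment> \<open>Attainment of the supremum is avoided: a point with more than half of it
        suffices, which in terms of m is the value B m / 2.\<close>
      have "M / 2 < M" using False by simp
      then obtain p where p: "p \<in> {t..t+1}\<times>UNIV" "M / 2 < g p"
        using less_cSUP_iff[OF _ bdd, of "M / 2"] unfolding M_def[symmetric] by auto
      have "c0 * m powr (2 - \<alpha>) \<le> X t - X (t + 1)"
        by (rule main[OF mR, of "fst p" "snd p"]) (use p m in auto)
      also have "\<dots> \<le> \<bar>K\<bar> * \<eta>" using RX[OF *(1)] \<eta> by (meson abs_ge_self less_imp_le mult_right_mono order_trans)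
      finally have "m powr (2 - \<alpha>) \<le> \<bar>K\<bar> / c0 * \<eta>" using c0 by (simp add: field_simps)
      then have "(m powr (2 - \<alpha>)) powr (1 / (2 - \<alpha>)) \<le> (\<bar>K\<bar> / c0 * \<eta>) powr (1 / (2 - \<alpha>))"
        using \<alpha> by (intro powr_mono2) auto
      also have "(m powr (2 - \<alpha>)) powr (1 / (2 - \<alpha>)) = m" using m \<alpha> by (simp add: powr_powr)
      also have "(\<bar>K\<bar> / c0 * \<eta>) powr (1 / (2 - \<alpha>)) = (\<bar>K\<bar> / c0) powr (1 / (2 - \<alpha>)) * \<eta> powr (1 / (2 - \<alpha>))"
        by (rule powr_mult)
      also have "\<dots> \<le> (\<bar>K\<bar> / c0) powr (1 / (2 - \<alpha>)) * \<eta> powr \<alpha>"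
      proof (intro mult_left_mono powr_mono')
        have "0 \<le> (1 - \<alpha>)\<^sup>2" by simp
        then have "\<alpha> * (2 - \<alpha>) \<le> 1" by (simp add: power2_eq_square algebra_simps)
        then show "\<alpha> \<le> 1 / (2 - \<alpha>)" using \<alpha> by (simp add: field_simps)
      qed (use \<eta> in auto)
      finally show ?thesis
        unfolding m(3)[symmetric] C_def using B(1) by (simp add: mult.assoc mult_left_mono)
    qed (use C0 in linarith)
    then show "\<bar>g (s, x)\<bar> \<le> C * \<eta> powr \<alpha>"
      using gM[OF *(2,3), of x] g(3)[of "(s, x)"] \<eta> * by auto
  qed
qed

section \<open>Calculus of small fields\<close>

lemma small_on_add:
  assumes "small_on R \<alpha> g" "small_on R \<alpha> h"
  shows "small_on R \<alpha> (\<lambda>p. g p + h p)"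
proof -
  obtain A B where A: "\<And>t \<eta> s x. (t, \<eta>) \<in> R \<Longrightarrow> t \<le> s \<Longrightarrow> s \<le> t + 1 \<Longrightarrow> \<bar>g (s, x)\<bar> \<le> A * \<eta> powr \<alpha>"
    and B: "\<And>t \<eta> s x. (t, \<eta>) \<in> R \<Longrightarrow> t \<le> s \<Longrightarrow> s \<le> t + 1 \<Longrightarrow> \<bar>h (s, x)\<bar> \<le> B * \<eta> powr \<alpha>"
    using assms unfolding small_on_def by blast
  have "\<bar>g (s, x) + h (s, x)\<bar> \<le> (A + B) * \<eta> powr \<alpha>" if "(t, \<eta>) \<in> R" "t \<le> s" "s \<le> t + 1" for t \<eta> s x
    using A[OF that, of x] B[OF that, of x] by (simp add: algebra_simps)
  then show ?thesis unfolding small_on_def by blast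
qed

lemma small_on_mult:
  assumes R: "windows R" and "bounded_pos f" "small_on R \<alpha> g"
  shows "small_on R \<alpha> (\<lambda>p. f p * g p)"
proof -
  obtain A where A: "\<And>t \<eta> s x. (t, \<eta>) \<in> R \<Longrightarrow> t \<le> s \<Longrightarrow> s \<le> t + 1 \<Longrightarrow> \<bar>g (s, x)\<bar> \<le> A * \<eta> powr \<alpha>"
    using assms(3) unfolding small_on_def by blast
  obtain B where B: "\<And>p. fst p > 0 \<Longrightarrow> \<bar>f p\<bar> \<le> B"
    using assms(2) unfolding bounded_pos_def by blast
  have "\<bar>f (s, x) * g (s, x)\<bar> \<le> (B * A) * \<eta> powr \<alpha>" if "(t, \<eta>) \<in> R" "t \<le> s" "s \<le> t + 1" for t \<eta> s x
  proof -
    have "\<bar>f (s, x)\<bar> \<le> B" using B[of "(s, x)"] windowsD[OF R that(1)] that by simp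
    then have "\<bar>f (s, x)\<bar> * \<bar>g (s, x)\<bar> \<le> B * (A * \<eta> powr \<alpha>)"
      using A[OF that, of x] by (intro mult_mono) auto
    then show ?thesis by (simp add: abs_mult mult.assoc)
  qed
  then show ?thesis unfolding small_on_def by blast
qed

lemma small_on_cong:
  assumes R: "windows R" and "\<And>p. fst p > 0 \<Longrightarrow> g p = h p" "small_on R \<alpha> g"
  shows "small_on R \<alpha> h"
proof -
  obtain A where A: "\<And>t \<eta> s x. (t, \<eta>) \<in> R \<Longrightarrow> t \<le> s \<Longrightarrow> s \<le> t + 1 \<Longrightarrow> \<bar>g (s, x)\<bar> \<le> A * \<eta> powr \<alpha>"
    using assms(3) unfolding small_on_def by blast
  have "\<bar>h (s, x)\<bar> \<le> A * \<eta> powr \<alpha>" if "(t, \<eta>) \<in> R" "t \<le> s" "s \<le> t + 1" for t \<eta> s x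
    using A[OF that, of x] assms(2)[of "(s, x)"] windowsD[OF R that(1)] that by simp
  then show ?thesis unfolding small_on_def by blast
qed

text \<open>All exponents below 1/2 rather than a fixed one: each differentiation loses an
  arbitrarily small amount, so the class is stable under any number of them.\<close>

definition half_order :: "(real \<times> real) set \<Rightarrow> 'n::finite field \<Rightarrow> bool" where
  "half_order R g \<longleftrightarrow> windows R \<and> smooth_bounded g \<and> (\<forall>\<alpha><1/2. small_on R \<alpha> g)"

lemma half_order_tame: "half_order R g \<Longrightarrow> tame m g"
  by (simp add: half_order_def)

lemma half_order_add: "half_order R g \<Longrightarrow> half_order R h \<Longrightarrow> half_order R (\<lambda>p. g p + h p)"
  by (simp add: half_order_def small_on_add tame_add)

lemma half_order_mult:
  assumes "half_order R g" "smooth_bounded f"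
  shows "half_order R (\<lambda>p. f p * g p)"
proof -
  have "bounded_pos f" using assms(2) tame_bounded[of 1 f] by (meson zero_less_one)
  then show ?thesis using assms by (auto simp: half_order_def intro: small_on_mult tame_mult)
qed

lemma half_order_mult_right: "half_order R g \<Longrightarrow> smooth_bounded f \<Longrightarrow> half_order R (\<lambda>p. g p * f p)"
  using half_order_mult[of R g f] by (simp add: mult.commute)

lemma half_order_uminus: "half_order R g \<Longrightarrow> half_order R (\<lambda>p. - g p)"
  using half_order_mult[of R g "\<lambda>_. -1"] by simp

lemma half_order_diff: "half_order R g \<Longrightarrow> half_order R h \<Longrightarrow> half_order R (\<lambda>p. g p - h p)"
  using half_order_add[of R g "\<lambda>p. - h p"] half_order_uminus[of R h] by simp

lemma half_order_cmult: "half_order R g \<Longrightarrow> half_order R (\<lambda>p. a * g p)"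
  using half_order_mult[of R g "\<lambda>_. a"] by simp

lemma half_order_zero: "windows R \<Longrightarrow> half_order R (\<lambda>p. 0)"
  by (auto simp: half_order_def small_on_def intro!: exI[of _ 0])

lemma half_order_sum:
  "windows R \<Longrightarrow> (\<And>i. i \<in> I \<Longrightarrow> half_order R (g i)) \<Longrightarrow> half_order R (\<lambda>p. \<Sum>i\<in>I. g i p)"
  by (induction I rule: infinite_finite_induct) (auto intro: half_order_add half_order_zero)

lemma half_order_cong:
  assumes "half_order R g" "\<And>p. fst p > 0 \<Longrightarrow> g p = h p"
  shows "half_order R h"
  using assms(1) unfolding half_order_def
  by (auto intro: tame_cong[OF assms(2)] small_on_cong[OF _ assms(2)])

lemma half_order_partial:
  assumes "half_order R g" shows "half_order R (partial_c c g)"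
  unfolding half_order_def
proof (intro conjI allI impI)
  show "windows R" "tame m (partial_c c g)" for m
    using assms smooth_bounded_partial unfolding half_order_def by blast+
  fix \<alpha> :: real assume \<alpha>: "\<alpha> < 1/2"
  \<comment> \<open>An exponent strictly between \<alpha> and 1/2; the maximum with 0 makes it
    positive, as interpolation requires.\<close>
  define \<beta> where "\<beta> = (max \<alpha> 0 + 1/2) / 2"
  have \<beta>: "max \<alpha> 0 < \<beta>" "\<beta> < 1/2" using \<alpha> by (auto simp: \<beta>_def)
  show "small_on R \<alpha> (partial_c c g)"
    by (rule small_on_partial[of R g \<beta>]) (use assms \<beta> in \<open>simp_all add: half_order_def\<close>)
qed

lemma half_order_periodic_dx:
  assumes "half_order R (dx i (dx i g))" "smooth_bounded g" "periodic_x g"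
  shows "half_order R (dx i g)"
  using assms smooth_bounded_partial[of g "Some i"] small_on_periodic_dx[of R 0 g]
  unfolding half_order_def by blast

text \<open>The dissipation bounds the squares of the strain and of grad T, so its orders below 1
  become orders below 1/2 for these fields.\<close>

lemma half_order_sqrt:
  assumes R: "windows R" and "smooth_bounded f" "c > 0" "\<And>p. fst p > 0 \<Longrightarrow> (f p)\<^sup>2 \<le> c * g p"
    and small: "\<And>\<alpha>. 0 \<le> \<alpha> \<Longrightarrow> \<alpha> < 1 \<Longrightarrow> small_on R \<alpha> g"
  shows "half_order R f"
  unfolding half_order_def
proof (intro conjI allI impI)
  fix \<alpha> :: real assume "\<alpha> < 1/2"
  define \<beta> where "\<beta> = max \<alpha> 0"
  have \<beta>: "0 \<le> 2 * \<beta>" "2 * \<beta> < 1" "\<alpha> \<le> \<beta>" using \<open>\<alpha> < 1/2\<close> by (auto simp: \<beta>_def)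
  obtain A where A: "\<And>t \<eta> s x. (t, \<eta>) \<in> R \<Longrightarrow> t \<le> s \<Longrightarrow> s \<le> t + 1 \<Longrightarrow> \<bar>g (s, x)\<bar> \<le> A * \<eta> powr (2 * \<beta>)"
    using small[OF \<beta>(1,2)] unfolding small_on_def by blast
  have "\<bar>f (s, x)\<bar> \<le> sqrt (c * \<bar>A\<bar>) * \<eta> powr \<beta>" if "(t, \<eta>) \<in> R" "t \<le> s" "s \<le> t + 1" for t \<eta> s x
  proof (rule power2_le_imp_le)
    have \<eta>: "\<eta> > 0" "s > 0" using windowsD[OF R that(1)] that by auto
    have "\<bar>f (s, x)\<bar>\<^sup>2 \<le> c * g (s, x)" using assms(4)[of "(s, x)"] \<eta> by simp
    also have "\<dots> \<le> c * (\<bar>A\<bar> * \<eta> powr (2 * \<beta>))"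
      using A[OF that, of x] assms(3)
      by (intro mult_left_mono) (auto intro: order_trans[OF _ mult_right_mono[of A "\<bar>A\<bar>"]])
    also have "\<eta> powr (2 * \<beta>) = (\<eta> powr \<beta>)\<^sup>2"
      using \<eta> by (simp add: power2_eq_square powr_add[symmetric])
    also have "c * (\<bar>A\<bar> * (\<eta> powr \<beta>)\<^sup>2) = (sqrt (c * \<bar>A\<bar>) * \<eta> powr \<beta>)\<^sup>2"
      using assms(3) by (simp add: power_mult_distrib)
    finally show "\<bar>f (s, x)\<bar>\<^sup>2 \<le> (sqrt (c * \<bar>A\<bar>) * \<eta> powr \<beta>)\<^sup>2" .
  qed (use assms(3) in simp)
  then have "small_on R \<beta> f" unfolding small_on_def by blast
  then show "small_on R \<alpha> f" using small_on_mono[OF R] \<beta>(3) by blast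
qed (use assms in blast)+

section \<open>Decay from a difference inequality\<close>

text \<open>X decreases, so in each of the k unit steps it drops by at least the amount that belongs
  to the last value.\<close>

lemma telescoping_decay:
  fixes X :: "real \<Rightarrow> real"
  assumes mono: "\<And>s t. 0 < s \<Longrightarrow> s \<le> t \<Longrightarrow> X t \<le> X s" and nonneg: "\<And>t. 0 < t \<Longrightarrow> 0 \<le> X t"
    and gap: "\<And>t. t > 0 \<Longrightarrow> c * X t powr a \<le> X t - X (t + 1)" and c: "c > 0" and a: "a > 0" and t: "t > 0"
  shows "real k * (c * X (t + real k) powr a) \<le> X t - X (t + real k)"
proof (induction k)
  case (Suc k)
  have "X (t + real (Suc k)) powr a \<le> X (t + real k) powr a"
    using t a mono[of "t + real k" "t + real (Suc k)"] nonneg[of "t + real (Suc k)"] by (intro powr_mono2) auto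
  then have "c * X (t + real (Suc k)) powr a \<le> c * X (t + real k) powr a" using c by simp
  moreover from this have "real k * (c * X (t + real (Suc k)) powr a) \<le> real k * (c * X (t + real k) powr a)"
    by (rule mult_left_mono) simp
  moreover have "c * X (t + real k) powr a \<le> X (t + real k) - X (t + real (Suc k))"
    using gap[of "t + real k"] t by (simp add: add_ac)
  ultimately show ?case using Suc by (simp add: algebra_simps)
qed simp

text \<open>Summing the gap inequality from t/2 to t improves a decay exponent b to (b + 1) * \<alpha>,
  which equals b + 1/2 for a suitable \<alpha>.\<close>

lemma superpolynomial_decay:
  fixes X :: "real \<Rightarrow> real"
  assumes mono: "\<And>s t. 0 < s \<Longrightarrow> s \<le> t \<Longrightarrow> X t \<le> X s" and nonneg: "\<And>t. 0 < t \<Longrightarrow> 0 \<le> X t"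
    and gap: "\<And>\<alpha>. 0 < \<alpha> \<Longrightarrow> \<alpha> < 1 \<Longrightarrow> \<exists>c>0. \<forall>t>0. c * X t powr (1 / \<alpha>) \<le> X t - X (t + 1)"
  shows "\<exists>C. \<forall>t\<ge>1. X t \<le> C * t powr (- (real n / 2))"
proof (induction n)
  case 0
  show ?case using mono[of 1] by (intro exI[of _ "X 1"]) auto
next
  case (Suc n)
  then obtain C where C: "\<And>t. t \<ge> 1 \<Longrightarrow> X t \<le> C * t powr (- (real n / 2))" by blast
  define b where "b = real n / 2"
  define \<alpha> where "\<alpha> = (b + 1/2) / (b + 1)"
  have b: "b \<ge> 0" by (simp add: b_def)
  then have \<alpha>: "0 < \<alpha>" "\<alpha> < 1" "\<alpha> * (b + 1) = b + 1/2"
    by (auto simp: \<alpha>_def field_simps)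
  obtain c where c: "c > 0" "\<And>t. t > 0 \<Longrightarrow> c * X t powr (1 / \<alpha>) \<le> X t - X (t + 1)"
    using gap[OF \<alpha>(1,2)] by blast
  have C0: "C \<ge> 0" using C[of 1] nonneg[of 1] by simp
  define D where "D = 4 * C * 2 powr b / c"
  have D0: "D \<ge> 0" using C0 c by (simp add: D_def)
  have big: "X t \<le> D powr \<alpha> * t powr (- (b + 1/2))" if t: "t \<ge> 2" for t
  proof -
    \<comment> \<open>About t/2 unit steps, so that X at time t is compared with X at a time of at
      least t/2. The bound k \<ge> t/4 uses t \<ge> 2; times between 1 and 2 are treated
      separately.\<close>
    define k where "k = nat \<lfloor>t / 2\<rfloor>"
    have "1 \<le> \<lfloor>t / 2\<rfloor>" using t by (simp add: le_floor_iff)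
    then have k: "real k \<le> t / 2" "t / 4 \<le> real k" unfolding k_def by linarith+
    define s where "s = t - real k"
    have s: "t / 2 \<le> s" "1 \<le> s" "s + real k = t" using k t by (auto simp: s_def)
    have "real k * (c * X (s + real k) powr (1 / \<alpha>)) \<le> X s - X (s + real k)"
      by (rule telescoping_decay[of X, OF mono nonneg c(2,1)]) (use \<alpha> s in auto)
    also have "\<dots> \<le> X s" using nonneg[of "s + real k"] s by simp
    also have "\<dots> \<le> C * s powr (- b)" using C[OF s(2)] by (simp add: b_def)
    also have "\<dots> \<le> C * (t / 2) powr (- b)"
      using s t C0 b by (intro mult_left_mono powr_mono2') auto
    also have "(t / 2) powr (- b) = 2 powr b * t powr (- b)"
      using t by (simp add: powr_divide powr_minus field_simps)
    finally have 1: "real k * (c * X t powr (1 / \<alpha>)) \<le> C * (2 powr b * t powr (- b))" by (simp add: s)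
    have "t / 4 * (c * X t powr (1 / \<alpha>)) \<le> real k * (c * X t powr (1 / \<alpha>))"
      using k c by (intro mult_right_mono) auto
    with 1 have "t / 4 * (c * X t powr (1 / \<alpha>)) \<le> C * (2 powr b * t powr (- b))"
      by linarith
    then have "t * X t powr (1 / \<alpha>) \<le> 4 * (C * (2 powr b * t powr (- b))) / c"
      using c(1) by (simp add: field_simps)
    also have "\<dots> = D * t powr (- b)" by (simp add: D_def)
    finally have "t * X t powr (1 / \<alpha>) \<le> D * t powr (- b)" .
    then have "X t powr (1 / \<alpha>) \<le> D * t powr (- b) / t"
      using t by (simp add: field_simps)
    also have "\<dots> = D * t powr (- (b + 1))"
      using t by (simp add: powr_diff powr_minus field_simps powr_add)
    finally have "(X t powr (1 / \<alpha>)) powr \<alpha> \<le> (D * t powr (- (b + 1))) powr \<alpha>"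
      using \<alpha> by (intro powr_mono2) auto
    also have "(X t powr (1 / \<alpha>)) powr \<alpha> = X t" using \<alpha> nonneg[of t] t by (simp add: powr_powr)
    also have "(D * t powr (- (b + 1))) powr \<alpha> = D powr \<alpha> * t powr (- (b + 1/2))"
      using D0 \<alpha>(3) by (subst powr_mult) (auto simp: powr_powr mult.commute[of _ \<alpha>] minus_mult_right[symmetric] simp del: minus_add_distrib)
    finally show ?thesis .
  qed
  have small: "X t \<le> (X 1 * 2 powr (b + 1/2)) * t powr (- (b + 1/2))" if t: "1 \<le> t" "t \<le> 2" for t
  proof -
    have "1 = 2 powr (b + 1/2) * 2 powr (- (b + 1/2))" by (simp add: powr_add[symmetric])
    also have "\<dots> \<le> 2 powr (b + 1/2) * t powr (- (b + 1/2))"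
      using t b by (intro mult_left_mono powr_mono2') auto
    finally have "X 1 * 1 \<le> X 1 * (2 powr (b + 1/2) * t powr (- (b + 1/2)))"
      using nonneg[of 1] by (intro mult_left_mono) auto
    then show ?thesis using mono[of 1 t] t by (simp add: mult.assoc)
  qed
  define E where "E = max (D powr \<alpha>) (X 1 * 2 powr (b + 1/2))"
  have "X t \<le> E * t powr (- (b + 1/2))" if "t \<ge> 1" for t
  proof (cases "t \<ge> 2")
    case True
    have "D powr \<alpha> * t powr (- (b + 1/2)) \<le> E * t powr (- (b + 1/2))"
      by (intro mult_right_mono) (auto simp: E_def)
    then show ?thesis using big[OF True] by linarith
  next
    case False
    have "(X 1 * 2 powr (b + 1/2)) * t powr (- (b + 1/2)) \<le> E * t powr (- (b + 1/2))"
      by (intro mult_right_mono) (auto simp: E_def)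
    then show ?thesis using small[of t] that False by linarith
  qed
  moreover have "b + 1/2 = real (Suc n) / 2" by (simp add: b_def field_simps)
  ultimately show ?case by metis
qed

section \<open>The compressible Navier--Stokes system\<close>

lemma tame_partial_add:
  "tame m g \<Longrightarrow> tame m h \<Longrightarrow> fst p > 0 \<Longrightarrow> partial_c c (\<lambda>q. g q + h q) p = partial_c c g p + partial_c c h p"
  by (rule partial_c_add[OF tame_partially_differentiable tame_partially_differentiable])

lemma tame_partial_mult:
  "tame m g \<Longrightarrow> tame m h \<Longrightarrow> fst p > 0 \<Longrightarrow>
    partial_c c (\<lambda>q. g q * h q) p = partial_c c g p * h p + g p * partial_c c h p"
  by (rule partial_c_mult[OF tame_partially_differentiable tame_partially_differentiable])

lemma tame_partial_cmult:
  "tame m g \<Longrightarrow> fst p > 0 \<Longrightarrow> partial_c c (\<lambda>q. a * g q) p = a * partial_c c g p"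
  using tame_partial_mult[of m "\<lambda>_. a" g p c] by simp

lemma tame_partial_divide:
  "tame m g \<Longrightarrow> fst p > 0 \<Longrightarrow> partial_c c (\<lambda>q. g q / a) p = partial_c c g p / a"
  using tame_partial_cmult[of m g p c "inverse a"] by (simp add: divide_inverse mult.commute)

lemma tame_partial_diff:
  "tame m g \<Longrightarrow> tame m h \<Longrightarrow> fst p > 0 \<Longrightarrow> partial_c c (\<lambda>q. g q - h q) p = partial_c c g p - partial_c c h p"
  using tame_partial_add[of m g "\<lambda>q. -1 * h q" p c] tame_partial_cmult[of m h p c "-1"] tame_uminus[of m h] by simp

lemma tame_partial_sum:
  assumes "\<And>i. i \<in> I \<Longrightarrow> tame m (g i)" "fst p > 0"
  shows "partial_c c (\<lambda>q. \<Sum>i\<in>I. g i q) p = (\<Sum>i\<in>I. partial_c c (g i) p)"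
  using assms(1)
  by (induction I rule: infinite_finite_induct) (auto simp: tame_partial_add[of m] tame_sum assms(2))

locale navier_stokes =
  fixes \<rho> T :: "real \<times> (real^'n::finite) \<Rightarrow> real"
    and u :: "real \<times> (real^'n) \<Rightarrow> real^'n"
    and \<mu> \<kappa> \<rho>m Tm :: real
  assumes mu_pos: "\<mu> > 0" and kappa_pos: "\<kappa> > 0"
    and smooth: "smooth_pos \<rho>" "smooth_pos T" "\<And>i. smooth_pos (\<lambda>p. u p $ i)"
    and periodic: "periodic_x \<rho>" "periodic_x T" "\<And>i. periodic_x (\<lambda>p. u p $ i)"
    and mass_eq: "\<And>p. fst p > 0 \<Longrightarrow>
        dt \<rho> p + (\<Sum>i\<in>UNIV. dx i (\<lambda>q. \<rho> q * u q $ i) p) = 0"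
    and momentum_eq: "\<And>p i. fst p > 0 \<Longrightarrow>
        dt (\<lambda>q. \<rho> q * u q $ i) p
        + (\<Sum>j\<in>UNIV. dx j (\<lambda>q. \<rho> q * u q $ i * u q $ j) p)
        + dx i (\<lambda>q. \<rho> q * T q) p
        = 2 * \<mu> * (\<Sum>j\<in>UNIV. dx j (strain u i j) p)"
    and energy_eq: "\<And>p. fst p > 0 \<Longrightarrow>
        dt (\<lambda>q. \<rho> q * (norm (u q))\<^sup>2 / 2 + real CARD('n) / 2 * \<rho> q * T q) p
        + (\<Sum>j\<in>UNIV. dx j (\<lambda>q. \<rho> q * (norm (u q))\<^sup>2 / 2 * u q $ j
              + (real CARD('n) + 2) / 2 * \<rho> q * u q $ j * T q) p)
        = 2 * \<mu> * (\<Sum>j\<in>UNIV. dx j (\<lambda>q. \<Sum>i\<in>UNIV. u q $ i * strain u i j q) p)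
          + real CARD('n) / 2 * \<kappa> * (\<Sum>j\<in>UNIV. dx j (dx j T) p)"
    and norm_mass: "\<And>t. t > 0 \<Longrightarrow> torus_int (\<lambda>x. \<rho> (t, x)) = 1"
    and norm_mom: "\<And>t i. t > 0 \<Longrightarrow> torus_int (\<lambda>x. \<rho> (t, x) * u (t, x) $ i) = 0"
    and norm_energy: "\<And>t. t > 0 \<Longrightarrow>
        torus_int (\<lambda>x. \<rho> (t, x) * (norm (u (t, x)))\<^sup>2 / 2)
        + real CARD('n) / 2 * torus_int (\<lambda>x. \<rho> (t, x) * T (t, x)) = real CARD('n) / 2"
    and bounded: "\<And>k. \<exists>B. \<forall>t>0. Ck_bound k \<rho> t B \<and> Ck_bound k T t B \<and>
        (\<forall>i. Ck_bound k (\<lambda>p. u p $ i) t B)"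
    and rho_lower: "\<rho>m > 0" "\<And>p. fst p > 0 \<Longrightarrow> \<rho> p \<ge> \<rho>m"
    and T_lower: "Tm > 0" "\<And>p. fst p > 0 \<Longrightarrow> T p \<ge> Tm"
begin

lemma rho_pos: "fst p > 0 \<Longrightarrow> \<rho> p > 0" and T_pos: "fst p > 0 \<Longrightarrow> T p > 0"
  using rho_lower T_lower by (meson less_le_trans)+

lemma tame_0: "tame 0 \<rho>" "tame 0 T" "tame 0 (\<lambda>p. u p $ i)"
  by (simp_all add: tame_def smooth_pos_regular smooth)

lemma tame_strain: "(\<And>i. tame m (\<lambda>p. u p $ i)) \<Longrightarrow> tame m (strain u i j)"
  unfolding strain_def[abs_def] by (intro tame_intros)

lemma tame_rho_inverse: "tame m \<rho> \<Longrightarrow> tame m (\<lambda>p. inverse (\<rho> p))"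
  and tame_T_inverse: "tame m T \<Longrightarrow> tame m (\<lambda>p. inverse (T p))"
  and tame_rho_ln: "tame m \<rho> \<Longrightarrow> tame m (\<lambda>p. ln (\<rho> p))"
  and tame_T_ln: "tame m T \<Longrightarrow> tame m (\<lambda>p. ln (T p))"
  by (rule tame_inverse[OF rho_lower] tame_inverse[OF T_lower] tame_ln[OF rho_lower] tame_ln[OF T_lower];
      assumption)+

section \<open>Material derivative and temperature equation\<close>

definition material :: "'n field \<Rightarrow> 'n field" where
  "material f p = dt f p + (\<Sum>j\<in>UNIV. u p $ j * dx j f p)"

definition divu :: "'n field" where
  "divu p = (\<Sum>j\<in>UNIV. dx j (\<lambda>q. u q $ j) p)"

lemma material_rho: "fst p > 0 \<Longrightarrow> material \<rho> p = - \<rho> p * divu p"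
  using mass_eq[of p]
  by (simp add: tame_partial_mult[of 0] tame_0 material_def divu_def sum.distrib sum_distrib_left sum_negf mult.commute)

text \<open>The terms in which \<open>\<rho>\<close> or u is differentiated add up to f times the
  mass equation. This turns conservation form into a derivative along the flow for the velocity, the
  kinetic and thermal energies and the entropy.\<close>

lemma transport:
  assumes "tame 0 f" "fst p > 0"
  shows "dt (\<lambda>q. \<rho> q * f q) p + (\<Sum>j\<in>UNIV. dx j (\<lambda>q. \<rho> q * f q * u q $ j) p) = \<rho> p * material f p"
proof -
  have "dx j (\<lambda>q. \<rho> q * f q * u q $ j) p =
      f p * (u p $ j * dx j \<rho> p) + \<rho> p * (u p $ j * dx j f p) + (\<rho> p * f p) * dx j (\<lambda>q. u q $ j) p" for j
    using assms by (simp add: tame_partial_mult[of 0] tame_0 tame_mult algebra_simps)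
  then have "(\<Sum>j\<in>UNIV. dx j (\<lambda>q. \<rho> q * f q * u q $ j) p) =
      f p * (\<Sum>j\<in>UNIV. u p $ j * dx j \<rho> p) + \<rho> p * (\<Sum>j\<in>UNIV. u p $ j * dx j f p) + (\<rho> p * f p) * divu p"
    by (simp only: sum.distrib sum_distrib_left divu_def)
  moreover have "dt (\<lambda>q. \<rho> q * f q) p = dt \<rho> p * f p + \<rho> p * dt f p"
    using assms by (simp add: tame_partial_mult[of 0] tame_0)
  moreover have "dt \<rho> p = - \<rho> p * divu p - (\<Sum>j\<in>UNIV. u p $ j * dx j \<rho> p)"
    using material_rho[OF assms(2)] by (simp add: material_def)
  ultimately show ?thesis by (simp add: material_def algebra_simps)
qed

lemma momentum:
  assumes "fst p > 0"
  shows "\<rho> p * material (\<lambda>q. u q $ i) p =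
    2 * \<mu> * (\<Sum>j\<in>UNIV. dx j (strain u i j) p) - dx i (\<lambda>q. \<rho> q * T q) p"
  using momentum_eq[OF assms, of i] transport[OF tame_0(3) assms, of i] by simp

lemma material_add: "tame 0 f \<Longrightarrow> tame 0 g \<Longrightarrow> fst p > 0 \<Longrightarrow> material (\<lambda>q. f q + g q) p = material f p + material g p"
  by (simp add: material_def tame_partial_add[of 0] distrib_left sum.distrib)

lemma material_mult: "tame 0 f \<Longrightarrow> tame 0 g \<Longrightarrow> fst p > 0 \<Longrightarrow>
    material (\<lambda>q. f q * g q) p = material f p * g p + f p * material g p"
  by (simp add: material_def tame_partial_mult[of 0] distrib_left distrib_right sum.distrib
      sum_distrib_left sum_distrib_right mult_ac)

lemma material_const [simp]: "material (\<lambda>q. a) p = 0"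
  by (simp add: material_def)

lemma material_sum:
  assumes "\<And>i. i \<in> I \<Longrightarrow> tame 0 (f i)" "fst p > 0"
  shows "material (\<lambda>q. \<Sum>i\<in>I. f i q) p = (\<Sum>i\<in>I. material (f i) p)"
  using assms(1)
  by (induction I rule: infinite_finite_induct) (auto simp: material_add tame_sum assms(2))

lemma norm_u: "(norm (u q))\<^sup>2 = (\<Sum>i\<in>UNIV. (u q $ i)\<^sup>2)"
  by (simp add: norm_vec_def L2_set_def sum_nonneg)

text \<open>Subtract from the energy equation the momentum equation multiplied by u, which is the
  balance of kinetic energy. What remains of the viscous stress is grad u contracted with the
  strain.\<close>

lemma temperature:
  assumes p: "fst p > 0"
  shows "real CARD('n) / 2 * (\<rho> p * material T p) + \<rho> p * T p * divu p =
    2 * \<mu> * (\<Sum>i\<in>UNIV. \<Sum>j\<in>UNIV. dx j (\<lambda>q. u q $ i) p * strain u i j p)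
      + real CARD('n) / 2 * \<kappa> * (\<Sum>j\<in>UNIV. dx j (dx j T) p)"
proof -
  define k where "k q = (\<Sum>i\<in>UNIV. 1/2 * (u q $ i * u q $ i))" for q
  have k: "(norm (u q))\<^sup>2 = 2 * k q" for q
    unfolding norm_u k_def by (simp add: sum_distrib_left power2_eq_square)
  have tk: "tame 0 k" unfolding k_def[abs_def] by (intro tame_intros tame_0)
  define P where "P i = dx i (\<lambda>q. \<rho> q * T q) p" for i
  define S where "S i = (\<Sum>j\<in>UNIV. dx j (strain u i j) p)" for i
  have "material (\<lambda>q. 1/2 * (u q $ i * u q $ i)) p = u p $ i * material (\<lambda>q. u q $ i) p" for i
    by (subst material_mult[OF tame_const tame_mult[OF tame_0(3) tame_0(3)] p],
        subst material_mult[OF tame_0(3) tame_0(3) p]) simp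
  then have "material k p = (\<Sum>i\<in>UNIV. u p $ i * material (\<lambda>q. u q $ i) p)"
    unfolding k_def[abs_def] by (subst material_sum[OF _ p]) (simp_all add: tame_divide_const tame_mult tame_0)
  then have "\<rho> p * material k p = (\<Sum>i\<in>UNIV. u p $ i * (\<rho> p * material (\<lambda>q. u q $ i) p))"
    by (simp add: sum_distrib_left mult_ac)
  then have Dk: "\<rho> p * material k p = 2 * \<mu> * (\<Sum>i\<in>UNIV. u p $ i * S i) - (\<Sum>i\<in>UNIV. u p $ i * P i)"
    unfolding momentum[OF p] P_def S_def
    by (simp add: right_diff_distrib sum_subtractf sum_distrib_left mult_ac)
  \<comment> \<open>The coefficient (N + 2)/2 splits as N/2 + 1. The part N/2 transports thermal
    energy; the remaining 1 yields u times the pressure gradient, cancelled by the momentum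
    equation, and the term with div u.\<close>
  have flux: "dx j (\<lambda>q. \<rho> q * (norm (u q))\<^sup>2 / 2 * u q $ j + (real CARD('n) + 2) / 2 * \<rho> q * u q $ j * T q) p =
      dx j (\<lambda>q. \<rho> q * k q * u q $ j) p + real CARD('n) / 2 * dx j (\<lambda>q. \<rho> q * T q * u q $ j) p
        + (P j * u p $ j + \<rho> p * T p * dx j (\<lambda>q. u q $ j) p)" for j
  proof -
    have "dx j (\<lambda>q. \<rho> q * (norm (u q))\<^sup>2 / 2 * u q $ j + (real CARD('n) + 2) / 2 * \<rho> q * u q $ j * T q) p =
      dx j (\<lambda>q. \<rho> q * k q * u q $ j + (real CARD('n) / 2 * (\<rho> q * T q * u q $ j) + (\<rho> q * T q) * u q $ j)) p"
      by (rule arg_cong2[of _ _ p p "dx j"]) (simp_all add: k fun_eq_iff field_simps)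
    also have "\<dots> = dx j (\<lambda>q. \<rho> q * k q * u q $ j) p + (real CARD('n) / 2 * dx j (\<lambda>q. \<rho> q * T q * u q $ j) p
        + dx j (\<lambda>q. (\<rho> q * T q) * u q $ j) p)"
      using p tk by (simp add: tame_partial_add[of 0] tame_partial_cmult[of 0] tame_partial_divide[of 0] tame_0 tame_intros)
    finally have "dx j (\<lambda>q. \<rho> q * (norm (u q))\<^sup>2 / 2 * u q $ j + (real CARD('n) + 2) / 2 * \<rho> q * u q $ j * T q) p =
      dx j (\<lambda>q. \<rho> q * k q * u q $ j) p + (real CARD('n) / 2 * dx j (\<lambda>q. \<rho> q * T q * u q $ j) p
        + dx j (\<lambda>q. (\<rho> q * T q) * u q $ j) p)" .
    moreover have "dx j (\<lambda>q. (\<rho> q * T q) * u q $ j) p = P j * u p $ j + \<rho> p * T p * dx j (\<lambda>q. u q $ j) p"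
      unfolding P_def by (intro tame_partial_mult[of 0] tame_intros tame_0 p)
    ultimately show ?thesis by linarith
  qed
  have time: "dt (\<lambda>q. \<rho> q * (norm (u q))\<^sup>2 / 2 + real CARD('n) / 2 * \<rho> q * T q) p =
      dt (\<lambda>q. \<rho> q * k q) p + real CARD('n) / 2 * dt (\<lambda>q. \<rho> q * T q) p"
  proof -
    have "dt (\<lambda>q. \<rho> q * (norm (u q))\<^sup>2 / 2 + real CARD('n) / 2 * \<rho> q * T q) p = dt (\<lambda>q. \<rho> q * k q + real CARD('n) / 2 * (\<rho> q * T q)) p"
      by (rule arg_cong2[of _ _ p p "dt"]) (simp_all add: k fun_eq_iff)
    then show ?thesis
      using p tk by (simp add: tame_partial_add[of 0] tame_partial_cmult[of 0] tame_partial_divide[of 0] tame_0 tame_intros)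
  qed
  \<comment> \<open>The second sum is the work of the viscous force on u; it cancels against the
    kinetic energy balance.\<close>
  have visc: "(\<Sum>j\<in>UNIV. dx j (\<lambda>q. \<Sum>i\<in>UNIV. u q $ i * strain u i j q) p) =
      (\<Sum>i\<in>UNIV. \<Sum>j\<in>UNIV. dx j (\<lambda>q. u q $ i) p * strain u i j p) + (\<Sum>i\<in>UNIV. u p $ i * S i)"
  proof -
    have "dx j (\<lambda>q. \<Sum>i\<in>UNIV. u q $ i * strain u i j q) p =
       (\<Sum>i\<in>UNIV. dx j (\<lambda>q. u q $ i) p * strain u i j p + u p $ i * dx j (strain u i j) p)" for j
      using p by (simp add: tame_partial_sum[of _ 0] tame_partial_mult[of 0] tame_0 tame_strain tame_mult)
    then have "(\<Sum>j\<in>UNIV. dx j (\<lambda>q. \<Sum>i\<in>UNIV. u q $ i * strain u i j q) p) =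
       (\<Sum>i\<in>UNIV. \<Sum>j\<in>UNIV. dx j (\<lambda>q. u q $ i) p * strain u i j p + u p $ i * dx j (strain u i j) p)"
      by (subst sum.swap) simp
    then show ?thesis by (simp add: S_def sum.distrib sum_distrib_left)
  qed
  have "dt (\<lambda>q. \<rho> q * k q) p + (\<Sum>j\<in>UNIV. dx j (\<lambda>q. \<rho> q * k q * u q $ j) p)
      + real CARD('n) / 2 * (dt (\<lambda>q. \<rho> q * T q) p + (\<Sum>j\<in>UNIV. dx j (\<lambda>q. \<rho> q * T q * u q $ j) p))
      + ((\<Sum>i\<in>UNIV. u p $ i * P i) + \<rho> p * T p * divu p)
    = 2 * \<mu> * ((\<Sum>i\<in>UNIV. \<Sum>j\<in>UNIV. dx j (\<lambda>q. u q $ i) p * strain u i j p) + (\<Sum>i\<in>UNIV. u p $ i * S i))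
          + real CARD('n) / 2 * \<kappa> * (\<Sum>j\<in>UNIV. dx j (dx j T) p)"
    using energy_eq[OF p] unfolding flux time visc
    by (simp add: sum.distrib sum_distrib_left divu_def algebra_simps)
  then show ?thesis
    unfolding transport[OF tk p] transport[OF tame_0(2) p] Dk by (simp add: algebra_simps)
qed

lemma strain_sym: "strain u i j p = strain u j i p"
  by (simp add: strain_def add.commute)

lemma strain_trace: "(\<Sum>i\<in>UNIV. strain u i i p) = 0"
  by (simp add: strain_def sum_subtractf)

lemma sym_gradient:
  "dx j (\<lambda>q. u q $ i) p + dx i (\<lambda>q. u q $ j) p
    = 2 * strain u i j p + 2 * divu p / real CARD('n) * (if i = j then 1 else 0)"
  by (simp add: strain_def divu_def)

text \<open>Symmetry of the strain leaves only the symmetric part of grad u, and its vanishing trace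
  removes the multiple of the identity.\<close>

lemma strain_dissipation:
  "(\<Sum>i\<in>UNIV. \<Sum>j\<in>UNIV. dx j (\<lambda>q. u q $ i) p * strain u i j p) = (\<Sum>i\<in>UNIV. \<Sum>j\<in>UNIV. (strain u i j p)\<^sup>2)"
proof -
  define a where "a i j = dx j (\<lambda>q. u q $ i) p" for i j
  have "(\<Sum>i\<in>UNIV. \<Sum>j\<in>UNIV. a i j * strain u i j p) = (\<Sum>i\<in>UNIV. \<Sum>j\<in>UNIV. a j i * strain u i j p)"
    by (subst sum.swap) (simp add: strain_sym)
  then have "2 * (\<Sum>i\<in>UNIV. \<Sum>j\<in>UNIV. a i j * strain u i j p) = (\<Sum>i\<in>UNIV. \<Sum>j\<in>UNIV. (a i j + a j i) * strain u i j p)"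
    by (simp add: distrib_right sum.distrib)
  also have "\<dots> = (\<Sum>i\<in>UNIV. \<Sum>j\<in>UNIV. 2 * (strain u i j p)\<^sup>2
      + (if i = j then 2 * divu p / real CARD('n) * strain u i i p else 0))"
    unfolding a_def sym_gradient
    by (intro sum.cong refl) (auto simp: algebra_simps power2_eq_square)
  also have "\<dots> = 2 * (\<Sum>i\<in>UNIV. \<Sum>j\<in>UNIV. (strain u i j p)\<^sup>2)
      + 2 * divu p / real CARD('n) * (\<Sum>i\<in>UNIV. strain u i i p)"
    by (simp add: sum.distrib sum_distrib_left)
  finally show ?thesis by (simp add: strain_trace a_def)
qed

section \<open>Entropy balance\<close>

text \<open>Minus the specific entropy of an ideal gas; with this sign its integral against
  \<open>\<rho>\<close> decreases.\<close>

definition entropy :: "'n field" where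
  "entropy p = ln (\<rho> p) - real CARD('n) / 2 * ln (T p)"

definition dissipation :: "'n field" where
  "dissipation p = inverse (T p) * (2 * \<mu> * (\<Sum>i\<in>UNIV. \<Sum>j\<in>UNIV. (strain u i j p)\<^sup>2))
     + real CARD('n) / 2 * \<kappa> * (\<Sum>j\<in>UNIV. (dx j T p * inverse (T p))\<^sup>2)"

definition entropy_flux :: "'n \<Rightarrow> 'n field" where
  "entropy_flux j p = \<rho> p * entropy p * u p $ j + real CARD('n) / 2 * \<kappa> * (dx j T p * inverse (T p))"

lemma tame_entropy: "tame m \<rho> \<Longrightarrow> tame m T \<Longrightarrow> tame m entropy"
  unfolding entropy_def[abs_def] by (intro tame_intros tame_rho_ln tame_T_ln)

lemma tame_entropy_flux: "tame 0 (entropy_flux j)"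
  unfolding entropy_flux_def[abs_def]
  by (intro tame_intros tame_entropy tame_T_inverse tame_0)

lemma material_ln_rho: "fst p > 0 \<Longrightarrow> material (\<lambda>q. ln (\<rho> q)) p = material \<rho> p * inverse (\<rho> p)"
  and material_ln_T: "fst p > 0 \<Longrightarrow> material (\<lambda>q. ln (T q)) p = material T p * inverse (T p)"
  using tame_partially_differentiable[OF tame_0(1)] tame_partially_differentiable[OF tame_0(2)] rho_pos T_pos
  by (simp_all add: material_def partial_c_ln algebra_simps sum_distrib_left)

text \<open>Divide the temperature equation by T. The pressure work cancels against the derivative
  of ln \<rho> along the flow, which is -div u. The Laplacian of T over T is the divergence of grad
  T / T plus |grad T|^2 / T^2, the heat part of the dissipation.\<close>

lemma entropy_balance:
  assumes p: "fst p > 0"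
  shows "dt (\<lambda>q. \<rho> q * entropy q) p = - dissipation p - (\<Sum>j\<in>UNIV. dx j (entropy_flux j) p)"
proof -
  note pos = rho_pos[OF p] T_pos[OF p]
  define Q where "Q = 2 * \<mu> * (\<Sum>i\<in>UNIV. \<Sum>j\<in>UNIV. (strain u i j p)\<^sup>2)"
  have "material entropy p = material (\<lambda>q. ln (\<rho> q) + (- real CARD('n) / 2) * ln (T q)) p"
    by (simp add: entropy_def[abs_def])
  also have "\<dots> = material \<rho> p * inverse (\<rho> p) - real CARD('n) / 2 * (material T p * inverse (T p))"
    by (subst material_add[OF tame_rho_ln[OF tame_0(1)] tame_mult[OF tame_const tame_T_ln[OF tame_0(2)]] p],
        subst material_mult[OF tame_const tame_T_ln[OF tame_0(2)] p])
      (simp add: material_ln_rho[OF p] material_ln_T[OF p])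
  also have "material \<rho> p * inverse (\<rho> p) = - divu p" using pos by (simp add: material_rho[OF p])
  finally have e: "material entropy p = - divu p - real CARD('n) / 2 * (material T p * inverse (T p))" .
  have "\<rho> p * material entropy p =
      - inverse (T p) * (real CARD('n) / 2 * (\<rho> p * material T p) + \<rho> p * T p * divu p)"
    unfolding e using pos by (simp add: field_simps)
  then have 1: "\<rho> p * material entropy p =
      - inverse (T p) * (Q + real CARD('n) / 2 * \<kappa> * (\<Sum>j\<in>UNIV. dx j (dx j T) p))"
    unfolding temperature[OF p] strain_dissipation Q_def .
  have "dx j (\<lambda>q. dx j T q * inverse (T q)) p =
      inverse (T p) * dx j (dx j T) p - (dx j T p * inverse (T p))\<^sup>2" for j
  proof -
    have "dx j (\<lambda>q. inverse (T q)) p = - dx j T p * (inverse (T p) * inverse (T p))"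
      by (rule partial_c_inverse[OF tame_partially_differentiable[OF tame_0(2)] T_pos p])
    then show ?thesis
      by (subst tame_partial_mult[OF tame_dx[OF tame_0(2)] tame_T_inverse[OF tame_0(2)] p])
        (simp add: power2_eq_square algebra_simps)
  qed
  moreover have "dx j (entropy_flux j) p = dx j (\<lambda>q. \<rho> q * entropy q * u q $ j) p
      + real CARD('n) / 2 * \<kappa> * dx j (\<lambda>q. dx j T q * inverse (T q)) p" for j
    unfolding entropy_flux_def[abs_def]
    by (subst tame_partial_add[of 0], intro tame_intros tame_0 tame_entropy,
        intro tame_intros tame_0 tame_T_inverse, rule p, subst tame_partial_cmult[of 0])
      (simp_all add: tame_mult tame_dx tame_T_inverse tame_0 p)
  ultimately have "(\<Sum>j\<in>UNIV. dx j (entropy_flux j) p) = (\<Sum>j\<in>UNIV. dx j (\<lambda>q. \<rho> q * entropy q * u q $ j) p)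
      + real CARD('n) / 2 * \<kappa> * (inverse (T p) * (\<Sum>j\<in>UNIV. dx j (dx j T) p) - (\<Sum>j\<in>UNIV. (dx j T p * inverse (T p))\<^sup>2))"
    by (simp only: sum.distrib sum_distrib_left[symmetric] sum_subtractf)
  moreover have "dt (\<lambda>q. \<rho> q * entropy q) p =
      \<rho> p * material entropy p - (\<Sum>j\<in>UNIV. dx j (\<lambda>q. \<rho> q * entropy q * u q $ j) p)"
    using transport[OF tame_entropy[OF tame_0(1,2)] p] by simp
  ultimately show ?thesis
    unfolding 1 dissipation_def Q_def[symmetric] by (simp add: algebra_simps)
qed

section \<open>Bounds on all space-time derivatives\<close>

lemma tame_1: "tame 1 \<rho>" "tame 1 T" "tame 1 (\<lambda>p. u p $ i)"
proof -
  have *: "bounded_pos (iter_partial (map Some cs) \<rho>) \<and> bounded_pos (iter_partial (map Some cs) T) \<and>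
      bounded_pos (iter_partial (map Some cs) (\<lambda>p. u p $ i))" for cs
  proof -
    obtain B where B: "\<And>t. t > 0 \<Longrightarrow> Ck_bound (length cs) \<rho> t B \<and> Ck_bound (length cs) T t B \<and>
        (\<forall>i. Ck_bound (length cs) (\<lambda>p. u p $ i) t B)"
      using bounded by blast
    have "\<bar>iter_partial (map Some cs) \<rho> p\<bar> \<le> B \<and> \<bar>iter_partial (map Some cs) T p\<bar> \<le> B \<and>
        \<bar>iter_partial (map Some cs) (\<lambda>p. u p $ i) p\<bar> \<le> B" if "fst p > 0" for p
      using B[OF that] unfolding Ck_bound_def by (metis order_refl prod.collapse)
    then show ?thesis unfolding bounded_pos_def by blast
  qed
  show "tame 1 \<rho>" "tame 1 T" "tame 1 (\<lambda>p. u p $ i)"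
    unfolding tame_def using * tame_0 regular_1I unfolding tame_def by blast+
qed

text \<open>The equations express the time derivatives of \<open>\<rho>\<close>, u and T through
  space derivatives, divided by \<open>\<rho>\<close> where necessary, so bounds on derivatives with
  at most m time derivatives pass to m + 1. The induction starts at \<open>tame 1\<close>, which the
  hypotheses provide.\<close>

lemma smooth_bounded_solution:
  "smooth_bounded \<rho>" "smooth_bounded T" "smooth_bounded (\<lambda>p. u p $ i)"
proof -
  have "tame (Suc m) \<rho> \<and> tame (Suc m) T \<and> (\<forall>i. tame (Suc m) (\<lambda>p. u p $ i))" for m
  proof (induction m)
    case 0
    then show ?case using tame_1 by simp
  next
    case (Suc m)
    note t = Suc[THEN conjunct1] Suc[THEN conjunct2, THEN conjunct1] Suc[THEN conjunct2, THEN conjunct2, rule_format]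
    have div: "tame (Suc m) divu"
      unfolding divu_def[abs_def] by (intro tame_intros t)
    have "tame (Suc m) (dt \<rho>)"
    proof (rule tame_cong)
      show "tame (Suc m) (\<lambda>p. - \<rho> p * divu p - (\<Sum>j\<in>UNIV. u p $ j * dx j \<rho> p))"
        by (intro tame_intros t div)
      show "- \<rho> p * divu p - (\<Sum>j\<in>UNIV. u p $ j * dx j \<rho> p) = dt \<rho> p" if "fst p > 0" for p
        using material_rho[OF that] by (simp add: material_def)
    qed
    moreover have "tame (Suc m) (dt (\<lambda>q. u q $ i))" for i
    proof (rule tame_cong)
      show "tame (Suc m) (\<lambda>p. inverse (\<rho> p) * (2 * \<mu> * (\<Sum>j\<in>UNIV. dx j (strain u i j) p)
          - dx i (\<lambda>q. \<rho> q * T q) p) - (\<Sum>j\<in>UNIV. u p $ j * dx j (\<lambda>q. u q $ i) p))"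
        by (intro tame_intros t tame_rho_inverse tame_strain)
      show "inverse (\<rho> p) * (2 * \<mu> * (\<Sum>j\<in>UNIV. dx j (strain u i j) p) - dx i (\<lambda>q. \<rho> q * T q) p)
          - (\<Sum>j\<in>UNIV. u p $ j * dx j (\<lambda>q. u q $ i) p) = dt (\<lambda>q. u q $ i) p" if "fst p > 0" for p
        unfolding momentum[OF that, symmetric] using rho_pos[OF that] by (simp add: material_def mult.assoc[symmetric])
    qed
    moreover have "tame (Suc m) (dt T)"
    proof (rule tame_cong)
      let ?Q = "\<lambda>p. 2 * \<mu> * (\<Sum>i\<in>UNIV. \<Sum>j\<in>UNIV. dx j (\<lambda>q. u q $ i) p * strain u i j p)
          + real CARD('n) / 2 * \<kappa> * (\<Sum>j\<in>UNIV. dx j (dx j T) p)"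
      show "tame (Suc m) (\<lambda>p. 2 / real CARD('n) * (inverse (\<rho> p) * ?Q p - T p * divu p)
          - (\<Sum>j\<in>UNIV. u p $ j * dx j T p))"
        by (intro tame_intros t tame_rho_inverse tame_strain div)
      show "2 / real CARD('n) * (inverse (\<rho> p) * ?Q p - T p * divu p) - (\<Sum>j\<in>UNIV. u p $ j * dx j T p) = dt T p"
        if "fst p > 0" for p
        unfolding temperature[OF that, symmetric] using rho_pos[OF that] by (simp add: material_def field_simps)
    qed
    ultimately show ?case
      using t tame_SucI[of "Suc m"] by blast
  qed
  then show "smooth_bounded \<rho>" "smooth_bounded T" "smooth_bounded (\<lambda>p. u p $ i)"
    using tame_mono by (meson Suc_n_not_le_n nat_le_linear)+
qed

end

section \<open>Products, means and oscillation of small fields\<close>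

lemma small_on_product:
  assumes R: "windows R" and "small_on R \<alpha> f" "small_on R \<beta> g"
  shows "small_on R (\<alpha> + \<beta>) (\<lambda>p. f p * g p)"
proof -
  obtain A B where A: "\<And>t \<eta> s x. (t, \<eta>) \<in> R \<Longrightarrow> t \<le> s \<Longrightarrow> s \<le> t + 1 \<Longrightarrow> \<bar>f (s, x)\<bar> \<le> A * \<eta> powr \<alpha>"
    and B: "\<And>t \<eta> s x. (t, \<eta>) \<in> R \<Longrightarrow> t \<le> s \<Longrightarrow> s \<le> t + 1 \<Longrightarrow> \<bar>g (s, x)\<bar> \<le> B * \<eta> powr \<beta>"
    using assms(2,3) unfolding small_on_def by blast
  have "\<bar>f (s, x) * g (s, x)\<bar> \<le> (A * B) * \<eta> powr (\<alpha> + \<beta>)" if "(t, \<eta>) \<in> R" "t \<le> s" "s \<le> t + 1" for t \<eta> s x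
  proof -
    have "\<bar>f (s, x)\<bar> * \<bar>g (s, x)\<bar> \<le> (A * \<eta> powr \<alpha>) * (B * \<eta> powr \<beta>)"
      using A[OF that, of x] B[OF that, of x] by (intro mult_mono) auto
    then show ?thesis by (simp add: abs_mult powr_add mult_ac)
  qed
  then show ?thesis unfolding small_on_def by blast
qed

lemma small_on_sum:
  "(\<And>i. i \<in> I \<Longrightarrow> small_on R \<alpha> (g i)) \<Longrightarrow> small_on R \<alpha> (\<lambda>p. \<Sum>i\<in>I. g i p)"
proof (induction I rule: infinite_finite_induct)
  case (insert i I)
  then show ?case by (auto intro: small_on_add)
qed (auto simp: small_on_def intro!: exI[of _ 0])

lemma torus_int_abs_le:
  assumes "tame m g" "t > 0" "\<And>x. \<bar>g (t, x)\<bar> \<le> a"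
  shows "\<bar>torus_int (\<lambda>x. g (t, x))\<bar> \<le> a"
proof -
  have "norm (integral (cbox 0 One) (\<lambda>x. g (t, x))) \<le> integral (cbox 0 (One :: real^'a)) (\<lambda>x. a)"
    by (rule integral_norm_bound_integral) (use assms in \<open>auto intro: tame_slice_integrable\<close>)
  then show ?thesis by (simp add: torus_int_def)
qed

lemma small_on_torus_int:
  assumes R: "windows R" and "tame m g" "small_on R \<alpha> g"
  obtains C where "\<And>t \<eta> s. (t, \<eta>) \<in> R \<Longrightarrow> t \<le> s \<Longrightarrow> s \<le> t + 1 \<Longrightarrow> \<bar>torus_int (\<lambda>x. g (s, x))\<bar> \<le> C * \<eta> powr \<alpha>"
proof -
  obtain A where A: "\<And>t \<eta> s x. (t, \<eta>) \<in> R \<Longrightarrow> t \<le> s \<Longrightarrow> s \<le> t + 1 \<Longrightarrow> \<bar>g (s, x)\<bar> \<le> A * \<eta> powr \<alpha>"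
    using assms(3) unfolding small_on_def by blast
  show thesis
  proof (rule that)
    fix t \<eta> s assume *: "(t, \<eta>) \<in> R" "t \<le> s" "s \<le> t + 1"
    show "\<bar>torus_int (\<lambda>x. g (s, x))\<bar> \<le> A * \<eta> powr \<alpha>"
      by (rule torus_int_abs_le[OF assms(2) _ A[OF *]]) (use windowsD[OF R *(1)] * in auto)
  qed
qed

lemma small_on_oscillation:
  fixes g :: "'n::finite field"
  assumes R: "windows R" and "tame m g" "periodic_x g" "\<And>i. small_on R \<alpha> (dx i g)"
  obtains C where "\<And>t \<eta> s x y. (t, \<eta>) \<in> R \<Longrightarrow> t \<le> s \<Longrightarrow> s \<le> t + 1 \<Longrightarrow> \<bar>g (s, x) - g (s, y)\<bar> \<le> C * \<eta> powr \<alpha>"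
proof -
  have "\<exists>C. \<forall>t \<eta> s x. (t, \<eta>) \<in> R \<longrightarrow> t \<le> s \<longrightarrow> s \<le> t + 1 \<longrightarrow> \<bar>dx i g (s, x)\<bar> \<le> C * \<eta> powr \<alpha>" for i
    using assms(4) unfolding small_on_def by blast
  then obtain L where "\<And>i. \<forall>t \<eta> s x. (t, \<eta>) \<in> R \<longrightarrow> t \<le> s \<longrightarrow> s \<le> t + 1 \<longrightarrow> \<bar>dx i g (s, x)\<bar> \<le> L * \<eta> powr \<alpha>"
    by (rule finite_uniform_const[where P = "\<lambda>i C. \<forall>t \<eta> s x. (t, \<eta>) \<in> R \<longrightarrow> t \<le> s \<longrightarrow> s \<le> t + 1 \<longrightarrow>
      \<bar>dx i g (s, x)\<bar> \<le> C * \<eta> powr \<alpha>" and B = 0]) (meson mult_right_mono order_trans powr_ge_zero, blast)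
  then have L: "\<And>i t \<eta> s x. (t, \<eta>) \<in> R \<Longrightarrow> t \<le> s \<Longrightarrow> s \<le> t + 1 \<Longrightarrow> \<bar>dx i g (s, x)\<bar> \<le> L * \<eta> powr \<alpha>"
    by blast
  show thesis
  proof (rule that)
    fix t \<eta> s x y assume *: "(t, \<eta>) \<in> R" "t \<le> s" "s \<le> t + 1"
    have "\<bar>g (s, x) - g (s, y)\<bar> \<le> L * \<eta> powr \<alpha> * real CARD('n)"
      by (rule periodic_oscillation[OF assms(2,3) _ L[OF *]]) (use windowsD[OF R *(1)] * in auto)
    then show "\<bar>g (s, x) - g (s, y)\<bar> \<le> (L * real CARD('n)) * \<eta> powr \<alpha>" by (simp add: mult_ac)
  qed
qed

text \<open>The gradient bounds the oscillation on the torus, and the weighted mean fixes the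
  constant a. The mean may carry an error of the same order; T requires this, since its mean
  involves the kinetic energy.\<close>

lemma half_orderI_mean:
  fixes w f :: "'n::finite field"
  assumes R: "windows R" and "smooth_bounded w" "smooth_bounded f" "periodic_x f"
    and w: "\<And>p. fst p > 0 \<Longrightarrow> w p \<ge> 0" "\<And>t. t > 0 \<Longrightarrow> torus_int (\<lambda>x. w (t, x)) = 1"
    and dx: "\<And>i. half_order R (dx i f)"
    and mean: "\<And>\<alpha>. \<alpha> < 1/2 \<Longrightarrow> \<exists>C. \<forall>t \<eta> s. (t, \<eta>) \<in> R \<longrightarrow> t \<le> s \<longrightarrow> s \<le> t + 1 \<longrightarrow>
        \<bar>torus_int (\<lambda>x. w (s, x) * f (s, x)) - a\<bar> \<le> C * \<eta> powr \<alpha>"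
  shows "half_order R (\<lambda>p. f p - a)"
  unfolding half_order_def
proof (intro conjI allI impI)
  show "tame m (\<lambda>p. f p - a)" for m using assms(3) by (simp add: tame_diff)
  fix \<alpha> :: real assume \<alpha>: "\<alpha> < 1/2"
  have tw: "tame 0 w" and tf: "tame 0 f" using assms(2,3) by blast+
  have "small_on R \<alpha> (dx i f)" for i using dx \<alpha> by (simp add: half_order_def)
  then obtain C where C: "\<And>t \<eta> s x y. (t, \<eta>) \<in> R \<Longrightarrow> t \<le> s \<Longrightarrow> s \<le> t + 1 \<Longrightarrow> \<bar>f (s, x) - f (s, y)\<bar> \<le> C * \<eta> powr \<alpha>"
    using small_on_oscillation[OF R tf assms(4)] by blast
  obtain D where D: "\<And>t \<eta> s. (t, \<eta>) \<in> R \<Longrightarrow> t \<le> s \<Longrightarrow> s \<le> t + 1 \<Longrightarrow>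
      \<bar>torus_int (\<lambda>x. w (s, x) * f (s, x)) - a\<bar> \<le> D * \<eta> powr \<alpha>"
    using mean[OF \<alpha>] by blast
  have "\<bar>f (s, x) - a\<bar> \<le> (C + D) * \<eta> powr \<alpha>" if *: "(t, \<eta>) \<in> R" "t \<le> s" "s \<le> t + 1" for t \<eta> s x
  proof -
    have s: "s > 0" using windowsD[OF R *(1)] * by auto
    have "\<bar>f (s, x) - torus_int (\<lambda>y. w (s, y) * f (s, y))\<bar> \<le> C * \<eta> powr \<alpha>"
      by (rule torus_weighted_mean[OF tw tf s _ w(2)[OF s] C[OF *]]) (use w(1) s in auto)
    then show ?thesis using D[OF *] by (simp add: distrib_right)
  qed
  then show "small_on R \<alpha> (\<lambda>p. f p - a)" unfolding small_on_def by blast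
qed (rule R)

context navier_stokes
begin

lemma smooth_bounded_strain: "smooth_bounded (strain u i j)"
  using smooth_bounded_solution tame_strain by blast

lemma smooth_bounded_inverse: "smooth_bounded (\<lambda>p. inverse (\<rho> p))" "smooth_bounded (\<lambda>p. inverse (T p))"
  using smooth_bounded_solution tame_rho_inverse tame_T_inverse by blast+

lemma smooth_bounded_divu: "smooth_bounded divu"
  unfolding divu_def[abs_def] by (intro allI tame_intros smooth_bounded_solution[rule_format])

lemma smooth_bounded_dissipation: "smooth_bounded dissipation"
  unfolding dissipation_def[abs_def]
  by (intro allI tame_intros smooth_bounded_solution[rule_format] smooth_bounded_inverse[rule_format]
      smooth_bounded_strain[rule_format])

lemma smooth_bounded_entropy: "smooth_bounded (\<lambda>p. \<rho> p * entropy p)"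
  using smooth_bounded_solution tame_entropy by (blast intro: tame_mult)

lemma periodic_dx_solution:
  "periodic_x (dx j T)" "periodic_x (dx j (\<lambda>p. u p $ i))"
  using periodic by (auto intro: periodic_x_partial)

lemma periodic_strain: "periodic_x (strain u i j)"
  using periodic_dx_solution(2) by (simp add: periodic_x_def strain_def)

lemma periodic_dissipation: "periodic_x dissipation"
  using periodic_dx_solution periodic_strain periodic by (simp add: periodic_x_def dissipation_def)

lemma periodic_entropy_flux: "periodic_x (entropy_flux j)"
  using periodic_dx_solution periodic by (simp add: periodic_x_def entropy_flux_def entropy_def)

lemma dissipation_nonneg: "fst p > 0 \<Longrightarrow> dissipation p \<ge> 0"
  using T_pos[of p] mu_pos kappa_pos by (simp add: dissipation_def sum_nonneg)

section \<open>Smallness of all gradients in terms of the entropy drop\<close>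

definition H :: "real \<Rightarrow> real" where
  "H t = torus_int (\<lambda>x. \<rho> (t, x) * entropy (t, x))"

text \<open>The entropy flux is periodic, so its divergence integrates to zero and only the
  dissipation is left.\<close>

lemma H_deriv:
  assumes t: "t > 0"
  shows "(H has_real_derivative - torus_int (\<lambda>x. dissipation (t, x))) (at t)"
proof -
  have tame: "tame 0 (\<lambda>p. \<rho> p * entropy p)" using smooth_bounded_entropy by blast
  have int: "(\<lambda>x. dissipation (t, x)) integrable_on cbox 0 One"
    "(\<lambda>x. dx j (entropy_flux j) (t, x)) integrable_on cbox 0 One" for j
    using tame_slice_integrable[of 0 dissipation t] smooth_bounded_dissipation
      tame_slice_integrable[OF tame_dx[OF tame_entropy_flux] t] t by blast+
  have "torus_int (\<lambda>x. dt (\<lambda>q. \<rho> q * entropy q) (t, x)) =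
      torus_int (\<lambda>x. - dissipation (t, x) - (\<Sum>j\<in>UNIV. dx j (entropy_flux j) (t, x)))"
    using t by (simp add: entropy_balance)
  also have "\<dots> = - torus_int (\<lambda>x. dissipation (t, x)) - (\<Sum>j\<in>UNIV. torus_int (\<lambda>x. dx j (entropy_flux j) (t, x)))"
    unfolding torus_int_def using int
    by (subst integral_diff) (auto simp: integral_sum intro: integrable_neg integrable_sum)
  also have "(\<Sum>j\<in>UNIV. torus_int (\<lambda>x. dx j (entropy_flux j) (t, x))) = 0"
    using torus_int_dx[OF tame_entropy_flux periodic_entropy_flux t] by simp
  finally show ?thesis
    using torus_int_dt[OF tame t] unfolding H_def[abs_def] by simp
qed

lemma H_antimono:
  assumes "0 < s" "s \<le> t" shows "H t \<le> H s"
proof (rule DERIV_nonpos_imp_nonincreasing[OF assms(2)])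
  fix r assume "s \<le> r" "r \<le> t"
  then have r: "r > 0" using assms(1) by simp
  have "tame 0 dissipation" using smooth_bounded_dissipation by blast
  then have "torus_int (\<lambda>x. dissipation (r, x)) \<ge> 0"
    using torus_int_ge_box[of 0 dissipation r 0 One 0] r dissipation_nonneg by simp
  then show "\<exists>d. DERIV H r :> d \<and> d \<le> 0" using H_deriv[OF r] by force
qed

text \<open>The drop is bounded by \<eta> rather than equal to it. So \<eta> stays positive when the
  drop vanishes, and it can be chosen freely: as a power of H(t) for the difference inequality, as a
  power of t for the decay rates.\<close>

definition W :: "(real \<times> real) set" where
  "W = {(t, \<eta>). t > 0 \<and> 0 < \<eta> \<and> \<eta> \<le> 1 \<and> H t - H (t + 1) \<le> \<eta>}"

lemma windows_W: "windows W"
  by (simp add: windows_def W_def)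

lemma small_dissipation: "0 \<le> \<alpha> \<Longrightarrow> \<alpha> < 1 \<Longrightarrow> small_on W \<alpha> dissipation"
  by (rule dissipation_controls_density[OF smooth_bounded_dissipation periodic_dissipation dissipation_nonneg
        H_deriv windows_W, where K = 1]) (auto simp: W_def)

lemma T_upper: obtains B where "B > 0" "\<And>p. fst p > 0 \<Longrightarrow> T p \<le> B"
proof -
  obtain B where B: "\<And>p. fst p > 0 \<Longrightarrow> \<bar>T p\<bar> \<le> B"
    using tame_bounded[OF tame_1(2)] unfolding bounded_pos_def by auto
  show thesis
  proof (rule that[of "max B 1"])
    show "T p \<le> max B 1" if "fst p > 0" for p using B[OF that] by linarith
  qed simp
qed

text \<open>The upper bound on T bounds the weight 1/T of the dissipation from below.\<close>

lemma half_order_strain: "half_order W (strain u i j)"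
proof -
  obtain B where B: "B > 0" "\<And>p. fst p > 0 \<Longrightarrow> T p \<le> B" by (rule T_upper) blast
  show ?thesis
  proof (rule half_order_sqrt[OF windows_W smooth_bounded_strain _ _ small_dissipation])
    show "B / (2 * \<mu>) > 0" using B mu_pos by simp
    fix p :: "real \<times> (real^'n)" assume p: "fst p > 0"
    note pos = T_pos[OF p]
    let ?S = "\<Sum>i\<in>UNIV. \<Sum>j\<in>UNIV. (strain u i j p)\<^sup>2"
    have "(strain u i j p)\<^sup>2 \<le> (\<Sum>j\<in>UNIV. (strain u i j p)\<^sup>2)"
      by (rule member_le_sum) auto
    also have "\<dots> \<le> ?S"
      by (rule member_le_sum[of i UNIV "\<lambda>i. \<Sum>j\<in>UNIV. (strain u i j p)\<^sup>2"]) (auto simp: sum_nonneg)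
    finally have 1: "(strain u i j p)\<^sup>2 \<le> ?S" .
    have S0: "?S \<ge> 0" by (simp add: sum_nonneg)
    have "inverse (T p) * (2 * \<mu> * ?S) \<le> dissipation p"
      using kappa_pos by (simp add: dissipation_def sum_nonneg)
    then have "2 * \<mu> * ?S \<le> T p * dissipation p" using pos by (simp add: field_simps)
    also have "\<dots> \<le> B * dissipation p" using B(2)[OF p] dissipation_nonneg[OF p] by (rule mult_right_mono)
    finally have "?S \<le> B / (2 * \<mu>) * dissipation p" using mu_pos by (simp add: field_simps)
    with 1 show "(strain u i j p)\<^sup>2 \<le> B / (2 * \<mu>) * dissipation p" by linarith
  qed
qed

lemma half_order_dx_T: "half_order W (dx i T)"
proof -
  obtain B where B: "B > 0" "\<And>p. fst p > 0 \<Longrightarrow> T p \<le> B" by (rule T_upper) blast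
  have sb: "smooth_bounded (dx i T)" using smooth_bounded_solution(2) by (rule smooth_bounded_partial)
  show ?thesis
  proof (rule half_order_sqrt[OF windows_W sb _ _ small_dissipation])
    let ?c = "real CARD('n) / 2 * \<kappa>"
    have c: "?c > 0" using kappa_pos by simp
    show "B\<^sup>2 / ?c > 0" using B c by simp
    fix p :: "real \<times> (real^'n)" assume p: "fst p > 0"
    note pos = T_pos[OF p]
    have "(dx i T p * inverse (T p))\<^sup>2 \<le> (\<Sum>j\<in>UNIV. (dx j T p * inverse (T p))\<^sup>2)"
      by (rule member_le_sum) auto
    then have "?c * (dx i T p * inverse (T p))\<^sup>2 \<le> ?c * (\<Sum>j\<in>UNIV. (dx j T p * inverse (T p))\<^sup>2)"
      using c by (intro mult_left_mono) auto
    also have "\<dots> \<le> dissipation p"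
      using pos mu_pos by (simp add: dissipation_def sum_nonneg)
    finally have "(dx i T p * inverse (T p))\<^sup>2 \<le> dissipation p / ?c"
      unfolding pos_le_divide_eq[OF c] by (simp only: mult.commute)
    then have "(T p)\<^sup>2 * (dx i T p * inverse (T p))\<^sup>2 \<le> (T p)\<^sup>2 * (dissipation p / ?c)"
      by (intro mult_left_mono) auto
    also have "\<dots> \<le> B\<^sup>2 * (dissipation p / ?c)"
      using B(2)[OF p] pos c dissipation_nonneg[OF p] by (intro mult_right_mono power_mono) auto
    also have "(T p)\<^sup>2 * (dx i T p * inverse (T p))\<^sup>2 = (dx i T p)\<^sup>2"
      using pos by (simp add: power2_eq_square field_simps)
    finally show "(dx i T p)\<^sup>2 \<le> B\<^sup>2 / ?c * dissipation p"
      by (simp only: times_divide_eq_right times_divide_eq_left)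
  qed
qed

lemmas half_order_intros = half_order_add half_order_diff half_order_cmult half_order_mult half_order_partial
  half_order_sum[OF windows_W]

lemma half_order_dx_ln_T: "half_order W (dx i (\<lambda>p. ln (T p)))"
  by (rule half_order_cong[OF half_order_mult_right[OF half_order_dx_T[of i] smooth_bounded_inverse(2)]])
    (simp add: partial_c_ln[OF tame_partially_differentiable[OF tame_0(2)] T_pos])

text \<open>In the temperature equation solved for div u, every term except the time derivative of
  ln T contains the strain or a space derivative of T. The gradient of the exceptional term is the
  time derivative of grad ln T.\<close>

lemma half_order_dx_divu: "half_order W (dx i divu)"
proof -
  let ?n = "real CARD('n) / 2"
  \<comment> \<open>The temperature equation divided by \<rho> T, with the contraction of grad u
    against the strain replaced by the squared strain, so that each summand has a small
    factor.\<close>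
  define h where "h p = inverse (\<rho> p) * (inverse (T p) * (2 * \<mu> * (\<Sum>i\<in>UNIV. \<Sum>j\<in>UNIV. strain u i j p * strain u i j p)
      + ?n * \<kappa> * (\<Sum>j\<in>UNIV. dx j (dx j T) p))) - ?n * (\<Sum>j\<in>UNIV. u p $ j * dx j (\<lambda>q. ln (T q)) p)" for p
  have h: "half_order W h"
    unfolding h_def[abs_def]
    by (intro half_order_intros half_order_strain half_order_dx_T half_order_dx_ln_T smooth_bounded_inverse
        smooth_bounded_strain smooth_bounded_solution)
  have tl: "tame 0 (\<lambda>q. ln (T q))" by (rule tame_T_ln[OF tame_0(2)])
  have eq: "h p - ?n * dt (\<lambda>q. ln (T q)) p = divu p" if p: "fst p > 0" for p
  proof -
    have "material T p = T p * material (\<lambda>q. ln (T q)) p"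
      using T_pos[OF p] by (simp add: material_ln_T[OF p])
    then have "?n * (\<rho> p * (T p * material (\<lambda>q. ln (T q)) p)) + \<rho> p * T p * divu p =
      2 * \<mu> * (\<Sum>i\<in>UNIV. \<Sum>j\<in>UNIV. strain u i j p * strain u i j p) + ?n * \<kappa> * (\<Sum>j\<in>UNIV. dx j (dx j T) p)"
      using temperature[OF p] by (simp add: strain_dissipation power2_eq_square)
    then have "h p = inverse (\<rho> p) * (inverse (T p) * (?n * (\<rho> p * (T p * material (\<lambda>q. ln (T q)) p)) + \<rho> p * T p * divu p))
        - ?n * (\<Sum>j\<in>UNIV. u p $ j * dx j (\<lambda>q. ln (T q)) p)"
      by (simp only: h_def)
    also have "\<dots> = ?n * material (\<lambda>q. ln (T q)) p + divu p - ?n * (\<Sum>j\<in>UNIV. u p $ j * dx j (\<lambda>q. ln (T q)) p)"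
      using rho_pos[OF p] T_pos[OF p] by (simp add: field_simps)
    finally show ?thesis by (simp add: material_def algebra_simps)
  qed
  have "half_order W (\<lambda>p. dx i h p - ?n * dt (dx i (\<lambda>q. ln (T q))) p)"
    by (intro half_order_intros h half_order_dx_ln_T)
  then show ?thesis
  proof (rule half_order_cong)
    fix p :: "real \<times> (real^'n)" assume p: "fst p > 0"
    have "dx i divu p = dx i (\<lambda>p. h p - ?n * dt (\<lambda>q. ln (T q)) p) p"
      by (rule partial_c_cong[OF eq[symmetric] p])
    also have "\<dots> = dx i h p - dx i (\<lambda>p. ?n * dt (\<lambda>q. ln (T q)) p) p"
      by (intro tame_partial_diff[of 0] half_order_tame[OF h] tame_intros tl p)
    also have "dx i (\<lambda>p. ?n * dt (\<lambda>q. ln (T q)) p) p = ?n * dx i (dt (\<lambda>q. ln (T q))) p"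
      by (rule tame_partial_cmult[OF tame_0_partial[OF tl] p])
    finally show "dx i h p - ?n * dt (dx i (\<lambda>q. ln (T q))) p = dx i divu p"
      using partial_commute[OF tl p, of "Some i" None] by simp
  qed
qed

text \<open>With e for the strain and dk for the derivative in direction k: dk dk u_i = 2 dk e_ik +
  c dk div u - di dk u_k, where c is 2/N for i = k and 0 otherwise, and dk u_k = e_kk + div u / N.
  Only derivatives of the strain and of div u remain.\<close>

lemma half_order_dx_u: "half_order W (dx k (\<lambda>q. u q $ i))"
proof (rule half_order_periodic_dx[OF _ smooth_bounded_solution(3) periodic(3)])
  let ?c = "2 / real CARD('n) * (if i = k then 1 else 0)"
  have "half_order W (\<lambda>p. (2 * dx k (strain u i k) p + ?c * dx k divu p)
      - (dx i (strain u k k) p + 1 / real CARD('n) * dx i divu p))"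
    by (intro half_order_intros half_order_strain half_order_dx_divu)
  then show "half_order W (dx k (dx k (\<lambda>q. u q $ i)))"
  proof (rule half_order_cong)
    fix p :: "real \<times> (real^'n)" assume p: "fst p > 0"
    have ts: "tame 0 (strain u i j)" "tame 0 divu" for i j
      using smooth_bounded_strain smooth_bounded_divu by blast+
    have "dx k (\<lambda>q. u q $ i) = (\<lambda>p. (2 * strain u i k p + ?c * divu p) - dx i (\<lambda>q. u q $ k) p)"
      using sym_gradient[of k i] by (auto simp: fun_eq_iff algebra_simps)
    then have "dx k (dx k (\<lambda>q. u q $ i)) p = dx k (\<lambda>p. (2 * strain u i k p + ?c * divu p) - dx i (\<lambda>q. u q $ k) p) p"
      by simp
    also have "\<dots> = dx k (\<lambda>p. 2 * strain u i k p + ?c * divu p) p - dx k (dx i (\<lambda>q. u q $ k)) p"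
      by (intro tame_partial_diff[of 0] tame_intros ts tame_0 p)
    also have "dx k (\<lambda>p. 2 * strain u i k p + ?c * divu p) p = dx k (\<lambda>p. 2 * strain u i k p) p + dx k (\<lambda>p. ?c * divu p) p"
      by (intro tame_partial_add[of 0] tame_intros ts p)
    also have "dx k (\<lambda>p. 2 * strain u i k p) p = 2 * dx k (strain u i k) p"
      by (rule tame_partial_cmult[OF ts(1) p])
    also have "dx k (\<lambda>p. ?c * divu p) p = ?c * dx k divu p"
      by (rule tame_partial_cmult[OF ts(2) p])
    also have "dx k (dx i (\<lambda>q. u q $ k)) p = dx i (dx k (\<lambda>q. u q $ k)) p"
      by (rule partial_commute[OF tame_0(3) p])
    also have "dx k (\<lambda>q. u q $ k) = (\<lambda>p. strain u k k p + 1 / real CARD('n) * divu p)"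
    proof
      show "dx k (\<lambda>q. u q $ k) p = strain u k k p + 1 / real CARD('n) * divu p" for p
        using sym_gradient[of k k p] by (simp add: field_simps)
    qed
    also have "dx i (\<lambda>p. strain u k k p + 1 / real CARD('n) * divu p) p =
        dx i (strain u k k) p + dx i (\<lambda>p. 1 / real CARD('n) * divu p) p"
      by (intro tame_partial_add[of 0] tame_intros ts p)
    also have "dx i (\<lambda>p. 1 / real CARD('n) * divu p) p = 1 / real CARD('n) * dx i divu p"
      by (rule tame_partial_cmult[OF ts(2) p])
    finally show "(2 * dx k (strain u i k) p + ?c * dx k divu p)
      - (dx i (strain u k k) p + 1 / real CARD('n) * dx i divu p) = dx k (dx k (\<lambda>q. u q $ i)) p" by (rule sym)
  qed
qed

text \<open>The momentum equation divided by \<rho> T reads di ln \<rho> = g - (1/T) dt u_i with g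
  small. After one more derivative in direction i the last term consists of products containing di
  (1/T) or dt di u_i, both small.\<close>

lemma half_order_dx_rho: "half_order W (dx i \<rho>)"
proof -
  let ?ui = "\<lambda>q. u q $ i"
  define g where "g p = inverse (T p) * (2 * \<mu> * (inverse (\<rho> p) * (\<Sum>j\<in>UNIV. dx j (strain u i j) p))
      - (\<Sum>j\<in>UNIV. u p $ j * dx j ?ui p) - dx i T p)" for p
  have g: "half_order W g"
    unfolding g_def[abs_def]
    by (intro half_order_intros half_order_strain half_order_dx_T half_order_dx_u smooth_bounded_inverse
        smooth_bounded_solution)
  have dln: "dx i (\<lambda>q. ln (\<rho> q)) p = dx i \<rho> p * inverse (\<rho> p)" if "fst p > 0" for p
    by (rule partial_c_ln[OF tame_partially_differentiable[OF tame_0(1)] rho_pos that])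
  have eq: "dx i (\<lambda>q. ln (\<rho> q)) p = g p - inverse (T p) * dt ?ui p" if p: "fst p > 0" for p
  proof -
    have "dx i (\<lambda>q. \<rho> q * T q) p = dx i \<rho> p * T p + \<rho> p * dx i T p"
      by (rule tame_partial_mult[OF tame_0(1,2) p])
    with momentum[OF p, of i] have "\<rho> p * (dt ?ui p + (\<Sum>j\<in>UNIV. u p $ j * dx j ?ui p)) =
      2 * \<mu> * (\<Sum>j\<in>UNIV. dx j (strain u i j) p) - (dx i \<rho> p * T p + \<rho> p * dx i T p)"
      by (simp add: material_def)
    then have e: "dx i \<rho> p = inverse (T p) * (2 * \<mu> * (\<Sum>j\<in>UNIV. dx j (strain u i j) p)
        - \<rho> p * (dt ?ui p + (\<Sum>j\<in>UNIV. u p $ j * dx j ?ui p)) - \<rho> p * dx i T p)"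
      using T_pos[OF p] by (simp add: field_simps)
    show ?thesis
      unfolding dln[OF p] g_def by (subst e) (use T_pos[OF p] rho_pos[OF p] in \<open>simp add: field_simps\<close>)
  qed
  have tu: "tame 0 (dt ?ui)" "tame 0 (\<lambda>q. inverse (T q))"
    by (intro tame_0_partial tame_0 tame_T_inverse)+
  have "smooth_bounded (\<lambda>p. - (inverse (T p) * inverse (T p)))"
    by (intro allI tame_intros smooth_bounded_inverse[rule_format])
  from half_order_mult_right[OF half_order_dx_T[of i] this]
  have "half_order W (dx i (\<lambda>q. inverse (T q)))"
    by (rule half_order_cong)
      (simp add: partial_c_inverse[OF tame_partially_differentiable[OF tame_0(2)] T_pos])
  then have "half_order W (\<lambda>p. dx i g p - (dx i (\<lambda>q. inverse (T q)) p * dt ?ui p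
      + inverse (T p) * dt (dx i ?ui) p))"
    by (intro half_order_diff half_order_add half_order_partial[OF g]
        half_order_mult_right[OF _ smooth_bounded_partial[OF smooth_bounded_solution(3)]]
        half_order_mult[OF half_order_partial[OF half_order_dx_u] smooth_bounded_inverse(2)])
  then have "half_order W (dx i (dx i (\<lambda>q. ln (\<rho> q))))"
  proof (rule half_order_cong)
    fix p :: "real \<times> (real^'n)" assume p: "fst p > 0"
    have "dx i (dx i (\<lambda>q. ln (\<rho> q))) p = dx i (\<lambda>p. g p - inverse (T p) * dt ?ui p) p"
      by (rule partial_c_cong[OF eq p])
    also have "\<dots> = dx i g p - dx i (\<lambda>p. inverse (T p) * dt ?ui p) p"
      by (intro tame_partial_diff[of 0] half_order_tame[OF g] tame_mult tu p)
    also have "dx i (\<lambda>p. inverse (T p) * dt ?ui p) p =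
        dx i (\<lambda>q. inverse (T q)) p * dt ?ui p + inverse (T p) * dx i (dt ?ui) p"
      by (rule tame_partial_mult[OF tu(2,1) p])
    also have "dx i (dt ?ui) p = dt (dx i ?ui) p" by (rule partial_commute[OF tame_0(3) p])
    finally show "dx i g p - (dx i (\<lambda>q. inverse (T q)) p * dt ?ui p + inverse (T p) * dt (dx i ?ui) p)
      = dx i (dx i (\<lambda>q. ln (\<rho> q))) p" by (rule sym)
  qed
  then have "half_order W (dx i (\<lambda>q. ln (\<rho> q)))"
    using half_order_periodic_dx tame_rho_ln smooth_bounded_solution(1) periodic(1)
    by (metis (no_types, lifting) periodic_x_def)
  then have "half_order W (\<lambda>p. \<rho> p * dx i (\<lambda>q. ln (\<rho> q)) p)"
    by (rule half_order_mult[OF _ smooth_bounded_solution(1)])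
  then show ?thesis
    by (rule half_order_cong) (use rho_pos in \<open>simp add: dln less_imp_neq[THEN not_sym]\<close>)
qed

end

section \<open>Distance to equilibrium and the difference inequality for H\<close>

lemma torus_int_add:
  "tame m f \<Longrightarrow> tame m g \<Longrightarrow> t > 0 \<Longrightarrow>
    torus_int (\<lambda>x. f (t, x) + g (t, x)) = torus_int (\<lambda>x. f (t, x)) + torus_int (\<lambda>x. g (t, x))"
  unfolding torus_int_def by (intro integral_add tame_slice_integrable)

lemma torus_int_cmult: "torus_int (\<lambda>x. a * f x) = a * torus_int f"
  by (simp add: torus_int_def)

lemma torus_int_const [simp]: "torus_int (\<lambda>x. a) = a"
  by (simp add: torus_int_def)

text \<open>Everything follows from 1 - 1/x \<le> ln x \<le> x - 1, so the quadratic upper bounds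
  hold globally and not merely near 1.\<close>

lemma relative_entropy_bounds:
  fixes r \<theta> :: real
  assumes "r > 0" "\<theta> > 0"
  shows "0 \<le> r * ln r - r + 1" "r * ln r - r + 1 \<le> (r - 1) * (r - 1)"
    "0 \<le> \<theta> - 1 - ln \<theta>" "\<theta> - 1 - ln \<theta> \<le> inverse \<theta> * ((\<theta> - 1) * (\<theta> - 1))"
proof -
  have 1: "ln x \<le> x - 1" "1 - inverse x \<le> ln x" if "x > 0" for x :: real
    using ln_le_minus_one[OF that] ln_le_minus_one[of "inverse x"] that by (auto simp: ln_inverse)
  have "r * (1 - inverse r) \<le> r * ln r" "r * ln r \<le> r * (r - 1)"
    using 1[OF assms(1)] assms(1) by (auto intro: mult_left_mono)
  then show "0 \<le> r * ln r - r + 1" "r * ln r - r + 1 \<le> (r - 1) * (r - 1)"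
    using assms(1) by (auto simp: algebra_simps)
  have "inverse \<theta> * ((\<theta> - 1) * (\<theta> - 1)) = \<theta> - 2 + inverse \<theta>"
    using assms(2) by (simp add: field_simps)
  then show "0 \<le> \<theta> - 1 - ln \<theta>" "\<theta> - 1 - ln \<theta> \<le> inverse \<theta> * ((\<theta> - 1) * (\<theta> - 1))"
    using 1[OF assms(2)] by linarith+
qed

context navier_stokes
begin

text \<open>The weight is 1 here and \<open>\<rho>\<close> for u and T, matching the conserved
  quantities; for \<open>\<rho>\<close> and u the mean is exact and its error constant is 0.\<close>

lemma half_order_rho: "half_order W (\<lambda>p. \<rho> p - 1)"
  by (rule half_orderI_mean[OF windows_W _ smooth_bounded_solution(1) periodic(1), where w = "\<lambda>_. 1"])
    (auto simp: half_order_dx_rho dest!: windowsD[OF windows_W] intro!: exI[of _ 0] norm_mass)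

lemma half_order_u: "half_order W (\<lambda>p. u p $ i)"
proof -
  have "half_order W (\<lambda>p. u p $ i - 0)"
    by (rule half_orderI_mean[OF windows_W smooth_bounded_solution(1) smooth_bounded_solution(3) periodic(3)])
      (auto simp: half_order_dx_u less_imp_le[OF rho_pos] dest!: windowsD[OF windows_W]
        intro!: exI[of _ 0] norm_mass norm_mom)
  then show ?thesis by simp
qed

text \<open>Written as a sum of two-factor products so that the product rules for small fields apply
  to each summand; \<open>kinetic_norm\<close> gives the usual form.\<close>

definition kinetic :: "'n field" where
  "kinetic p = (\<Sum>i\<in>UNIV. (1/2 * \<rho> p * u p $ i) * u p $ i)"

lemma kinetic_norm: "kinetic p = \<rho> p * (norm (u p))\<^sup>2 / 2"
  unfolding norm_u kinetic_def by (simp add: sum_distrib_left sum_divide_distrib power2_eq_square mult.assoc)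

lemma smooth_bounded_kinetic: "smooth_bounded kinetic"
  unfolding kinetic_def[abs_def] by (intro allI tame_intros smooth_bounded_solution[rule_format])

lemma half_order_kinetic: "half_order W kinetic"
  unfolding kinetic_def[abs_def]
  by (intro half_order_sum[OF windows_W] half_order_mult half_order_u allI tame_intros
      smooth_bounded_solution[rule_format])

lemma mean_temperature:
  "t > 0 \<Longrightarrow> torus_int (\<lambda>x. \<rho> (t, x) * T (t, x)) - 1 = - (2 / real CARD('n)) * torus_int (\<lambda>x. kinetic (t, x))"
  using norm_energy[of t] by (simp add: kinetic_norm field_simps)

text \<open>By the energy normalization the \<rho>-weighted mean of T differs from 1 by 2/N times
  the kinetic energy, which is small because u is.\<close>

lemma half_order_T: "half_order W (\<lambda>p. T p - 1)"
proof (rule half_orderI_mean[OF windows_W smooth_bounded_solution(1,2) periodic(2)])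
  fix \<alpha> :: real assume "\<alpha> < 1/2"
  then have "small_on W \<alpha> kinetic" using half_order_kinetic by (simp add: half_order_def)
  then obtain C where C: "\<And>t \<eta> s. (t, \<eta>) \<in> W \<Longrightarrow> t \<le> s \<Longrightarrow> s \<le> t + 1 \<Longrightarrow>
      \<bar>torus_int (\<lambda>x. kinetic (s, x))\<bar> \<le> C * \<eta> powr \<alpha>"
    using small_on_torus_int[OF windows_W, of 0 kinetic] smooth_bounded_kinetic by blast
  have "\<bar>torus_int (\<lambda>x. \<rho> (s, x) * T (s, x)) - 1\<bar> \<le> (2 / real CARD('n) * C) * \<eta> powr \<alpha>"
    if *: "(t, \<eta>) \<in> W" "t \<le> s" "s \<le> t + 1" for t \<eta> s
  proof -
    have "s > 0" using windowsD[OF windows_W *(1)] * by auto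
    then have "\<bar>torus_int (\<lambda>x. \<rho> (s, x) * T (s, x)) - 1\<bar> = 2 / real CARD('n) * \<bar>torus_int (\<lambda>x. kinetic (s, x))\<bar>"
      by (simp add: mean_temperature abs_mult)
    also have "\<dots> \<le> 2 / real CARD('n) * (C * \<eta> powr \<alpha>)"
      using C[OF *] by (intro mult_left_mono) auto
    finally show ?thesis by simp
  qed
  then show "\<exists>C. \<forall>t \<eta> s. (t, \<eta>) \<in> W \<longrightarrow> t \<le> s \<longrightarrow> s \<le> t + 1 \<longrightarrow>
      \<bar>torus_int (\<lambda>x. \<rho> (s, x) * T (s, x)) - 1\<bar> \<le> C * \<eta> powr \<alpha>" by blast
qed (auto simp: norm_mass half_order_dx_T less_imp_le[OF rho_pos])

text \<open>By the three conservation laws, H is the integral of this non-negative relative entropy.\<close>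

definition relative_entropy :: "'n field" where
  "relative_entropy p = (\<rho> p * entropy p + kinetic p) + (1 + (real CARD('n) / 2 * (\<rho> p * T p) + (- 1 - real CARD('n) / 2) * \<rho> p))"

text \<open>The weight \<rho>/T comes from the upper bound for \<theta> - 1 - ln \<theta>. Up to
  bounded factors every summand is a product of two small fields.\<close>

definition quadratic_distance :: "'n field" where
  "quadratic_distance p = (\<rho> p - 1) * (\<rho> p - 1)
     + (real CARD('n) / 2 * (\<rho> p * inverse (T p)) * ((T p - 1) * (T p - 1)) + kinetic p)"

text \<open>Kinetic and thermal energy together integrate to N/2, the constant to 1 and the last
  term to -1 - N/2, so the added terms contribute nothing.\<close>

lemma H_relative_entropy:
  assumes t: "t > 0" shows "H t = torus_int (\<lambda>x. relative_entropy (t, x))"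
proof -
  have tame: "tame 0 (\<lambda>p. \<rho> p * entropy p)" "tame 0 kinetic"
    using smooth_bounded_entropy smooth_bounded_kinetic by blast+
  let ?n = "real CARD('n) / 2"
  let ?f = "\<lambda>p. ?n * (\<rho> p * T p)" and ?g = "\<lambda>p. (- 1 - ?n) * \<rho> p"
  have f: "tame 0 ?f" "tame 0 ?g" by (intro tame_intros tame_0)+
  have "torus_int (\<lambda>x. relative_entropy (t, x)) =
      torus_int (\<lambda>x. \<rho> (t, x) * entropy (t, x) + kinetic (t, x)) + torus_int (\<lambda>x. 1 + (?f (t, x) + ?g (t, x)))"
    unfolding relative_entropy_def
    by (rule torus_int_add[OF tame_add[OF tame] tame_add[OF tame_const tame_add[OF f]] t])
  also have "torus_int (\<lambda>x. \<rho> (t, x) * entropy (t, x) + kinetic (t, x)) = H t + torus_int (\<lambda>x. kinetic (t, x))"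
    unfolding H_def by (rule torus_int_add[OF tame t])
  also have "torus_int (\<lambda>x. 1 + (?f (t, x) + ?g (t, x))) = torus_int (\<lambda>x::real^'n. 1) + torus_int (\<lambda>x. ?f (t, x) + ?g (t, x))"
    by (rule torus_int_add[OF tame_const tame_add[OF f] t])
  also have "torus_int (\<lambda>x. ?f (t, x) + ?g (t, x)) = torus_int (\<lambda>x. ?f (t, x)) + torus_int (\<lambda>x. ?g (t, x))"
    by (rule torus_int_add[OF f t])
  finally have "torus_int (\<lambda>x. relative_entropy (t, x)) = H t + torus_int (\<lambda>x. kinetic (t, x))
      + (1 + (?n * torus_int (\<lambda>x. \<rho> (t, x) * T (t, x)) + (- 1 - ?n) * torus_int (\<lambda>x. \<rho> (t, x))))"
    unfolding torus_int_cmult torus_int_const .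
  moreover have "torus_int (\<lambda>x. kinetic (t, x)) = real CARD('n) / 2 - real CARD('n) / 2 * torus_int (\<lambda>x. \<rho> (t, x) * T (t, x))"
    using norm_energy[OF t] by (simp add: kinetic_norm)
  ultimately show ?thesis unfolding norm_mass[OF t] by simp
qed

lemma relative_entropy_quadratic:
  assumes p: "fst p > 0"
  shows "0 \<le> relative_entropy p" "relative_entropy p \<le> quadratic_distance p"
proof -
  note pos = rho_pos[OF p] T_pos[OF p]
  note b = relative_entropy_bounds[OF pos]
  let ?n = "real CARD('n) / 2"
  have eq: "relative_entropy p = (\<rho> p * ln (\<rho> p) - \<rho> p + 1) + (?n * \<rho> p * (T p - 1 - ln (T p)) + kinetic p)"
    by (simp add: relative_entropy_def entropy_def field_simps)
  have "kinetic p \<ge> 0" using pos by (simp add: kinetic_norm)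
  moreover have "?n * \<rho> p * (T p - 1 - ln (T p)) \<ge> 0" using b(3) pos by simp
  ultimately show "0 \<le> relative_entropy p" unfolding eq using b(1) by linarith
  have "?n * \<rho> p * (T p - 1 - ln (T p)) \<le> ?n * \<rho> p * (inverse (T p) * ((T p - 1) * (T p - 1)))"
    using b(4) pos by (intro mult_left_mono) auto
  also have "\<dots> = ?n * (\<rho> p * inverse (T p)) * ((T p - 1) * (T p - 1))" by simp
  finally show "relative_entropy p \<le> quadratic_distance p"
    unfolding eq quadratic_distance_def using b(2) by linarith
qed

lemma tame_relative_entropy: "tame 0 relative_entropy"
proof -
  have "tame 0 (\<lambda>p. \<rho> p * entropy p)" "tame 0 kinetic"
    using smooth_bounded_entropy smooth_bounded_kinetic by blast+
  then show ?thesis unfolding relative_entropy_def[abs_def] by (intro tame_intros tame_0 tame_entropy)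
qed

lemma tame_quadratic_distance: "tame 0 quadratic_distance"
proof -
  have "tame 0 kinetic" using smooth_bounded_kinetic by blast
  then show ?thesis
    unfolding quadratic_distance_def[abs_def] by (intro tame_intros tame_0 tame_T_inverse)
qed

lemma H_nonneg: "t > 0 \<Longrightarrow> H t \<ge> 0"
  using torus_int_ge_box[OF tame_relative_entropy, of t 0 One 0] relative_entropy_quadratic(1)
  by (simp add: H_relative_entropy)

text \<open>Two factors of order \<alpha>/2 < 1/2 multiply to order \<alpha>; squaring recovers what
  the square root of the dissipation lost.\<close>

lemma small_quadratic_distance:
  assumes "\<alpha> < 1" shows "small_on W \<alpha> quadratic_distance"
proof -
  have h: "small_on W (\<alpha> / 2) g" if "half_order W g" for g :: "'n field"
    using that assms by (simp add: half_order_def)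
  have prod: "small_on W \<alpha> (\<lambda>p. f p * g p)" if "half_order W f" "half_order W g" for f g :: "'n field"
    using small_on_product[OF windows_W h[OF that(1)] h[OF that(2)]] by simp
  have bd: "bounded_pos (\<lambda>p. real CARD('n) / 2 * (\<rho> p * inverse (T p)))"
    by (rule tame_bounded[of 1]) (intro tame_intros tame_1 tame_T_inverse, simp)
  have "half_order W (\<lambda>p. 1/2 * \<rho> p * u p $ i)" for i
    by (intro half_order_mult half_order_u allI tame_intros smooth_bounded_solution[rule_format])
  then have "small_on W \<alpha> kinetic"
    unfolding kinetic_def[abs_def] by (intro small_on_sum prod half_order_u)
  then show ?thesis
    unfolding quadratic_distance_def[abs_def]
    by (intro small_on_add small_on_mult[OF windows_W bd] prod half_order_rho half_order_T)
qed

lemma H_small: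
  assumes "\<alpha> < 1"
  obtains C where "\<And>t \<eta>. (t, \<eta>) \<in> W \<Longrightarrow> H t \<le> C * \<eta> powr \<alpha>"
proof -
  obtain C where C: "\<And>t \<eta> s. (t, \<eta>) \<in> W \<Longrightarrow> t \<le> s \<Longrightarrow> s \<le> t + 1 \<Longrightarrow>
      \<bar>torus_int (\<lambda>x. quadratic_distance (s, x))\<bar> \<le> C * \<eta> powr \<alpha>"
    using small_on_torus_int[OF windows_W tame_quadratic_distance small_quadratic_distance[OF assms]] by blast
  show thesis
  proof (rule that)
    fix t \<eta> assume W: "(t, \<eta>) \<in> W"
    have t: "t > 0" using windowsD[OF windows_W W] by simp
    have "H t \<le> torus_int (\<lambda>x. quadratic_distance (t, x))"
      unfolding H_relative_entropy[OF t] torus_int_def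
      by (intro integral_le tame_slice_integrable[OF tame_relative_entropy t]
          tame_slice_integrable[OF tame_quadratic_distance t]) (use relative_entropy_quadratic t in auto)
    then show "H t \<le> C * \<eta> powr \<alpha>" using C[OF W, of t] by simp
  qed
qed

text \<open>A drop of at most \<eta> would give H(t) \<le> C \<eta>^\<alpha>, and \<eta> is a
  multiple of H(t)^(1/\<alpha>) for which the right side is at most H(t)/2.\<close>

lemma H_gap:
  assumes \<alpha>: "0 < \<alpha>" "\<alpha> < 1"
  shows "\<exists>c>0. \<forall>t>0. c * H t powr (1 / \<alpha>) \<le> H t - H (t + 1)"
proof -
  obtain C where C: "\<And>t \<eta>. (t, \<eta>) \<in> W \<Longrightarrow> H t \<le> C * \<eta> powr \<alpha>"
    using H_small[OF \<alpha>(2)] by blast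
  have tame: "tame 1 (\<lambda>p. \<rho> p * entropy p)" using smooth_bounded_entropy by blast
  then obtain B where B: "\<And>p. fst p > 0 \<Longrightarrow> \<bar>\<rho> p * entropy p\<bar> \<le> B"
    using tame_bounded[OF tame] unfolding bounded_pos_def by auto
  have HB: "H t \<le> B" if "t > 0" for t
    using torus_int_abs_le[OF tame that, of B] B that by (simp add: H_def)
  \<comment> \<open>D \<ge> C makes this choice contradictory, D \<ge> B makes \<eta> at most 1, and
    the entry 1 makes D positive.\<close>
  define D where "D = max (max C B) 1"
  have D: "D > 0" "C \<le> D" "B \<le> D" by (auto simp: D_def)
  define c where "c = (1 / (2 * D)) powr (1 / \<alpha>)"
  have "c * H t powr (1 / \<alpha>) \<le> H t - H (t + 1)" if t: "t > 0" for t
  proof (cases "H t = 0")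
    \<comment> \<open>A window needs \<eta> > 0, so this case is separate: the power of 0 is 0, and
      monotonicity of H suffices.\<close>
    case True
    then show ?thesis using H_antimono[of t "t + 1"] t by simp
  next
    case False
    then have Ht: "H t > 0" using H_nonneg[OF t] by simp
    define \<eta> where "\<eta> = (H t / (2 * D)) powr (1 / \<alpha>)"
    have \<eta>: "\<eta> > 0" "\<eta> powr \<alpha> = H t / (2 * D)"
      using Ht D \<alpha> by (simp_all add: \<eta>_def powr_powr)
    have \<eta>c: "\<eta> = c * H t powr (1 / \<alpha>)"
      using powr_mult[of "1 / (2 * D)" "H t" "1 / \<alpha>"] by (simp add: \<eta>_def c_def)
    have "\<eta> \<le> 1" unfolding \<eta>_def using HB[OF t] D Ht \<alpha> by (intro powr_le1) auto
    have "C * \<eta> powr \<alpha> \<le> D * (H t / (2 * D))"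
      unfolding \<eta>(2) using D Ht by (intro mult_right_mono) auto
    also have "\<dots> < H t" using D Ht by simp
    finally have "(t, \<eta>) \<notin> W" using C[of t \<eta>] by linarith
    then show ?thesis using t \<eta>(1) \<open>\<eta> \<le> 1\<close> unfolding \<eta>c[symmetric] by (auto simp: W_def)
  qed
  moreover have "c > 0" using D by (simp add: c_def)
  ultimately show ?thesis by blast
qed

section \<open>Decay in time and convergence\<close>

lemma half_order_decay:
  assumes "half_order W g" "\<beta> > 0"
  shows "\<exists>C. \<forall>\<^sub>F t in at_top. \<forall>x. \<bar>g (t, x)\<bar> \<le> C * t powr (- \<beta>)"
proof -
  \<comment> \<open>Some positive exponent below 1/2; with 1/4 the window size \<eta> = t^(-4
    \<beta>) produces the rate t^(-\<beta>).\<close>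
  have "small_on W (1/4) g" using assms(1) by (simp add: half_order_def)
  then obtain A where A: "\<And>t \<eta> s x. (t, \<eta>) \<in> W \<Longrightarrow> t \<le> s \<Longrightarrow> s \<le> t + 1 \<Longrightarrow> \<bar>g (s, x)\<bar> \<le> A * \<eta> powr (1/4)"
    unfolding small_on_def by blast
  \<comment> \<open>This makes n/2 at least 4 \<beta> + 1. The extra 1 absorbs the constant C, which
    is at most t for large t.\<close>
  obtain n :: nat where n: "real n \<ge> 8 * \<beta> + 2" using real_arch_simple by blast
  obtain C where C: "\<And>t. t \<ge> 1 \<Longrightarrow> H t \<le> C * t powr (- (real n / 2))"
    using superpolynomial_decay[of H, OF H_antimono H_nonneg H_gap] by blast
  have "\<bar>g (t, x)\<bar> \<le> A * t powr (- \<beta>)" if t: "t \<ge> max 1 \<bar>C\<bar>" for t x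
  proof -
    have t1: "t \<ge> 1" "\<bar>C\<bar> \<le> t" using t by auto
    have "H t - H (t + 1) \<le> H t" using H_nonneg[of "t + 1"] t1 by simp
    also have "\<dots> \<le> C * t powr (- (real n / 2))" using C t1 by blast
    also have "\<dots> \<le> t * t powr (- (real n / 2))" using t1 by (intro mult_right_mono) auto
    also have "\<dots> = t powr (1 - real n / 2)" using t1 powr_add[of t 1 "- (real n / 2)"] by simp
    also have "\<dots> \<le> t powr (- (4 * \<beta>))" using t1 n by (intro powr_mono) auto
    finally have "H t - H (t + 1) \<le> t powr (- (4 * \<beta>))" .
    moreover have "t powr (- (4 * \<beta>)) \<le> t powr 0" using t1 assms(2) by (intro powr_mono) auto
    ultimately have "(t, t powr (- (4 * \<beta>))) \<in> W" using t1 by (simp add: W_def)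
    from A[OF this, of t x] show ?thesis by (simp add: powr_powr)
  qed
  then show ?thesis unfolding eventually_at_top_linorder by blast
qed

text \<open>The conclusion asks for one constant for three fields and all their derivatives up to
  order k; this is a finite family, so a maximum of constants and a common starting time
  exist.\<close>

lemma half_order_uniform_decay:
  assumes "finite F" "\<And>g. g \<in> F \<Longrightarrow> half_order W g" "\<beta> > 0"
  shows "\<exists>C. \<forall>\<^sub>F t in at_top. \<forall>g\<in>F. \<forall>x. \<bar>g (t, x)\<bar> \<le> C * t powr (- \<beta>)"
  using assms(1,2)
proof (induction F)
  case (insert g F)
  obtain C where C: "\<forall>\<^sub>F t in at_top. \<forall>g\<in>F. \<forall>x. \<bar>g (t, x)\<bar> \<le> C * t powr (- \<beta>)"
    using insert by blast
  obtain D where D: "\<forall>\<^sub>F t in at_top. \<forall>x. \<bar>g (t, x)\<bar> \<le> D * t powr (- \<beta>)"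
    using half_order_decay[OF _ assms(3)] insert.prems by blast
  from C D have "\<forall>\<^sub>F t in at_top. \<forall>h\<in>insert g F. \<forall>x. \<bar>h (t, x)\<bar> \<le> max C D * t powr (- \<beta>)"
  proof eventually_elim
    case (elim t)
    have "C * t powr (- \<beta>) \<le> max C D * t powr (- \<beta>)" "D * t powr (- \<beta>) \<le> max C D * t powr (- \<beta>)"
      by (auto intro: mult_right_mono)
    then show ?case using elim by (auto intro: order_trans)
  qed
  then show ?case by blast
qed auto

lemma half_order_iter_partial: "half_order W g \<Longrightarrow> half_order W (iter_partial cs g)"
  by (induction cs) (auto intro: half_order_partial)

theorem convergence_to_equilibrium:
  assumes \<beta>: "\<beta> > 0"
  shows "\<exists>C. \<forall>\<^sub>F t in at_top.
    Ck_bound k (\<lambda>p. \<rho> p - 1) t (C * t powr (-\<beta>)) \<and>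
    Ck_bound k (\<lambda>p. T p - 1) t (C * t powr (-\<beta>)) \<and>
    (\<forall>i. Ck_bound k (\<lambda>p. u p $ i) t (C * t powr (-\<beta>)))"
proof -
  define G where "G = insert (\<lambda>p. \<rho> p - 1) (insert (\<lambda>p. T p - 1) (range (\<lambda>i p. u p $ i)))"
  define L where "L = {cs :: 'n list. length cs \<le> k}"
  define F where "F = (\<lambda>(cs, g). iter_partial (map Some cs) g) ` (L \<times> G)"
  have "finite L" unfolding L_def using finite_lists_length_le[of "UNIV :: 'n set" k] by simp
  then have "finite F" by (simp add: F_def G_def)
  moreover have "half_order W g" if "g \<in> F" for g
    using that half_order_rho half_order_T half_order_u half_order_iter_partial
    by (auto simp: F_def G_def)
  ultimately obtain C where C: "\<forall>\<^sub>F t in at_top. \<forall>g\<in>F. \<forall>x. \<bar>g (t, x)\<bar> \<le> C * t powr (- \<beta>)"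
    using half_order_uniform_decay[OF _ _ \<beta>] by blast
  then have "\<forall>\<^sub>F t in at_top. \<forall>g\<in>G. Ck_bound k g t (C * t powr (- \<beta>))"
  proof eventually_elim
    case (elim t)
    have "iter_partial (map Some cs) g \<in> F" if "g \<in> G" "length cs \<le> k" for g cs
      using that unfolding F_def L_def by force
    then show ?case using elim unfolding Ck_bound_def by blast
  qed
  then show ?thesis unfolding G_def by (intro exI[of _ C]) (auto elim: eventually_mono)
qed

end

theorem theorem16p1:
  fixes \<rho> T :: "real \<times> (real^'n::finite) \<Rightarrow> real"
    and u :: "real \<times> (real^'n) \<Rightarrow> real^'n"
    and \<mu> \<kappa> :: real
  assumes mu_pos: "\<mu> > 0" and kappa_pos: "\<kappa> > 0"
    and smooth: "smooth_pos \<rho>" "smooth_pos T" "\<And>i. smooth_pos (\<lambda>p. u p $ i)"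
    and periodic: "periodic_x \<rho>" "periodic_x T" "\<And>i. periodic_x (\<lambda>p. u p $ i)"
    and mass_eq: "\<And>p. fst p > 0 \<Longrightarrow>
        dt \<rho> p + (\<Sum>i\<in>UNIV. dx i (\<lambda>q. \<rho> q * u q $ i) p) = 0"
    and momentum_eq: "\<And>p i. fst p > 0 \<Longrightarrow>
        dt (\<lambda>q. \<rho> q * u q $ i) p
        + (\<Sum>j\<in>UNIV. dx j (\<lambda>q. \<rho> q * u q $ i * u q $ j) p)
        + dx i (\<lambda>q. \<rho> q * T q) p
        = 2 * \<mu> * (\<Sum>j\<in>UNIV. dx j (strain u i j) p)"
    and energy_eq: "\<And>p. fst p > 0 \<Longrightarrow>
        dt (\<lambda>q. \<rho> q * (norm (u q))\<^sup>2 / 2 + real CARD('n) / 2 * \<rho> q * T q) p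
        + (\<Sum>j\<in>UNIV. dx j (\<lambda>q. \<rho> q * (norm (u q))\<^sup>2 / 2 * u q $ j
              + (real CARD('n) + 2) / 2 * \<rho> q * u q $ j * T q) p)
        = 2 * \<mu> * (\<Sum>j\<in>UNIV. dx j (\<lambda>q. \<Sum>i\<in>UNIV. u q $ i * strain u i j q) p)
          + real CARD('n) / 2 * \<kappa> * (\<Sum>j\<in>UNIV. dx j (dx j T) p)"
    and norm_mass: "\<And>t. t > 0 \<Longrightarrow> torus_int (\<lambda>x. \<rho> (t, x)) = 1"
    and norm_mom: "\<And>t i. t > 0 \<Longrightarrow> torus_int (\<lambda>x. \<rho> (t, x) * u (t, x) $ i) = 0"
    and norm_energy: "\<And>t. t > 0 \<Longrightarrow>
        torus_int (\<lambda>x. \<rho> (t, x) * (norm (u (t, x)))\<^sup>2 / 2)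
        + real CARD('n) / 2 * torus_int (\<lambda>x. \<rho> (t, x) * T (t, x)) = real CARD('n) / 2"
    and bounded: "\<And>k. \<exists>B. \<forall>t>0. Ck_bound k \<rho> t B \<and> Ck_bound k T t B \<and>
        (\<forall>i. Ck_bound k (\<lambda>p. u p $ i) t B)"
    and rho_lower: "\<exists>\<rho>m>0. \<forall>t>0. \<forall>x. \<rho> (t, x) \<ge> \<rho>m"
    and T_lower: "\<exists>Tm>0. \<forall>t>0. \<forall>x. T (t, x) \<ge> Tm"
  shows "\<forall>k. \<forall>\<beta>>0. \<exists>C. \<forall>\<^sub>F t in at_top.
           Ck_bound k (\<lambda>p. \<rho> p - 1) t (C * t powr (-\<beta>)) \<and>
           Ck_bound k (\<lambda>p. T p - 1) t (C * t powr (-\<beta>)) \<and>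
           (\<forall>i. Ck_bound k (\<lambda>p. u p $ i) t (C * t powr (-\<beta>)))"
proof -
  obtain \<rho>m where \<rho>m: "\<rho>m > 0" "\<And>t x. t > 0 \<Longrightarrow> \<rho> (t, x) \<ge> \<rho>m" using rho_lower by blast
  obtain Tm where Tm: "Tm > 0" "\<And>t x. t > 0 \<Longrightarrow> T (t, x) \<ge> Tm" using T_lower by blast
  have lower: "\<rho> p \<ge> \<rho>m" "T p \<ge> Tm" if "fst p > 0" for p
    using \<rho>m(2)[OF that, of "snd p"] Tm(2)[OF that, of "snd p"] by simp_all
  have "navier_stokes \<rho> T u \<mu> \<kappa> \<rho>m Tm"
    by unfold_locales (fact assms \<rho>m(1) Tm(1) lower)+
  then show ?thesis using navier_stokes.convergence_to_equilibrium by blast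
qed

end
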